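(* Let $T>0$, $H\in(0,1)$, and let $W^{H}$ be a one-dimensional fractional Brownian motion with Hurst index $H$. Then there is a constant $C>0$ such that for all real-valued $q_{1},q_{2}\in L^{2}([0,T])$ with ${}_{0}\partial^{\frac{1-2H}{2}}_{t}q_{1},\ {}_{0}\partial^{\frac{1-2H}{2}}_{t}q_{2}\in L^{2}([0,T])$, $$\mathbb{E}\left(\int_{0}^{T}q_{1}(r)\,dW^{H}(r)\int_{0}^{T}q_{2}(r)\,dW^{H}(r)\right)\le C\left\|{}_{0}\partial^{\frac{1-2H}{2}}_{t}q_{1}\right\|_{L^{2}([0,T])}\left\|{}_{0}\partial^{\frac{1-2H}{2}}_{t}q_{2}\right\|_{L^{2}([0,T])}$$ and $$\mathbb{E}\left(\int_{0}^{T}q_{1}(T-r)\,dW^{H}(r)\int_{0}^{T}q_{2}(T-r)\,dW^{H}(r)\right)\le C\left\|{}_{0}\partial^{\frac{1-2H}{2}}_{t}q_{1}\right\|_{L^{2}([0,T])}\left\|{}_{0}\partial^{\frac{1-2H}{2}}_{t}q_{2}\right\|_{L^{2}([0,T])}.$$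
   Context: Riemann–Liouville operators: for $\nu>0$, ${}_{0}\partial^{-\nu}_{t}q(t)=\frac{1}{\Gamma(\nu)}\int_{0}^{t}(t-r)^{\nu-1}q(r)\,dr$ (fractional integral); for $\beta\in(0,1)$, ${}_{0}\partial^{\beta}_{t}q(t)=\frac{1}{\Gamma(1-\beta)}\frac{d}{dt}\int_{0}^{t}(t-r)^{-\beta}q(r)\,dr$ (Riemann–Liouville fractional derivative); ${}_{0}\partial^{0}_{t}q=q$. Thus ${}_{0}\partial_t^{\frac{1-2H}{2}}$ is a fractional derivative if $H<\frac12$, the identity if $H=\frac12$, and a fractional integral if $H>\frac12$. Fractional Brownian motion with Hurst index $H$ is the centered Gaussian process on a complete probability space $(\Omega,\mathbb{F},\mathbb{P})$ with $\mathbb{E}[W^{H}(t)W^{H}(r)]=\frac12(t^{2H}+r^{2H}-|t-r|^{2H})$; $\mathbb{E}$ is expectation. The stochastic integral of a deterministic function $q$ with respect to $W^{H}$ is the Wiener integral, for which the following known identities hold, where for $H<\frac12$ functions on $[0,T]$ are extended by zero to $\mathbb{R}$: - $H\in(0,\frac12)$, $q_1,q_2\in H^{\frac{1-2H}{2}}_{0}([0,T])=\{v\in H^{\frac{1-2H}{2}}(\mathbb{R}):\operatorname{supp}v\subset[0,T]\}$: $\mathbb{E}[\int_0^T q_1dW^H\int_0^T q_2dW^H]=\frac12H(1-2H)\int_{\mathbb{R}}\int_{\mathbb{R}}\frac{(q_1(r_1)-q_1(r_2))(q_2(r_1)-q_2(r_2))}{|r_1-r_2|^{2-2H}}dr_1dr_2$;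 - $H=\frac12$, $q_1,q_2\in L^2([0,T])$: $\mathbb{E}[\int_0^T q_1dW^H\int_0^T q_2dW^H]=\int_0^T q_1q_2\,dr$; - $H\in(\frac12,1)$, $q_1,q_2\in L^2([0,T])$: $\mathbb{E}[\int_0^T q_1dW^H\int_0^T q_2dW^H]=H(2H-1)\int_0^T\int_0^T q_1(r_1)q_2(r_2)|r_1-r_2|^{2H-2}dr_1dr_2$. *)

theory Defs
  imports "HOL-Probability.Probability"
begin

text \<open>
  Elements of \<open>L\<^sup>2([0,T])\<close> are represented by functions on \<^typ>\<open>real\<close>; only their
  values on \<open>{0..T}\<close> matter.
\<close>

definition sq_integrable :: "real \<Rightarrow> (real \<Rightarrow> real) \<Rightarrow> bool" where
  "sq_integrable T q \<longleftrightarrow>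
     q \<in> borel_measurable (lebesgue_on {0..T}) \<and> integrable (lebesgue_on {0..T}) (\<lambda>r. (q r)\<^sup>2)"

definition L2_norm :: "real \<Rightarrow> (real \<Rightarrow> real) \<Rightarrow> real" where
  "L2_norm T q = sqrt (LINT r|lebesgue_on {0..T}. (q r)\<^sup>2)"

definition zero_ext :: "real \<Rightarrow> (real \<Rightarrow> real) \<Rightarrow> real \<Rightarrow> real" where
  "zero_ext T q r = (if r \<in> {0..T} then q r else 0)"

definition RL_integral :: "real \<Rightarrow> (real \<Rightarrow> real) \<Rightarrow> real \<Rightarrow> real" where
  "RL_integral \<nu> q t = 1 / Gamma \<nu> * (LINT r|lebesgue_on {0..t}. (t - r) powr (\<nu> - 1) * q r)"

text \<open>
  The function \<open>g\<close> is the weak derivative of \<open>F\<close> on the open interval from \<open>a\<close> to \<open>b\<close>.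
  The test functions are the continuously differentiable ones with compact support; for
  integrable \<open>F\<close> and \<open>g\<close> this is the same notion as the one with smooth test functions.
\<close>

definition has_weak_derivative :: "real \<Rightarrow> real \<Rightarrow> (real \<Rightarrow> real) \<Rightarrow> (real \<Rightarrow> real) \<Rightarrow> bool" where
  "has_weak_derivative a b F g \<longleftrightarrow>
     integrable (lebesgue_on {a..b}) F \<and> integrable (lebesgue_on {a..b}) g \<and>
     (\<forall>\<phi> \<phi>'. (\<forall>t. (\<phi> has_real_derivative \<phi>' t) (at t)) \<and> continuous_on UNIV \<phi>' \<and>
        (\<exists>c d. a < c \<and> d < b \<and> (\<forall>t. t \<notin> {c..d} \<longrightarrow> \<phi> t = 0)) \<longrightarrow>
        (LINT t|lebesgue_on {a..b}. F t * \<phi>' t) = - (LINT t|lebesgue_on {a..b}. g t * \<phi> t))"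

text \<open>
  \<open>g\<close> represents the Riemann--Liouville derivative of order \<open>\<beta>\<close> (with \<open>0 < \<beta> < 1\<close>) of \<open>q\<close> on
  \<open>[0,T]\<close>. The outer derivative \<open>d/dt\<close> is a weak one. A derivative that merely exists almost
  everywhere would not determine the function being differentiated (Cantor function). Note that
  \<^term>\<open>RL_integral (1 - \<beta>) q t\<close> has the kernel \<open>(t - r)\<close> to the power \<open>-\<beta>\<close> and the factor
  \<open>1 / Gamma (1 - \<beta>)\<close>.
\<close>

definition has_RL_derivative :: "real \<Rightarrow> real \<Rightarrow> (real \<Rightarrow> real) \<Rightarrow> (real \<Rightarrow> real) \<Rightarrow> bool" where
  "has_RL_derivative T \<beta> q g \<longleftrightarrow> has_weak_derivative 0 T (RL_integral (1 - \<beta>) q) g"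

text \<open>
  \<open>g\<close> represents the Riemann--Liouville operator of real order \<open>s\<close> (with \<open>s < 1\<close>) applied to \<open>q\<close>:
  a derivative for positive, the identity for zero, and an integral for negative order.
  The function \<open>g\<close> is determined up to equality almost everywhere on \<open>[0,T]\<close>.
\<close>

definition has_RL :: "real \<Rightarrow> real \<Rightarrow> (real \<Rightarrow> real) \<Rightarrow> (real \<Rightarrow> real) \<Rightarrow> bool" where
  "has_RL T s q g \<longleftrightarrow>
     (if s > 0 then has_RL_derivative T s q g
      else if s = 0 then (AE t in lebesgue_on {0..T}. g t = q t)
      else (AE t in lebesgue_on {0..T}. g t = RL_integral (- s) q t))"

text \<open>Point masses count as (degenerate) Gaussian distributions.\<close>

definition gaussian_rv :: "'a measure \<Rightarrow> ('a \<Rightarrow> real) \<Rightarrow> bool" where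
  "gaussian_rv M X \<longleftrightarrow> X \<in> borel_measurable M \<and>
     ((\<exists>\<mu>. AE \<omega> in M. X \<omega> = \<mu>) \<or>
      (\<exists>\<mu> \<sigma>. 0 < \<sigma> \<and> distributed M lborel X (normal_density \<mu> \<sigma>)))"

definition gaussian_process :: "'a measure \<Rightarrow> 'i set \<Rightarrow> ('i \<Rightarrow> 'a \<Rightarrow> real) \<Rightarrow> bool" where
  "gaussian_process M I W \<longleftrightarrow>
     (\<forall>S c. finite S \<and> S \<subseteq> I \<longrightarrow> gaussian_rv M (\<lambda>\<omega>. \<Sum>t\<in>S. c t * W t \<omega>))"

definition fractional_brownian_motion ::
    "'a measure \<Rightarrow> real \<Rightarrow> (real \<Rightarrow> 'a \<Rightarrow> real) \<Rightarrow> bool" where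
  "fractional_brownian_motion M H W \<longleftrightarrow>
     gaussian_process M {0..} W \<and>
     (\<forall>t\<ge>0. (LINT \<omega>|M. W t \<omega>) = 0) \<and>
     (\<forall>t\<ge>0. \<forall>r\<ge>0. (LINT \<omega>|M. W t \<omega> * W r \<omega>)
        = 1 / 2 * (t powr (2 * H) + r powr (2 * H) - \<bar>t - r\<bar> powr (2 * H)))"

text \<open>
  A step function on \<open>[0,T]\<close> is given by a list of triples \<open>(c, a, b)\<close>, each standing for \<open>c\<close>
  times the indicator function of \<open>{a<..b}\<close>. The intervals may overlap.
\<close>

definition step_list :: "real \<Rightarrow> (real \<times> real \<times> real) list \<Rightarrow> bool" where
  "step_list T xs \<longleftrightarrow> (\<forall>(c, a, b)\<in>set xs. 0 \<le> a \<and> a \<le> b \<and> b \<le> T)"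

definition step_fun :: "(real \<times> real \<times> real) list \<Rightarrow> real \<Rightarrow> real" where
  "step_fun xs r = (\<Sum>(c, a, b)\<leftarrow>xs. c * indicator {a<..b} r)"

definition step_integral ::
    "(real \<Rightarrow> 'a \<Rightarrow> real) \<Rightarrow> (real \<times> real \<times> real) list \<Rightarrow> 'a \<Rightarrow> real" where
  "step_integral W xs \<omega> = (\<Sum>(c, a, b)\<leftarrow>xs. c * (W b \<omega> - W a \<omega>))"

text \<open>
  The square of the norm of the space of integrands: \<open>L\<^sup>2([0,T])\<close> for \<open>H \<ge> 1/2\<close>, and for
  \<open>H < 1/2\<close> the fractional Sobolev (Sobolev--Slobodeckij) space of order \<open>s = (1 - 2 * H) / 2\<close>
  on the whole line, applied to the extension by zero; the exponent \<open>2 - 2 * H\<close> below is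
  \<open>1 + 2 * s\<close>.
\<close>

definition integrand_norm2 :: "real \<Rightarrow> real \<Rightarrow> (real \<Rightarrow> real) \<Rightarrow> ennreal" where
  "integrand_norm2 H T q =
     (\<integral>\<^sup>+ r. ennreal ((zero_ext T q r)\<^sup>2) \<partial>lebesgue) +
     (if H < 1 / 2
      then (\<integral>\<^sup>+ r1. (\<integral>\<^sup>+ r2. ennreal ((zero_ext T q r1 - zero_ext T q r2)\<^sup>2
              / \<bar>r1 - r2\<bar> powr (2 - 2 * H)) \<partial>lebesgue) \<partial>lebesgue)
      else 0)"

text \<open>
  The Wiener integral is the continuous extension of the elementary integral of step functions:
  \<open>X\<close> is the limit in mean square of elementary integrals of step functions which converge
  to \<open>q\<close> in the space of integrands. It is determined up to almost sure equality, and
  \<open>wiener_integral\<close> picks one version. For \<open>H > 1/2\<close> the mean square norm of the elementary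
  integral is dominated by the \<open>L\<^sup>2\<close> norm, so that convergence in \<open>L\<^sup>2\<close> suffices.
\<close>

definition has_wiener_integral ::
    "'a measure \<Rightarrow> (real \<Rightarrow> 'a \<Rightarrow> real) \<Rightarrow> real \<Rightarrow> real \<Rightarrow> (real \<Rightarrow> real) \<Rightarrow> ('a \<Rightarrow> real) \<Rightarrow> bool" where
  "has_wiener_integral M W H T q X \<longleftrightarrow>
     sq_integrable T q \<and> X \<in> borel_measurable M \<and> integrable M (\<lambda>\<omega>. (X \<omega>)\<^sup>2) \<and>
     (\<exists>xs. (\<forall>n. step_list T (xs n)) \<and>
        ((\<lambda>n. integrand_norm2 H T (\<lambda>r. step_fun (xs n) r - q r)) \<longlonglongrightarrow> 0) \<and>
        ((\<lambda>n. \<integral>\<^sup>+ \<omega>. ennreal ((step_integral W (xs n) \<omega> - X \<omega>)\<^sup>2) \<partial>M) \<longlonglongrightarrow> 0))"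

definition wiener_integral ::
    "'a measure \<Rightarrow> (real \<Rightarrow> 'a \<Rightarrow> real) \<Rightarrow> real \<Rightarrow> real \<Rightarrow> (real \<Rightarrow> real) \<Rightarrow> 'a \<Rightarrow> real" where
  "wiener_integral M W H T q = (SOME X. has_wiener_integral M W H T q X)"

end

theory Submission
  imports Defs
begin

text \<open>
  Put \<open>\<alpha> = H + 1 / 2\<close>, \<open>k(x) = x powr (\<alpha> - 1) / \<Gamma>(\<alpha>)\<close> for \<open>x > 0\<close>, and \<open>k(x) = 0\<close> otherwise. For
  every \<open>H\<close> between 0 and 1, the Riemann--Liouville operator of order \<open>(1 - 2 H) / 2\<close> sends
  the indicator function of \<open>{a<..b}\<close> to \<open>A\<^sub>+ = k(x - a) - k(x - b)\<close>, whether it is a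
  derivative, the identity or an integral. Let \<open>A\<^sub>-\<close> be the mirror image \<open>k(b - x) - k(a - x)\<close>. Both
  extend linearly to step functions \<open>f\<close>. Let \<open>E f\<close> be the variance of the elementary integral of \<open>f\<close>.
  The theorem rests on two identities.

  \<^item> The squared \<open>L\<^sup>2\<close> norm of \<open>A\<^sub>- f\<close> over the whole line is a constant times \<open>E f\<close>. By scaling,
    the squared norm of \<open>k(t - x) - k(r - x)\<close> is a constant times \<open>\<bar>t - r\<bar>\<close> to the power \<open>2 H\<close>, and
    by polarization the norms of the increments determine the whole quadratic form.
  \<^item> The inner product of \<open>A\<^sub>+ f\<close> and \<open>A\<^sub>- f\<close> is \<open>E f / \<Gamma>(2 H + 1)\<close>, by the Beta integral.

  As \<open>A\<^sub>+ f\<close> vanishes to the left of 0 and \<open>A\<^sub>- f\<close> to the right of \<open>T\<close>, only \<open>[0, T]\<close> contributes to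
  the inner product. By Cauchy--Schwarz, \<open>E f\<close> is at most a constant times the \<open>L\<^sup>2([0,T])\<close> norm
  of \<open>A\<^sub>+ f\<close> times the square root of \<open>E f\<close>. Cancelling the root gives the claim for step functions
  (\<open>energy_le_sq_norm_RL\<close>), for all \<open>H\<close> at once.

  It remains to approximate. For an integrand \<open>q\<close> with image \<open>g\<close> one needs step functions that
  converge to \<open>q\<close> in the space of integrands while their images converge to \<open>g\<close> in \<open>L\<^sup>2([0,T])\<close>
  (\<open>RL_step_approximation\<close>). For \<open>H \<ge> 1 / 2\<close> the operator is bounded on \<open>L\<^sup>2([0,T])\<close>, so that any
  approximation of \<open>q\<close> will do. For \<open>H < 1 / 2\<close> one first inverts the weak derivative: \<open>q\<close> is the
  fractional integral of order \<open>1 / 2 - H\<close> of \<open>g\<close> (\<open>RL_derivative_inverse\<close>). The fractional derivatives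
  of step functions are dense in \<open>L\<^sup>2([0,T])\<close> (\<open>step_RL_dense\<close>), so one approximates \<open>g\<close> by them. Their
  fractional integrals are step functions that converge to \<open>q\<close> in \<open>L\<^sup>2\<close>. The energy estimate makes
  them a Cauchy sequence in the Sobolev--Slobodeckij seminorm, whose square is again a constant times
  \<open>E f\<close> on step functions, and Fatou's lemma identifies the limit as \<open>q\<close>.

  Since \<open>E f\<close> is dominated by the norm of the space of integrands, the elementary integrals converge,
  and all versions of the Wiener integral inherit the bound (\<open>wiener_integral_sq_norm_le\<close>). The
  reflection \<open>r \<mapsto> T - r\<close> changes neither the covariances of the increments nor the norm of the
  integrands, which gives the second inequality with the same constant.
\<close>

section \<open>Mean squares and linear functionals of step functions\<close>

text \<open>
  Values in \<open>ennreal\<close> keep limits, suprema and Fatou's lemma free of integrability side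
  conditions.
\<close>

definition sq_norm :: "'b measure \<Rightarrow> ('b \<Rightarrow> real) \<Rightarrow> ennreal" where
  "sq_norm N f = (\<integral>\<^sup>+x. ennreal ((f x)\<^sup>2) \<partial>N)"

text \<open>
  The crude factor 2 replaces the triangle inequality for square roots: only the existence
  of a constant is claimed in the end.
\<close>

lemma sq_norm_add:
  assumes [measurable]: "f \<in> borel_measurable N" "g \<in> borel_measurable N"
  shows "sq_norm N (\<lambda>x. f x + g x) \<le> 2 * sq_norm N f + 2 * sq_norm N g"
proof -
  have "sq_norm N (\<lambda>x. f x + g x) \<le> (\<integral>\<^sup>+x. 2 * ennreal ((f x)\<^sup>2) + 2 * ennreal ((g x)\<^sup>2) \<partial>N)"
    unfolding sq_norm_def
  proof (intro nn_integral_mono)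
    fix x
    have "(f x + g x)\<^sup>2 \<le> 2 * (f x)\<^sup>2 + 2 * (g x)\<^sup>2"
      using zero_le_power2[of "f x - g x"] by (simp add: power2_sum power2_diff)
    then have "ennreal ((f x + g x)\<^sup>2) \<le> ennreal (2 * (f x)\<^sup>2 + 2 * (g x)\<^sup>2)"
      by (rule ennreal_leI)
    also have "\<dots> = 2 * ennreal ((f x)\<^sup>2) + 2 * ennreal ((g x)\<^sup>2)"
      by (simp add: ennreal_plus ennreal_mult')
    finally show "ennreal ((f x + g x)\<^sup>2) \<le> 2 * ennreal ((f x)\<^sup>2) + 2 * ennreal ((g x)\<^sup>2)" .
  qed
  also have "\<dots> = 2 * sq_norm N f + 2 * sq_norm N g"
    unfolding sq_norm_def by (subst nn_integral_add) (auto simp: nn_integral_cmult)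
  finally show ?thesis .
qed

lemma sq_norm_uminus: "sq_norm N (\<lambda>x. - f x) = sq_norm N f"
  by (simp add: sq_norm_def)

lemma sq_norm_commute: "sq_norm N (\<lambda>x. f x - g x) = sq_norm N (\<lambda>x. g x - f x)"
  by (simp add: sq_norm_def power2_commute)

lemma sq_norm_diff:
  assumes "f \<in> borel_measurable N" "g \<in> borel_measurable N"
  shows "sq_norm N (\<lambda>x. f x - g x) \<le> 2 * sq_norm N f + 2 * sq_norm N g"
  using sq_norm_add[of f N "\<lambda>x. - g x"] assms by (simp add: sq_norm_uminus)

lemma sq_norm_triangle:
  assumes "f \<in> borel_measurable N" "g \<in> borel_measurable N" "h \<in> borel_measurable N"
  shows "sq_norm N (\<lambda>x. f x - h x) \<le> 2 * sq_norm N (\<lambda>x. f x - g x) + 2 * sq_norm N (\<lambda>x. g x - h x)"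
  using sq_norm_add[of "\<lambda>x. f x - g x" N "\<lambda>x. g x - h x"] assms by simp

lemma sq_norm_le:
  assumes "f \<in> borel_measurable N" "g \<in> borel_measurable N"
  shows "sq_norm N f \<le> 2 * sq_norm N (\<lambda>x. f x - g x) + 2 * sq_norm N g"
  using sq_norm_add[of "\<lambda>x. f x - g x" N g] assms by simp

lemma sq_norm_cmult:
  assumes [measurable]: "f \<in> borel_measurable N"
  shows "sq_norm N (\<lambda>x. c * f x) = ennreal (c\<^sup>2) * sq_norm N f"
  unfolding sq_norm_def by (simp add: power_mult_distrib ennreal_mult nn_integral_cmult)

lemma sq_norm_cong_AE: "AE x in N. f x = g x \<Longrightarrow> sq_norm N f = sq_norm N g"
  unfolding sq_norm_def by (intro nn_integral_cong_AE) auto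

lemma integrable_sq_iff:
  assumes [measurable]: "f \<in> borel_measurable N"
  shows "integrable N (\<lambda>x. (f x)\<^sup>2) \<longleftrightarrow> sq_norm N f < \<infinity>"
  unfolding sq_norm_def by (subst integrable_iff_bounded) auto

lemma sq_norm_eq_integral:
  assumes "integrable N (\<lambda>x. (f x)\<^sup>2)"
  shows "sq_norm N f = ennreal (LINT x|N. (f x)\<^sup>2)"
  unfolding sq_norm_def using assms by (intro nn_integral_eq_integral) auto

text \<open>
  Cauchy--Schwarz. If the product is not integrable, the integral on the left is 0 by
  convention.
\<close>

lemma integral_mult_sq_le:
  assumes [measurable]: "f \<in> borel_measurable N" "g \<in> borel_measurable N"
  shows "(ennreal \<bar>LINT x|N. f x * g x\<bar>)\<^sup>2 \<le> sq_norm N f * sq_norm N g"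
proof -
  have "ennreal \<bar>LINT x|N. f x * g x\<bar> \<le> (\<integral>\<^sup>+x. ennreal \<bar>f x\<bar> * ennreal \<bar>g x\<bar> \<partial>N)"
    using integral_norm_bound_ennreal[of N "\<lambda>x. f x * g x"]
    by (cases "integrable N (\<lambda>x. f x * g x)") (auto simp: abs_mult ennreal_mult not_integrable_integral_eq)
  then have "(ennreal \<bar>LINT x|N. f x * g x\<bar>)\<^sup>2 \<le> (\<integral>\<^sup>+x. ennreal \<bar>f x\<bar> * ennreal \<bar>g x\<bar> \<partial>N)\<^sup>2"
    by (rule power_mono) simp
  also have "\<dots> \<le> (\<integral>\<^sup>+x. (ennreal \<bar>f x\<bar>)\<^sup>2 \<partial>N) * (\<integral>\<^sup>+x. (ennreal \<bar>g x\<bar>)\<^sup>2 \<partial>N)"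
    by (rule Cauchy_Schwarz_nn_integral) auto
  finally show ?thesis by (simp add: sq_norm_def ennreal_power)
qed

text \<open>
  Cauchy--Schwarz, with the weight split into two square roots.
\<close>

lemma nn_integral_weighted_sq_le:
  assumes [measurable]: "p \<in> borel_measurable N" "f \<in> borel_measurable N" and p: "\<And>x. 0 \<le> p x"
  shows "(\<integral>\<^sup>+x. ennreal (p x * \<bar>f x\<bar>) \<partial>N)\<^sup>2 \<le> (\<integral>\<^sup>+x. ennreal (p x) \<partial>N) * (\<integral>\<^sup>+x. ennreal (p x * (f x)\<^sup>2) \<partial>N)"
proof -
  have "(\<integral>\<^sup>+x. ennreal (p x * \<bar>f x\<bar>) \<partial>N) = (\<integral>\<^sup>+x. ennreal (sqrt (p x)) * ennreal (sqrt (p x) * \<bar>f x\<bar>) \<partial>N)"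
    using p by (intro nn_integral_cong) (simp add: ennreal_mult'[symmetric] mult.assoc[symmetric])
  moreover have "\<dots>\<^sup>2 \<le> (\<integral>\<^sup>+x. (ennreal (sqrt (p x)))\<^sup>2 \<partial>N) * (\<integral>\<^sup>+x. (ennreal (sqrt (p x) * \<bar>f x\<bar>))\<^sup>2 \<partial>N)"
    by (rule Cauchy_Schwarz_nn_integral) measurable
  ultimately show ?thesis using p by (simp add: ennreal_power power_mult_distrib)
qed

text \<open>
  The bilinear extension to step functions of a kernel \<open>K\<close> on pairs of intervals.
\<close>

definition step_form :: "(real \<Rightarrow> real \<Rightarrow> real \<Rightarrow> real \<Rightarrow> real) \<Rightarrow>
    (real \<times> real \<times> real) list \<Rightarrow> (real \<times> real \<times> real) list \<Rightarrow> real" where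
  "step_form K xs ys = (\<Sum>(c, a, b)\<leftarrow>xs. \<Sum>(c', a', b')\<leftarrow>ys. c * c' * K a b a' b')"

lemma step_integral_Nil [simp]: "step_integral W [] x = 0"
  by (simp add: step_integral_def)

lemma step_integral_Cons [simp]:
  "step_integral W ((c, a, b) # xs) x = c * (W b x - W a x) + step_integral W xs x"
  by (simp add: step_integral_def)

lemma step_integral_append [simp]:
  "step_integral W (xs @ ys) x = step_integral W xs x + step_integral W ys x"
  by (simp add: step_integral_def)

lemma step_list_Nil [simp]: "step_list T []"
  by (simp add: step_list_def)

lemma step_list_Cons [simp]:
  "step_list T ((c, a, b) # xs) \<longleftrightarrow> 0 \<le> a \<and> a \<le> b \<and> b \<le> T \<and> step_list T xs"
  by (simp add: step_list_def)

lemma step_list_append [simp]: "step_list T (xs @ ys) \<longleftrightarrow> step_list T xs \<and> step_list T ys"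
  by (simp add: step_list_def ball_Un)

definition step_scale :: "real \<Rightarrow> (real \<times> real \<times> real) list \<Rightarrow> (real \<times> real \<times> real) list" where
  "step_scale k xs = map (\<lambda>(c, a, b). (k * c, a, b)) xs"

lemma step_list_scale [simp]: "step_list T (step_scale k xs) \<longleftrightarrow> step_list T xs"
  by (auto simp: step_scale_def step_list_def)

lemma step_integral_scale [simp]:
  "step_integral W (step_scale k xs) x = k * step_integral W xs x"
  by (induction xs) (auto simp: step_scale_def algebra_simps)

definition step_diff where "step_diff xs ys = xs @ step_scale (- 1) ys"

lemma step_list_diff [simp]: "step_list T (step_diff xs ys) \<longleftrightarrow> step_list T xs \<and> step_list T ys"
  by (simp add: step_diff_def)

lemma step_integral_diff [simp]:
  "step_integral W (step_diff xs ys) x = step_integral W xs x - step_integral W ys x"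
  by (simp add: step_diff_def)

text \<open>
  Step functions, their fractional images, their difference quotients and their elementary
  integrals are all obtained by one construction, applied to different families indexed by
  time.
\<close>

lemma step_fun_eq_step_integral:
  assumes "step_list T xs"
  shows "step_fun xs x = step_integral (\<lambda>t. indicator {0<..t}) xs x"
  using assms
proof (induction xs)
  case (Cons p xs)
  obtain c a b where p: "p = (c, a, b)" by (cases p)
  have "indicator {a<..b} x = (indicator {0<..b} x - indicator {0<..a} x :: real)"
    using Cons.prems p by (auto simp: indicator_def)
  with Cons p show ?case by (simp add: step_fun_def)
qed (simp add: step_fun_def)

lemma borel_measurable_step_integral:
  assumes "step_list T xs" "\<And>t. t \<in> {0..T} \<Longrightarrow> W t \<in> borel_measurable N"
  shows "step_integral W xs \<in> borel_measurable N"
  using assms(1)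
proof (induction xs)
  case Nil
  have "step_integral W [] = (\<lambda>x. 0)" by (simp add: fun_eq_iff)
  then show ?case by simp
next
  case (Cons p xs)
  obtain c a b where p: "p = (c, a, b)" by (cases p)
  have [measurable]: "W a \<in> borel_measurable N" "W b \<in> borel_measurable N"
    "step_integral W xs \<in> borel_measurable N"
    using Cons p by (auto intro!: assms(2))
  have "step_integral W (p # xs) = (\<lambda>x. c * (W b x - W a x) + step_integral W xs x)"
    by (simp add: fun_eq_iff p)
  then show ?case by simp
qed

lemma step_form_Cons:
  "step_form K ((c, a, b) # xs) ys = (\<Sum>(c', a', b')\<leftarrow>ys. c * c' * K a b a' b') + step_form K xs ys"
  by (simp add: step_form_def)

lemma step_form_swap: "step_form K xs ys = step_form (\<lambda>a b a' b'. K a' b' a b) ys xs"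
proof (induction xs)
  case Nil
  then show ?case by (simp add: step_form_def split_def)
next
  case (Cons p xs)
  obtain c a b where p: "p = (c, a, b)" by (cases p)
  have "step_form (\<lambda>a b a' b'. K a' b' a b) ys (p # xs)
      = (\<Sum>(c', a', b')\<leftarrow>ys. c * c' * K a b a' b') + step_form (\<lambda>a b a' b'. K a' b' a b) ys xs"
    by (simp add: step_form_def p split_def sum_list_addf algebra_simps)
  then show ?case by (simp add: p step_form_Cons Cons.IH)
qed

lemma step_form_add:
  "step_form K xs ys + step_form K' xs ys = step_form (\<lambda>a b a' b'. K a b a' b' + K' a b a' b') xs ys"
  by (simp add: step_form_def split_def sum_list_addf[symmetric] algebra_simps)

lemma step_form_cmult:
  "step_form (\<lambda>a b a' b'. k * K a b a' b') xs ys = k * step_form K xs ys"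
  by (simp add: step_form_def split_def sum_list_const_mult[symmetric] algebra_simps)

lemma has_bochner_integral_step_form:
  assumes "\<And>c a b c' a' b'. (c, a, b) \<in> set xs \<Longrightarrow> (c', a', b') \<in> set ys \<Longrightarrow>
      has_bochner_integral N (\<lambda>x. (V b x - V a x) * (W b' x - W a' x)) (K a b a' b')"
  shows "has_bochner_integral N (\<lambda>x. step_integral V xs x * step_integral W ys x) (step_form K xs ys)"
  using assms
proof (induction xs)
  case (Cons p xs)
  obtain c a b where p: "p = (c, a, b)" by (cases p)
  have "has_bochner_integral N (\<lambda>x. (c * (V b x - V a x)) * step_integral W ys x)
     (\<Sum>(c', a', b')\<leftarrow>ys. c * c' * K a b a' b')"
    using Cons.prems
  proof (induction ys)
    case (Cons p' ys)
    obtain c' a' b' where p': "p' = (c', a', b')" by (cases p')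
    have 1: "has_bochner_integral N (\<lambda>x. (c * c') * ((V b x - V a x) * (W b' x - W a' x)))
       ((c * c') * K a b a' b')"
      by (intro has_bochner_integral_mult_right Cons.prems) (auto simp: p p')
    have 2: "has_bochner_integral N (\<lambda>x. (c * (V b x - V a x)) * step_integral W ys x)
     (\<Sum>(c', a', b')\<leftarrow>ys. c * c' * K a b a' b')"
      by (rule Cons.IH) (auto intro: Cons.prems)
    from has_bochner_integral_add[OF 1 2] show ?case
      by (simp add: p' algebra_simps)
  qed (simp add: has_bochner_integral_zero)
  moreover have "has_bochner_integral N (\<lambda>x. step_integral V xs x * step_integral W ys x) (step_form K xs ys)"
    by (rule Cons.IH) (auto intro: Cons.prems)
  ultimately show ?case
    using has_bochner_integral_add by (fastforce simp: p step_form_Cons algebra_simps)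
qed (simp add: step_form_def has_bochner_integral_zero)

text \<open>
  The covariance of two increments of fractional Brownian motion.
\<close>

definition incr_cov :: "real \<Rightarrow> real \<Rightarrow> real \<Rightarrow> real \<Rightarrow> real \<Rightarrow> real" where
  "incr_cov H a b a' b' = (\<bar>b - a'\<bar> powr (2 * H) + \<bar>a - b'\<bar> powr (2 * H)
      - \<bar>b - b'\<bar> powr (2 * H) - \<bar>a - a'\<bar> powr (2 * H)) / 2"

text \<open>
  This will be the variance of the elementary integral. It depends on the distances between
  the end points only, and so links the probabilistic realization of the quadratic form with
  the analytic ones.
\<close>

definition fbm_energy :: "real \<Rightarrow> (real \<times> real \<times> real) list \<Rightarrow> real" where
  "fbm_energy H xs = step_form (incr_cov H) xs xs"

text \<open>
  Polarization: \<open>(x - y) (z - w)\<close> is a linear combination of four squared differences, so a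
  family whose increments have the squared norm of the fractional Brownian ones has, up to
  the factor \<open>k\<close>, the same quadratic form on step functions. It is applied to the process
  itself, to the right-sided fractional kernels and to the difference quotients of the
  Slobodeckij seminorm.
\<close>

lemma sq_norm_step_integral:
  assumes meas: "\<And>t. t \<in> {0..T} \<Longrightarrow> \<Psi> t \<in> borel_measurable N"
    and incr: "\<And>t r. t \<in> {0..T} \<Longrightarrow> r \<in> {0..T} \<Longrightarrow>
        sq_norm N (\<lambda>x. \<Psi> t x - \<Psi> r x) = ennreal (k * \<bar>t - r\<bar> powr (2 * H))"
    and "0 \<le> k" and xs: "step_list T xs"
  shows "sq_norm N (step_integral \<Psi> xs) = ennreal (k * fbm_energy H xs)"
proof -
  have sq: "has_bochner_integral N (\<lambda>x. (\<Psi> t x - \<Psi> r x)\<^sup>2) (k * \<bar>t - r\<bar> powr (2 * H))"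
    if "t \<in> {0..T}" "r \<in> {0..T}" for t r
  proof (rule has_bochner_integral_nn_integral)
    show "(\<lambda>x. (\<Psi> t x - \<Psi> r x)\<^sup>2) \<in> borel_measurable N" using meas that by measurable
    show "(\<integral>\<^sup>+x. ennreal ((\<Psi> t x - \<Psi> r x)\<^sup>2) \<partial>N) = ennreal (k * \<bar>t - r\<bar> powr (2 * H))"
      using incr[OF that] by (simp add: sq_norm_def)
  qed (use \<open>0 \<le> k\<close> in auto)
  have "has_bochner_integral N (\<lambda>x. step_integral \<Psi> xs x * step_integral \<Psi> xs x)
      (step_form (\<lambda>a b a' b'. k * incr_cov H a b a' b') xs xs)"
  proof (rule has_bochner_integral_step_form)
    fix c a b c' a' b' assume "(c, a, b) \<in> set xs" "(c', a', b') \<in> set xs"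
    then have in_T: "a \<in> {0..T}" "b \<in> {0..T}" "a' \<in> {0..T}" "b' \<in> {0..T}"
      using xs by (force simp: step_list_def)+
    have "has_bochner_integral N (\<lambda>x. ((\<Psi> b x - \<Psi> a' x)\<^sup>2 + (\<Psi> a x - \<Psi> b' x)\<^sup>2
        - (\<Psi> b x - \<Psi> b' x)\<^sup>2 - (\<Psi> a x - \<Psi> a' x)\<^sup>2) / 2)
       ((k * \<bar>b - a'\<bar> powr (2 * H) + k * \<bar>a - b'\<bar> powr (2 * H)
      - k * \<bar>b - b'\<bar> powr (2 * H) - k * \<bar>a - a'\<bar> powr (2 * H)) / 2)"
      by (intro has_bochner_integral_divide_zero has_bochner_integral_add has_bochner_integral_diff sq in_T)
    moreover have "((\<Psi> b x - \<Psi> a' x)\<^sup>2 + (\<Psi> a x - \<Psi> b' x)\<^sup>2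
        - (\<Psi> b x - \<Psi> b' x)\<^sup>2 - (\<Psi> a x - \<Psi> a' x)\<^sup>2) / 2
        = (\<Psi> b x - \<Psi> a x) * (\<Psi> b' x - \<Psi> a' x)" for x
      by (simp add: power2_eq_square field_simps)
    moreover have "(k * \<bar>b - a'\<bar> powr (2 * H) + k * \<bar>a - b'\<bar> powr (2 * H)
      - k * \<bar>b - b'\<bar> powr (2 * H) - k * \<bar>a - a'\<bar> powr (2 * H)) / 2 = k * incr_cov H a b a' b'"
      by (simp add: incr_cov_def algebra_simps)
    ultimately show "has_bochner_integral N (\<lambda>x. (\<Psi> b x - \<Psi> a x) * (\<Psi> b' x - \<Psi> a' x))
        (k * incr_cov H a b a' b')" by simp
  qed
  then have *: "has_bochner_integral N (\<lambda>x. (step_integral \<Psi> xs x)\<^sup>2) (k * fbm_energy H xs)"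
    by (simp add: power2_eq_square step_form_cmult fbm_energy_def)
  from sq_norm_eq_integral[of N "step_integral \<Psi> xs"] *
  show "sq_norm N (step_integral \<Psi> xs) = ennreal (k * fbm_energy H xs)"
    by (simp add: has_bochner_integral_iff)
qed

section \<open>The kernel of the Riemann--Liouville operators and the energy estimate\<close>

text \<open>
  Convolution with this function is the fractional integral of order \<open>a\<close>, started at the
  left end of the support.
\<close>

definition rl_kernel :: "real \<Rightarrow> real \<Rightarrow> real" where
  "rl_kernel a x = (if 0 < x then x powr (a - 1) / Gamma a else 0)"

lemma rl_kernel_nonneg: "0 < a \<Longrightarrow> 0 \<le> rl_kernel a x"
  by (simp add: rl_kernel_def Gamma_real_pos less_imp_le)

lemma measurable_rl_kernel [measurable]: "rl_kernel a \<in> borel_measurable borel"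
  unfolding rl_kernel_def by measurable

lemma rl_kernel_nonpos [simp]: "x \<le> 0 \<Longrightarrow> rl_kernel a x = 0"
  by (simp add: rl_kernel_def)

lemma rl_kernel_1: "rl_kernel 1 x = indicator {0<..} x"
  by (simp add: rl_kernel_def indicator_def)

lemma rl_kernel_scale: "0 < h \<Longrightarrow> rl_kernel a (h * x) = h powr (a - 1) * rl_kernel a x"
  by (auto simp: rl_kernel_def powr_mult zero_less_mult_iff)

text \<open>
  The Beta integral, after the substitution \<open>t = u + (x - u) y\<close>. It contains both the
  semigroup law of fractional integrals and the computation of \<open>\<langle>A\<^sub>+ f, A\<^sub>- f\<rangle>\<close>.
\<close>

lemma nn_integral_rl_kernel_conv:
  assumes a: "0 < a" and b: "0 < b"
  shows "(\<integral>\<^sup>+t. ennreal (rl_kernel a (x - t) * rl_kernel b (t - u)) \<partial>lborel) = ennreal (rl_kernel (a + b) (x - u))"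
proof (cases "u < x")
  case False
  then have "rl_kernel a (x - t) * rl_kernel b (t - u) = 0" for t
    by (auto simp: rl_kernel_def)
  then have "(\<lambda>t. ennreal (rl_kernel a (x - t) * rl_kernel b (t - u))) = (\<lambda>t. 0)"
    by (simp only: ennreal_0)
  with False show ?thesis by simp
next
  case True
  define h where "h = x - u"
  have h: "0 < h" using True by (simp add: h_def)
  have Gpos: "0 < Gamma a" "0 < Gamma b" using a b by (auto intro: Gamma_real_pos)
  have "(\<integral>\<^sup>+t. ennreal (rl_kernel a (x - t) * rl_kernel b (t - u)) \<partial>lborel)
      = ennreal \<bar>h\<bar> * (\<integral>\<^sup>+y. ennreal (rl_kernel a (x - (u + h * y)) * rl_kernel b ((u + h * y) - u)) \<partial>lborel)"
    by (rule nn_integral_real_affine) (use h in auto)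
  also have "(\<lambda>y. ennreal (rl_kernel a (x - (u + h * y)) * rl_kernel b ((u + h * y) - u)))
      = (\<lambda>y. ennreal (h powr (a + b - 2) / (Gamma a * Gamma b)) * (ennreal (y powr (b - 1) * (1 - y) powr (a - 1)) * indicator {0..1} y))"
  proof
    fix y
    have e: "x - (u + h * y) = h * (1 - y)" by (simp add: h_def algebra_simps)
    have "rl_kernel a (x - (u + h * y)) * rl_kernel b ((u + h * y) - u)
       = (h powr (a - 1) * h powr (b - 1)) * (rl_kernel a (1 - y) * rl_kernel b y)"
      unfolding e using h by (simp add: rl_kernel_scale)
    also have "h powr (a - 1) * h powr (b - 1) = h powr (a + b - 2)"
      by (simp add: powr_add[symmetric])
    also have "rl_kernel a (1 - y) * rl_kernel b y
        = (y powr (b - 1) * (1 - y) powr (a - 1)) * indicator {0..1} y / (Gamma a * Gamma b)"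
      by (auto simp: rl_kernel_def indicator_def)
    finally have e2: "rl_kernel a (x - (u + h * y)) * rl_kernel b ((u + h * y) - u)
      = h powr (a + b - 2) / (Gamma a * Gamma b) * ((y powr (b - 1) * (1 - y) powr (a - 1)) * indicator {0..1} y)"
      by simp
    then show "ennreal (rl_kernel a (x - (u + h * y)) * rl_kernel b ((u + h * y) - u))
      = ennreal (h powr (a + b - 2) / (Gamma a * Gamma b)) * (ennreal (y powr (b - 1) * (1 - y) powr (a - 1)) * indicator {0..1} y)"
      unfolding e2 ennreal_indicator[symmetric] using Gpos
      by (simp only: ennreal_mult' divide_nonneg_pos mult_pos_pos powr_ge_zero mult_nonneg_nonneg)
  qed
  also have "(\<integral>\<^sup>+y. ennreal (h powr (a + b - 2) / (Gamma a * Gamma b)) *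
       (ennreal (y powr (b - 1) * (1 - y) powr (a - 1)) * indicator {0..1} y) \<partial>lborel)
     = ennreal (h powr (a + b - 2) / (Gamma a * Gamma b)) * (\<integral>\<^sup>+y. ennreal (y powr (b - 1) * (1 - y) powr (a - 1)) * indicator {0..1} y \<partial>lborel)"
    by (rule nn_integral_cmult) measurable
  also have "(\<integral>\<^sup>+y. ennreal (y powr (b - 1) * (1 - y) powr (a - 1)) * indicator {0..1} y \<partial>lborel) = ennreal (Beta b a)"
    by (rule nn_integral_has_integral_lebesgue'[OF _ has_integral_Beta_real[OF b a]]) auto
  also have "ennreal \<bar>h\<bar> * (ennreal (h powr (a + b - 2) / (Gamma a * Gamma b)) * ennreal (Beta b a))
      = ennreal (h * (h powr (a + b - 2) / (Gamma a * Gamma b) * Beta b a))"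
    using h Gpos by (simp only: ennreal_mult' abs_of_pos less_imp_le divide_nonneg_pos mult_pos_pos powr_ge_zero)
  also have "h * (h powr (a + b - 2) / (Gamma a * Gamma b) * Beta b a) = rl_kernel (a + b) h"
  proof -
    have "h * h powr (a + b - 2) = h powr (a + b - 1)"
      using powr_mult_base[of h "a + b - 2"] h by (simp add: algebra_simps)
    then show ?thesis using h Gpos
      by (simp add: rl_kernel_def Beta_def field_simps add.commute)
  qed
  finally show ?thesis by (simp add: h_def)
qed

lemma has_bochner_integral_rl_kernel_conv:
  assumes "0 < a" "0 < b"
  shows "has_bochner_integral lborel (\<lambda>t. rl_kernel a (x - t) * rl_kernel b (t - u)) (rl_kernel (a + b) (x - u))"
  by (rule has_bochner_integral_nn_integral)
     (use assms nn_integral_rl_kernel_conv[OF assms] in \<open>auto intro!: rl_kernel_nonneg mult_nonneg_nonneg simp del: mult_eq_0_iff\<close>)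

text \<open>
  Integration is convolution with the kernel of order 1, the indicator function of the
  positive half-line.
\<close>

lemma nn_integral_rl_kernel:
  assumes "0 < a"
  shows "(\<integral>\<^sup>+t. ennreal (rl_kernel a t) * indicator {..h} t \<partial>lborel) = ennreal (rl_kernel (a + 1) h)"
proof -
  have "AE t in lborel. t \<noteq> h" by (rule AE_lborel_singleton)
  then have "(\<integral>\<^sup>+t. ennreal (rl_kernel a t) * indicator {..h} t \<partial>lborel)
      = (\<integral>\<^sup>+t. ennreal (rl_kernel 1 (h - t) * rl_kernel a (t - 0)) \<partial>lborel)"
    by (intro nn_integral_cong_AE) (auto simp: rl_kernel_1 indicator_def)
  also have "\<dots> = ennreal (rl_kernel (1 + a) (h - 0))"
    by (rule nn_integral_rl_kernel_conv) (use assms in auto)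
  finally show ?thesis by (simp add: add.commute)
qed

lemma rl_kernel_sq:
  assumes "1 / 2 < a"
  shows "(rl_kernel a x)\<^sup>2 = Gamma (2 * a - 1) / (Gamma a)\<^sup>2 * rl_kernel (2 * a - 1) x"
proof -
  have "Gamma (2 * a - 1) \<noteq> 0" using assms Gamma_real_pos[of "2 * a - 1"] by (metis diff_gt_0_iff_gt less_irrefl mult.commute pos_divide_less_eq zero_less_numeral)
  moreover have "(x powr (a - 1))\<^sup>2 = x powr (2 * a - 2)" if "0 < x"
    using that by (simp add: power2_eq_square powr_add[symmetric])
  ultimately show ?thesis by (auto simp: rl_kernel_def power_divide)
qed

lemma nn_integral_powr_tail:
  fixes x t p :: real
  assumes p: "p < - 1" and xt: "x < t"
  shows "(\<integral>\<^sup>+y. ennreal ((y - x) powr p) * indicator {t..} y \<partial>lborel) = ennreal ((t - x) powr (p + 1) / (- p - 1))"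
proof -
  have "(\<integral>\<^sup>+y. ennreal ((y - x) powr p) * indicator {t..} y \<partial>lborel) = ennreal (0 - (t - x) powr (p + 1) / (p + 1))"
  proof (rule nn_integral_FTC_atLeast[where F = "\<lambda>y. (y - x) powr (p + 1) / (p + 1)"])
    fix y assume "t \<le> y"
    then have y: "0 < y - x" using xt by simp
    have "((\<lambda>y. (y - x) powr (p + 1)) has_real_derivative (p + 1) * (y - x) powr (p + 1 - 1) * (1 - 0)) (at y)"
      by (rule DERIV_chain'[where f = "\<lambda>y. y - x" and g = "\<lambda>x. x powr (p + 1)", rotated])
         (use has_real_derivative_powr[OF y, of "p + 1"] in \<open>auto intro!: derivative_eq_intros simp: mult.commute\<close>)
    from DERIV_cdivide[OF this, of "p + 1"]
    have "((\<lambda>y. (y - x) powr (p + 1) / (p + 1)) has_real_derivative (p + 1) * (y - x) powr (p + 1 - 1) * (1 - 0) / (p + 1)) (at y)" .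
    then show "((\<lambda>y. (y - x) powr (p + 1) / (p + 1)) has_real_derivative (y - x) powr p) (at y)"
      using p by simp
  next
    have "((\<lambda>y. (y - x) powr (p + 1)) \<longlongrightarrow> 0) at_top"
      by (rule tendsto_neg_powr) (use p in \<open>auto intro!: filterlim_tendsto_add_at_top[where f = "\<lambda>_. - x", simplified] filterlim_ident simp: algebra_simps\<close>)
    from tendsto_divide[OF this tendsto_const[of "p + 1"]]
    show "((\<lambda>y. (y - x) powr (p + 1) / (p + 1)) \<longlongrightarrow> 0) at_top" using p by simp
  qed auto
  also have "0 - (t - x) powr (p + 1) / (p + 1) = (t - x) powr (p + 1) / (- p - 1)"
    using p by (simp add: field_simps)
  finally show ?thesis .
qed

text \<open>
  By the mean value theorem the difference decays like the derivative of the kernel, which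
  is square integrable at infinity as \<open>a < 3 / 2\<close>.
\<close>

lemma rl_kernel_diff_tail:
  assumes a: "1 / 2 < a" "a < 3 / 2" and x: "2 \<le> x"
  shows "(rl_kernel a x - rl_kernel a (x - 1))\<^sup>2 \<le> ((a - 1) / Gamma a)\<^sup>2 * (x - 1) powr (2 * a - 4)"
proof -
  have "\<exists>z. x - 1 < z \<and> z < x \<and> x powr (a - 1) - (x - 1) powr (a - 1) = (x - (x - 1)) * ((a - 1) * z powr (a - 2))"
  proof (rule MVT2)
    fix y assume "x - 1 \<le> y" "y \<le> x"
    then have "0 < y" using x by simp
    from has_real_derivative_powr[OF this, of "a - 1"]
    show "((\<lambda>y. y powr (a - 1)) has_real_derivative (a - 1) * y powr (a - 2)) (at y)"
      by (simp add: algebra_simps)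
  qed simp
  then obtain z where z: "x - 1 < z" "x powr (a - 1) - (x - 1) powr (a - 1) = (a - 1) * z powr (a - 2)"
    by auto
  have "(rl_kernel a x - rl_kernel a (x - 1))\<^sup>2 = ((x powr (a - 1) - (x - 1) powr (a - 1)) / Gamma a)\<^sup>2"
    using x by (simp add: rl_kernel_def diff_divide_distrib)
  also have "\<dots> = ((a - 1) / Gamma a)\<^sup>2 * (z powr (a - 2))\<^sup>2"
    by (simp add: z(2) power_mult_distrib power_divide)
  also have "(z powr (a - 2))\<^sup>2 = z powr (2 * a - 4)"
    using z x by (simp add: power2_eq_square powr_add[symmetric])
  also have "\<dots> \<le> (x - 1) powr (2 * a - 4)"
    using z x a by (intro powr_mono2') auto
  finally show ?thesis by (simp add: mult_left_mono)
qed

text \<open>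
  Near the singularities one uses \<open>a > 1 / 2\<close>, at infinity the preceding decay.
\<close>

lemma sq_norm_rl_kernel_unit_diff_finite:
  assumes a: "1 / 2 < a" "a < 3 / 2"
  shows "sq_norm lborel (\<lambda>x. rl_kernel a x - rl_kernel a (x - 1)) < \<infinity>"
proof -
  define k where "k = Gamma (2 * a - 1) / (Gamma a)\<^sup>2"
  define m where "m = ((a - 1) / Gamma a)\<^sup>2"
  have k: "0 \<le> k" using a by (simp add: k_def Gamma_real_pos less_imp_le)
  have nn: "0 \<le> rl_kernel (2 * a - 1) x" for x using a by (intro rl_kernel_nonneg) auto
  let ?K = "rl_kernel (2 * a - 1)"
  have "sq_norm lborel (\<lambda>x. rl_kernel a x - rl_kernel a (x - 1))
     \<le> (\<integral>\<^sup>+x. ennreal (2 * k) * (ennreal (?K x) * indicator {..2} x)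
           + (ennreal (2 * k) * (ennreal (?K (x - 1)) * indicator {..1} (x - 1))
           + ennreal m * (ennreal ((x - 1) powr (2 * a - 4)) * indicator {2..} x)) \<partial>lborel)"
    unfolding sq_norm_def
  proof (intro nn_integral_mono)
    fix x :: real
    show "ennreal ((rl_kernel a x - rl_kernel a (x - 1))\<^sup>2) \<le>
       ennreal (2 * k) * (ennreal (?K x) * indicator {..2} x)
           + (ennreal (2 * k) * (ennreal (?K (x - 1)) * indicator {..1} (x - 1))
           + ennreal m * (ennreal ((x - 1) powr (2 * a - 4)) * indicator {2..} x))"
    proof (cases "x < 2")
      case True
      have "(rl_kernel a x - rl_kernel a (x - 1))\<^sup>2 \<le> 2 * (rl_kernel a x)\<^sup>2 + 2 * (rl_kernel a (x - 1))\<^sup>2"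
        using zero_le_power2[of "rl_kernel a x + rl_kernel a (x - 1)"] by (simp add: power2_sum power2_diff)
      also have "\<dots> = 2 * k * ?K x + 2 * k * ?K (x - 1)"
        unfolding rl_kernel_sq[OF a(1)] k_def by simp
      finally have "ennreal ((rl_kernel a x - rl_kernel a (x - 1))\<^sup>2) \<le> ennreal (2 * k * ?K x + 2 * k * ?K (x - 1))"
        by (rule ennreal_leI)
      also have "\<dots> = ennreal (2 * k) * ennreal (?K x) + ennreal (2 * k) * ennreal (?K (x - 1))"
        using k nn by (simp add: ennreal_mult)
      finally show ?thesis using True by (simp add: indicator_def)
    next
      case False
      then have "ennreal ((rl_kernel a x - rl_kernel a (x - 1))\<^sup>2) \<le> ennreal (m * (x - 1) powr (2 * a - 4))"
        unfolding m_def by (intro ennreal_leI rl_kernel_diff_tail a) simp_all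
      also have "\<dots> = ennreal m * (ennreal ((x - 1) powr (2 * a - 4)) * indicator {2..} x)"
        using False by (simp add: m_def ennreal_mult)
      finally show ?thesis by (meson add_increasing zero_le order_trans)
    qed
  qed
  also have "\<dots> = ennreal (2 * k) * (\<integral>\<^sup>+x. ennreal (?K x) * indicator {..2} x \<partial>lborel)
      + (ennreal (2 * k) * (\<integral>\<^sup>+x. ennreal (?K (x - 1)) * indicator {..1} (x - 1) \<partial>lborel)
      + ennreal m * (\<integral>\<^sup>+x. ennreal ((x - 1) powr (2 * a - 4)) * indicator {2..} x \<partial>lborel))"
    by (simp add: nn_integral_add nn_integral_cmult)
  also have "(\<integral>\<^sup>+x. ennreal (?K x) * indicator {..2} x \<partial>lborel) = ennreal (rl_kernel (2 * a) 2)"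
    using nn_integral_rl_kernel[of "2 * a - 1" 2] a by simp
  also have "(\<integral>\<^sup>+x. ennreal (?K (x - 1)) * indicator {..1} (x - 1) \<partial>lborel)
       = (\<integral>\<^sup>+x. ennreal (?K x) * indicator {..1} x \<partial>lborel)"
    by (subst nn_integral_real_affine[where c = 1 and t = 1]) auto
  also have "\<dots> = ennreal (rl_kernel (2 * a) 1)"
    using nn_integral_rl_kernel[of "2 * a - 1" 1] a by simp
  also have "(\<integral>\<^sup>+x. ennreal ((x - 1) powr (2 * a - 4)) * indicator {2..} x \<partial>lborel)
      = ennreal ((2 - 1) powr (2 * a - 4 + 1) / (- (2 * a - 4) - 1))"
    by (rule nn_integral_powr_tail) (use a in auto)
  also have "ennreal (2 * k) * ennreal (rl_kernel (2 * a) 2) + (ennreal (2 * k) * ennreal (rl_kernel (2 * a) 1)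
      + ennreal m * ennreal ((2 - 1) powr (2 * a - 4 + 1) / (- (2 * a - 4) - 1))) < \<infinity>"
    by (simp add: ennreal_mult_less_top)
  finally show ?thesis .
qed

text \<open>
  The square integrability of the moving-average kernel of Mandelbrot and Van Ness. The
  power \<open>2 H\<close> comes from the homogeneity of the kernel: translation and scaling reduce the
  general case to the unit interval.
\<close>

lemma sq_norm_rl_kernel_diff:
  assumes "0 < H" "H < 1"
  obtains k where "0 \<le> k"
    "\<And>t r. sq_norm lborel (\<lambda>x. rl_kernel (H + 1 / 2) (x - t) - rl_kernel (H + 1 / 2) (x - r)) = ennreal (k * \<bar>t - r\<bar> powr (2 * H))"
proof -
  define a where "a = H + 1 / 2"
  have a: "1 / 2 < a" "a < 3 / 2" using assms by (auto simp: a_def)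
  define k where "k = enn2real (sq_norm lborel (\<lambda>x. rl_kernel a x - rl_kernel a (x - 1)))"
  have k: "sq_norm lborel (\<lambda>x. rl_kernel a x - rl_kernel a (x - 1)) = ennreal k" "0 \<le> k"
    using sq_norm_rl_kernel_unit_diff_finite[OF a] by (auto simp: k_def)
  have less: "sq_norm lborel (\<lambda>x. rl_kernel a (x - t) - rl_kernel a (x - r)) = ennreal (k * \<bar>t - r\<bar> powr (2 * H))"
    if "t < r" for t r
  proof -
    define h where "h = r - t"
    have h: "0 < h" using that by (simp add: h_def)
    have "sq_norm lborel (\<lambda>x. rl_kernel a (x - t) - rl_kernel a (x - r))
       = ennreal \<bar>h\<bar> * (\<integral>\<^sup>+y. ennreal ((rl_kernel a ((t + h * y) - t) - rl_kernel a ((t + h * y) - r))\<^sup>2) \<partial>lborel)"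
      unfolding sq_norm_def by (rule nn_integral_real_affine) (use h in auto)
    also have "(\<lambda>y. ennreal ((rl_kernel a ((t + h * y) - t) - rl_kernel a ((t + h * y) - r))\<^sup>2))
        = (\<lambda>y. ennreal ((h powr (a - 1))\<^sup>2) * ennreal ((rl_kernel a y - rl_kernel a (y - 1))\<^sup>2))"
    proof
      fix y
      have "(t + h * y) - r = h * (y - 1)" by (simp add: h_def algebra_simps)
      then show "ennreal ((rl_kernel a ((t + h * y) - t) - rl_kernel a ((t + h * y) - r))\<^sup>2)
          = ennreal ((h powr (a - 1))\<^sup>2) * ennreal ((rl_kernel a y - rl_kernel a (y - 1))\<^sup>2)"
        using h by (simp add: rl_kernel_scale right_diff_distrib[symmetric] power_mult_distrib ennreal_mult)
    qed
    also have "(\<integral>\<^sup>+y. ennreal ((h powr (a - 1))\<^sup>2) * ennreal ((rl_kernel a y - rl_kernel a (y - 1))\<^sup>2) \<partial>lborel)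
       = ennreal ((h powr (a - 1))\<^sup>2) * ennreal k"
      using k(1) by (subst nn_integral_cmult) (auto simp: sq_norm_def)
    also have "ennreal \<bar>h\<bar> * (ennreal ((h powr (a - 1))\<^sup>2) * ennreal k) = ennreal (h * ((h powr (a - 1))\<^sup>2 * k))"
      using h k(2) by (simp add: ennreal_mult)
    also have "h * ((h powr (a - 1))\<^sup>2 * k) = k * \<bar>t - r\<bar> powr (2 * H)"
    proof -
      have "h * (h powr (a - 1))\<^sup>2 = h powr (2 * H)"
        using h by (simp add: power2_eq_square powr_add[symmetric] powr_mult_base a_def)
      then show ?thesis using h by (simp add: h_def abs_if)
    qed
    finally show ?thesis .
  qed
  have "sq_norm lborel (\<lambda>x. rl_kernel a (x - t) - rl_kernel a (x - r)) = ennreal (k * \<bar>t - r\<bar> powr (2 * H))" for t r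
  proof (cases t r rule: linorder_cases)
    case greater
    from less[OF this] show ?thesis by (subst sq_norm_commute) (simp add: abs_minus_commute)
  next
    case equal
    then show ?thesis by (simp add: sq_norm_def)
  qed (rule less)
  with that k(2) show thesis by (simp add: a_def)
qed

text \<open>
  The image of a step function under the Riemann--Liouville operator of order
  \<open>(1 - 2 * H) / 2\<close>, in all three regimes: a derivative of order \<open>\<beta>\<close> lowers the order of the
  kernel \<open>rl_kernel 1\<close>, the indicator function, by \<open>\<beta>\<close>. The sign turns \<open>W b - W a\<close> into the
  kernel started at \<open>a\<close> minus the kernel started at \<open>b\<close>.
\<close>

definition step_RL :: "real \<Rightarrow> (real \<times> real \<times> real) list \<Rightarrow> real \<Rightarrow> real" where
  "step_RL H = step_integral (\<lambda>t x. - rl_kernel (H + 1 / 2) (x - t))"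

lemma measurable_step_RL [measurable]: "step_RL H xs \<in> borel_measurable borel"
proof (induction xs)
  case Nil
  have "step_RL H [] = (\<lambda>x. 0)" by (simp add: step_RL_def fun_eq_iff)
  then show ?case by simp
next
  case (Cons p xs)
  obtain c a b where p: "p = (c, a, b)" by (cases p)
  have "step_RL H (p # xs) = (\<lambda>x. c * (rl_kernel (H + 1 / 2) (x - a) - rl_kernel (H + 1 / 2) (x - b)) + step_RL H xs x)"
    by (simp add: step_RL_def p fun_eq_iff)
  with Cons show ?case by simp
qed

lemma measurable_zero_ext [measurable]: "f \<in> borel_measurable borel \<Longrightarrow> zero_ext T f \<in> borel_measurable borel"
proof -
  assume [measurable]: "f \<in> borel_measurable borel"
  have "zero_ext T f = (\<lambda>x. if x \<in> {0..T} then f x else 0)" by (simp add: zero_ext_def fun_eq_iff)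
  then show ?thesis by simp
qed

lemma rl_kernel_sym:
  assumes "0 < H"
  shows "rl_kernel (2 * H + 1) y + rl_kernel (2 * H + 1) (- y) = \<bar>y\<bar> powr (2 * H) / Gamma (2 * H + 1)"
  using assms by (cases y "0 :: real" rule: linorder_cases) (auto simp: rl_kernel_def)

text \<open>
  Each product of a left-sided and a right-sided kernel integrates to a one-sided power
  \<open>rl_kernel (2 * H + 1)\<close>. Symmetrizing the double sum over the intervals turns one-sided
  powers into powers of absolute values, that is, into the covariances.
\<close>

lemma energy_eq_RL_pairing:
  assumes H: "0 < H"
  shows "has_bochner_integral lborel
     (\<lambda>x. step_RL H xs x * step_integral (\<lambda>t x. rl_kernel (H + 1 / 2) (t - x)) xs x)
     (fbm_energy H xs / Gamma (2 * H + 1))"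
proof -
  define \<kappa> where "\<kappa> = rl_kernel (2 * H + 1)"
  define K where "K a b a' b' = \<kappa> (b' - a) - \<kappa> (a' - a) - \<kappa> (b' - b) + \<kappa> (a' - b)" for a b a' b'
  have conv: "has_bochner_integral lborel (\<lambda>x. rl_kernel (H + 1 / 2) (v - x) * rl_kernel (H + 1 / 2) (x - u)) (\<kappa> (v - u))" for u v
    using has_bochner_integral_rl_kernel_conv[of "H + 1 / 2" "H + 1 / 2" v u] H by (simp add: \<kappa>_def algebra_simps)
  have *: "has_bochner_integral lborel
     (\<lambda>x. step_RL H xs x * step_integral (\<lambda>t x. rl_kernel (H + 1 / 2) (t - x)) xs x) (step_form K xs xs)"
    unfolding step_RL_def
  proof (rule has_bochner_integral_step_form)
    fix a b a' b'
    let ?k = "rl_kernel (H + 1 / 2)"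
    have "has_bochner_integral lborel (\<lambda>x. ?k (b' - x) * ?k (x - a) - ?k (a' - x) * ?k (x - a)
        - ?k (b' - x) * ?k (x - b) + ?k (a' - x) * ?k (x - b)) (K a b a' b')"
      unfolding K_def by (intro has_bochner_integral_add has_bochner_integral_diff conv)
    then show "has_bochner_integral lborel (\<lambda>x. (- ?k (x - b) - - ?k (x - a)) * (?k (b' - x) - ?k (a' - x))) (K a b a' b')"
      by (simp add: algebra_simps)
  qed
  have "2 * step_form K xs xs = step_form (\<lambda>a b a' b'. K a b a' b' + K a' b' a b) xs xs"
    using step_form_swap[of K xs xs] step_form_add[of K xs xs "\<lambda>a b a' b'. K a' b' a b"] by simp
  also have "(\<lambda>a b a' b'. K a b a' b' + K a' b' a b) = (\<lambda>a b a' b'. 2 / Gamma (2 * H + 1) * incr_cov H a b a' b')"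
  proof (intro ext)
    fix a b a' b'
    have s: "\<kappa> (u - v) + \<kappa> (v - u) = \<bar>u - v\<bar> powr (2 * H) / Gamma (2 * H + 1)" for u v
      using rl_kernel_sym[OF H, of "u - v"] by (simp add: \<kappa>_def)
    have "K a b a' b' + K a' b' a b = (\<kappa> (b - a') + \<kappa> (a' - b)) + (\<kappa> (a - b') + \<kappa> (b' - a))
       - (\<kappa> (b - b') + \<kappa> (b' - b)) - (\<kappa> (a - a') + \<kappa> (a' - a))"
      by (simp add: K_def)
    also have "\<dots> = 2 / Gamma (2 * H + 1) * incr_cov H a b a' b'"
      unfolding s by (simp add: incr_cov_def add_divide_distrib diff_divide_distrib)
    finally show "K a b a' b' + K a' b' a b = 2 / Gamma (2 * H + 1) * incr_cov H a b a' b'" .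
  qed
  also have "step_form \<dots> xs xs = 2 / Gamma (2 * H + 1) * fbm_energy H xs"
    by (simp only: step_form_cmult fbm_energy_def)
  finally have "step_form K xs xs = fbm_energy H xs / Gamma (2 * H + 1)" by simp
  with * show ?thesis by simp
qed

lemma step_RL_neg: "step_list T xs \<Longrightarrow> x < 0 \<Longrightarrow> step_RL H xs x = 0"
  by (induction xs) (auto simp: step_RL_def)

lemma step_RL_right_zero:
  "step_list T xs \<Longrightarrow> T < x \<Longrightarrow> step_integral (\<lambda>t x. rl_kernel a (t - x)) xs x = 0"
  by (induction xs) auto

text \<open>
  The central estimate. The pairing identity and Cauchy--Schwarz bound the energy by the
  norm of the left-sided image on \<open>{0..T}\<close> times that of the right-sided one, and the latter
  is again the root of the energy, so that one root cancels.
\<close>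

lemma energy_le_sq_norm_RL:
  assumes H: "0 < H" "H < 1"
  obtains C where "0 < C"
    "\<And>T xs. step_list T xs \<Longrightarrow> ennreal (fbm_energy H xs) \<le> ennreal C * sq_norm lborel (zero_ext T (step_RL H xs))"
proof -
  obtain k where k: "0 \<le> k"
    "\<And>t r. sq_norm lborel (\<lambda>x. rl_kernel (H + 1 / 2) (x - t) - rl_kernel (H + 1 / 2) (x - r)) = ennreal (k * \<bar>t - r\<bar> powr (2 * H))"
    using sq_norm_rl_kernel_diff[OF H] by blast
  define G where "G = Gamma (2 * H + 1)"
  have G: "0 < G" using H by (simp add: G_def Gamma_real_pos)
  \<comment> \<open>The summand 1 makes the constant positive.\<close>
  have "ennreal (fbm_energy H xs) \<le> ennreal (k * G\<^sup>2 + 1) * sq_norm lborel (zero_ext T (step_RL H xs))"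
    if xs: "step_list T xs" for T xs
  proof (cases "0 < fbm_energy H xs")
    case False
    then show ?thesis by (simp add: ennreal_neg)
  next
    case True
    define e where "e = fbm_energy H xs"
    define R where "R = step_integral (\<lambda>t x. rl_kernel (H + 1 / 2) (t - x)) xs"
    define P where "P = zero_ext T (step_RL H xs)"
    have [measurable]: "R \<in> borel_measurable borel" "P \<in> borel_measurable borel"
      unfolding R_def P_def using xs
      by (auto intro!: borel_measurable_step_integral[where N = borel, unfolded measurable_lborel1])
    have R: "sq_norm lborel R = ennreal (k * e)"
      unfolding R_def e_def
    proof (rule sq_norm_step_integral[OF _ _ \<open>0 \<le> k\<close> xs])
      fix t r
      have "sq_norm lborel (\<lambda>x. rl_kernel (H + 1 / 2) (t - x) - rl_kernel (H + 1 / 2) (r - x))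
        = sq_norm lborel (\<lambda>x. rl_kernel (H + 1 / 2) (x - (- t)) - rl_kernel (H + 1 / 2) (x - (- r)))"
        unfolding sq_norm_def by (subst nn_integral_real_affine[where c = "-1" and t = 0]) (auto simp: add.commute)
      also have "\<dots> = ennreal (k * \<bar>t - r\<bar> powr (2 * H))" unfolding k(2) by (simp add: abs_minus_commute)
      finally show "sq_norm lborel (\<lambda>x. rl_kernel (H + 1 / 2) (t - x) - rl_kernel (H + 1 / 2) (r - x)) = ennreal (k * \<bar>t - r\<bar> powr (2 * H))" .
    qed auto
    have "has_bochner_integral lborel (\<lambda>x. P x * R x) (e / G)"
    proof -
      \<comment> \<open>Left of 0 the factor \<open>step_RL H xs\<close> vanishes, right of \<open>T\<close> the factor \<open>R\<close>.\<close>
      have "step_RL H xs x * R x = P x * R x" for x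
        using step_RL_neg[OF xs, of x] step_RL_right_zero[OF xs, of x]
        by (auto simp: P_def R_def zero_ext_def)
      then have "(\<lambda>x. step_RL H xs x * R x) = (\<lambda>x. P x * R x)" by (rule ext)
      with energy_eq_RL_pairing[OF H(1), of xs] show ?thesis by (simp only: R_def e_def G_def)
    qed
    then have "e / G = (LINT x|lborel. P x * R x)" by (simp add: has_bochner_integral_iff)
    with integral_mult_sq_le[of P lborel R] have main: "ennreal ((e / G)\<^sup>2) \<le> sq_norm lborel P * ennreal (k * e)"
      using True G by (simp add: R e_def ennreal_power)
    show ?thesis
    proof (cases "sq_norm lborel P = \<infinity>")
      case True
      then have "ennreal (k * G\<^sup>2 + 1) * sq_norm lborel P = \<infinity>"
        using k(1) by (simp add: ennreal_mult_top ennreal_eq_0_iff add_nonneg_pos not_le)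
      then show ?thesis by (simp add: P_def)
    next
      case False
      then obtain p where p: "0 \<le> p" "sq_norm lborel P = ennreal p"
        by (metis ennreal_cases infinity_ennreal_def)
      have e: "0 < e" using True by (simp add: e_def)
      from main have "(e / G)\<^sup>2 \<le> p * (k * e)"
        using p e k(1) by (simp add: ennreal_mult[symmetric])
      then have "e * e \<le> e * (k * G\<^sup>2 * p)"
        using G by (simp add: power_divide field_simps power2_eq_square)
      then have "e \<le> k * G\<^sup>2 * p" using e by simp
      then have "e \<le> (k * G\<^sup>2 + 1) * p" using p(1) by (simp add: algebra_simps)
      then have "ennreal e \<le> ennreal (k * G\<^sup>2 + 1) * ennreal p"
        using p k(1) by (subst ennreal_mult[symmetric]) (auto intro: ennreal_leI)
      then show ?thesis by (simp add: e_def P_def[symmetric] p)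
    qed
  qed
  moreover have "0 < k * G\<^sup>2 + 1" using k(1) by (simp add: add_nonneg_pos)
  ultimately show thesis using that by blast
qed

section \<open>The fractional Sobolev seminorm of step functions; fractional integrals on \<open>L\<^sup>2\<close>\<close>

text \<open>
  The square of the Sobolev--Slobodeckij seminorm of order \<open>(1 - 2 * H) / 2\<close> on the line.
\<close>

definition gagliardo :: "real \<Rightarrow> (real \<Rightarrow> real) \<Rightarrow> ennreal" where
  "gagliardo H f = (\<integral>\<^sup>+x. (\<integral>\<^sup>+y. ennreal ((f x - f y)\<^sup>2 / \<bar>x - y\<bar> powr (2 - 2 * H)) \<partial>lborel) \<partial>lborel)"

text \<open>
  Linear in \<open>f\<close>, and its squared \<open>L\<^sup>2\<close> norm on the plane is the squared seminorm.
  Polarization thus applies to it.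
\<close>

definition slobodeckij_quotient :: "real \<Rightarrow> (real \<Rightarrow> real) \<Rightarrow> real \<times> real \<Rightarrow> real" where
  "slobodeckij_quotient H f = (\<lambda>(x, y). (f x - f y) * \<bar>x - y\<bar> powr (H - 1))"

lemma measurable_slobodeckij_quotient [measurable]:
  assumes [measurable]: "f \<in> borel_measurable borel"
  shows "slobodeckij_quotient H f \<in> borel_measurable (lborel \<Otimes>\<^sub>M lborel)"
  unfolding slobodeckij_quotient_def by measurable

lemma slobodeckij_quotient_sq:
  "(slobodeckij_quotient H f (x, y))\<^sup>2 = (f x - f y)\<^sup>2 / \<bar>x - y\<bar> powr (2 - 2 * H)"
proof -
  have "(\<bar>x - y\<bar> powr (H - 1))\<^sup>2 = \<bar>x - y\<bar> powr (- (2 - 2 * H))"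
    by (simp add: power2_eq_square powr_add[symmetric])
  also have "\<dots> = 1 / \<bar>x - y\<bar> powr (2 - 2 * H)" by (rule powr_minus_divide)
  finally show ?thesis
    by (simp add: slobodeckij_quotient_def power_mult_distrib)
qed

lemma gagliardo_eq_sq_norm:
  assumes [measurable]: "f \<in> borel_measurable borel"
  shows "gagliardo H f = sq_norm (lborel \<Otimes>\<^sub>M lborel) (slobodeckij_quotient H f)"
  unfolding sq_norm_def gagliardo_def slobodeckij_quotient_sq[symmetric]
  by (rule lborel.nn_integral_fst) measurable

lemma slobodeckij_quotient_step:
  "step_integral (\<lambda>t. slobodeckij_quotient H (W t)) xs (x, y) = slobodeckij_quotient H (step_integral W xs) (x, y)"
  by (induction xs) (auto simp: slobodeckij_quotient_def algebra_simps)

lemma nn_integral_power_above: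
  assumes "H < 1 / 2" "x < t"
  shows "(\<integral>\<^sup>+y. ennreal (\<bar>x - y\<bar> powr (2 * H - 2)) * indicator {t..} y \<partial>lborel) = ennreal ((t - x) powr (2 * H - 1) / (1 - 2 * H))"
proof -
  have "(\<integral>\<^sup>+y. ennreal (\<bar>x - y\<bar> powr (2 * H - 2)) * indicator {t..} y \<partial>lborel)
      = (\<integral>\<^sup>+y. ennreal ((y - x) powr (2 * H - 2)) * indicator {t..} y \<partial>lborel)"
    using assms by (intro nn_integral_cong) (auto simp: indicator_def)
  also have "\<dots> = ennreal ((t - x) powr (2 * H - 2 + 1) / (- (2 * H - 2) - 1))"
    by (rule nn_integral_powr_tail) (use assms in auto)
  finally show ?thesis by simp
qed

lemma nn_integral_power_below:
  assumes "H < 1 / 2" "r < x"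
  shows "(\<integral>\<^sup>+y. ennreal (\<bar>x - y\<bar> powr (2 * H - 2)) * indicator {..r} y \<partial>lborel) = ennreal ((x - r) powr (2 * H - 1) / (1 - 2 * H))"
proof -
  have "(\<integral>\<^sup>+y. ennreal (\<bar>x - y\<bar> powr (2 * H - 2)) * indicator {..r} y \<partial>lborel)
      = (\<integral>\<^sup>+y. ennreal (\<bar>(- x) - y\<bar> powr (2 * H - 2)) * indicator {- r..} y \<partial>lborel)"
    by (subst nn_integral_real_affine[where c = "-1" and t = 0])
       (auto simp: indicator_def abs_minus_commute intro!: nn_integral_cong)
  also have "\<dots> = ennreal ((- r - (- x)) powr (2 * H - 1) / (1 - 2 * H))"
    by (rule nn_integral_power_above) (use assms in auto)
  finally show ?thesis by simp
qed

text \<open>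
  Only pairs with exactly one point in the interval contribute. Both integrals are
  elementary.
\<close>

lemma gagliardo_indicator:
  assumes H: "0 < H" "H < 1 / 2" and rt: "r < t"
  shows "gagliardo H (indicator {r<..t}) = ennreal (4 * Gamma (2 * H) / ((1 - 2 * H) * Gamma (2 * H + 1)) * (t - r) powr (2 * H))"
proof -
  define w where "w x y = \<bar>x - y\<bar> powr (2 * H - 2)" for x y :: real
  define G where "G = Gamma (2 * H)"
  have G: "0 < G" using H by (simp add: G_def Gamma_real_pos)
  define m where "m = G / (1 - 2 * H)"
  have m: "0 < m" using G H by (simp add: m_def)
  let ?I = "{r<..t}"
  let ?J = "(\<integral>\<^sup>+x. (\<integral>\<^sup>+y. ennreal (w x y) * indicator ?I x * indicator (- ?I) y \<partial>lborel) \<partial>lborel)"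
  have [measurable]: "(\<lambda>(x, y). w x y) \<in> borel_measurable (lborel \<Otimes>\<^sub>M lborel)"
    unfolding w_def by measurable
  have w1 [measurable]: "w x \<in> borel_measurable borel" "(\<lambda>x. w x y) \<in> borel_measurable borel" for x y
    unfolding w_def by measurable
  have pt: "ennreal ((indicator ?I x - indicator ?I y)\<^sup>2 / \<bar>x - y\<bar> powr (2 - 2 * H))
     = ennreal (w x y) * indicator ?I x * indicator (- ?I) y + ennreal (w y x) * indicator ?I y * indicator (- ?I) x" for x y
  proof -
    have "1 / \<bar>x - y\<bar> powr (2 - 2 * H) = w x y"
      by (simp add: w_def powr_minus_divide[symmetric])
    moreover have "w y x = w x y" by (simp add: w_def abs_minus_commute)
    ultimately show ?thesis
      by (auto simp: indicator_def simp del: greaterThanAtMost_iff)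
  qed
  have "gagliardo H (indicator ?I) = (\<integral>\<^sup>+x. (\<integral>\<^sup>+y. ennreal (w x y) * indicator ?I x * indicator (- ?I) y \<partial>lborel)
     + (\<integral>\<^sup>+y. ennreal (w y x) * indicator ?I y * indicator (- ?I) x \<partial>lborel) \<partial>lborel)"
    unfolding gagliardo_def pt by (intro nn_integral_cong nn_integral_add) measurable
  also have "\<dots> = ?J + (\<integral>\<^sup>+x. (\<integral>\<^sup>+y. ennreal (w y x) * indicator ?I y * indicator (- ?I) x \<partial>lborel) \<partial>lborel)"
    by (rule nn_integral_add) measurable
  also have "(\<integral>\<^sup>+x. (\<integral>\<^sup>+y. ennreal (w y x) * indicator ?I y * indicator (- ?I) x \<partial>lborel) \<partial>lborel) = ?J"
    by (rule lborel_pair.Fubini') measurable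
  also have "?J = (\<integral>\<^sup>+x. ennreal m * (ennreal (rl_kernel (2 * H) (t - x) * rl_kernel 1 (x - r))
      + ennreal (rl_kernel 1 (t - x) * rl_kernel (2 * H) (x - r))) \<partial>lborel)"
  proof (rule nn_integral_cong_AE)
    have "AE x in lborel. x \<noteq> t" by (rule AE_lborel_singleton)
    then show "AE x in lborel. (\<integral>\<^sup>+y. ennreal (w x y) * indicator ?I x * indicator (- ?I) y \<partial>lborel)
      = ennreal m * (ennreal (rl_kernel (2 * H) (t - x) * rl_kernel 1 (x - r))
      + ennreal (rl_kernel 1 (t - x) * rl_kernel (2 * H) (x - r)))"
    proof eventually_elim
      case (elim x)
      show ?case
      proof (cases "r < x \<and> x < t")
        case False
        then have "x \<notin> ?I" using elim by auto
        with False show ?thesis by (auto simp: rl_kernel_def)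
      next
        case True
        have "AE y in lborel. y \<noteq> t" by (rule AE_lborel_singleton)
        then have "(\<integral>\<^sup>+y. ennreal (w x y) * indicator ?I x * indicator (- ?I) y \<partial>lborel)
          = (\<integral>\<^sup>+y. ennreal (w x y) * indicator {t..} y + ennreal (w x y) * indicator {..r} y \<partial>lborel)"
          using True rt by (intro nn_integral_cong_AE) (auto simp: indicator_def)
        also have "\<dots> = (\<integral>\<^sup>+y. ennreal (w x y) * indicator {t..} y \<partial>lborel) + (\<integral>\<^sup>+y. ennreal (w x y) * indicator {..r} y \<partial>lborel)"
          by (rule nn_integral_add) measurable
        also have "\<dots> = ennreal ((t - x) powr (2 * H - 1) / (1 - 2 * H)) + ennreal ((x - r) powr (2 * H - 1) / (1 - 2 * H))"
          unfolding w_def using True H by (simp add: nn_integral_power_above nn_integral_power_below)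
        also have "(t - x) powr (2 * H - 1) / (1 - 2 * H) = m * (rl_kernel (2 * H) (t - x) * rl_kernel 1 (x - r))"
          using True G by (simp add: rl_kernel_def m_def G_def)
        also have "(x - r) powr (2 * H - 1) / (1 - 2 * H) = m * (rl_kernel 1 (t - x) * rl_kernel (2 * H) (x - r))"
          using True G by (simp add: rl_kernel_def m_def G_def)
        finally show ?thesis using m by (simp only: ennreal_mult' less_imp_le distrib_left)
      qed
    qed
  qed
  also have "\<dots> = ennreal m * (\<integral>\<^sup>+x. ennreal (rl_kernel (2 * H) (t - x) * rl_kernel 1 (x - r))
      + ennreal (rl_kernel 1 (t - x) * rl_kernel (2 * H) (x - r)) \<partial>lborel)"
    by (rule nn_integral_cmult) measurable
  also have "(\<integral>\<^sup>+x. ennreal (rl_kernel (2 * H) (t - x) * rl_kernel 1 (x - r))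
      + ennreal (rl_kernel 1 (t - x) * rl_kernel (2 * H) (x - r)) \<partial>lborel)
      = ennreal (rl_kernel (2 * H + 1) (t - r)) + ennreal (rl_kernel (1 + 2 * H) (t - r))"
    by (subst nn_integral_add) (use H in \<open>simp_all add: nn_integral_rl_kernel_conv\<close>)
  also have "ennreal m * (ennreal (rl_kernel (2 * H + 1) (t - r)) + ennreal (rl_kernel (1 + 2 * H) (t - r)))
      = ennreal (m * (2 * rl_kernel (2 * H + 1) (t - r)))"
    using m H rl_kernel_nonneg[of "2 * H + 1" "t - r"]
    by (simp add: ennreal_mult add.commute ennreal_plus[symmetric] del: ennreal_plus)
  also have "\<dots> + \<dots> = ennreal (2 * (m * (2 * rl_kernel (2 * H + 1) (t - r))))"
    using m H rl_kernel_nonneg[of "2 * H + 1" "t - r"]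
    by (simp add: ennreal_plus[symmetric] del: ennreal_plus)
  also have "2 * (m * (2 * rl_kernel (2 * H + 1) (t - r)))
     = 4 * Gamma (2 * H) / ((1 - 2 * H) * Gamma (2 * H + 1)) * (t - r) powr (2 * H)"
    using rt H by (simp add: rl_kernel_def m_def G_def)
  finally show ?thesis .
qed

text \<open>
  The seminorm of an indicator function is a constant times the length to the power \<open>2 * H\<close>,
  so that polarization identifies the squared seminorm of a step function with its energy.
\<close>

lemma gagliardo_step_fun:
  assumes H: "0 < H" "H < 1 / 2"
  obtains k where "0 < k"
    "\<And>T xs. step_list T xs \<Longrightarrow> gagliardo H (step_fun xs) = ennreal (k * fbm_energy H xs)"
proof -
  define k where "k = 4 * Gamma (2 * H) / ((1 - 2 * H) * Gamma (2 * H + 1))"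
  have k: "0 < k" using H by (auto simp: k_def intro!: divide_pos_pos mult_pos_pos Gamma_real_pos)
  have less: "sq_norm (lborel \<Otimes>\<^sub>M lborel) (\<lambda>z. slobodeckij_quotient H (indicator {0<..t}) z - slobodeckij_quotient H (indicator {0<..r}) z)
      = ennreal (k * \<bar>t - r\<bar> powr (2 * H))" if "0 \<le> r" "r < t" for r t
  proof -
    have "slobodeckij_quotient H (indicator {0<..t}) z - slobodeckij_quotient H (indicator {0<..r}) z
       = slobodeckij_quotient H (indicator {r<..t}) z" for z
      using that by (auto simp: slobodeckij_quotient_def indicator_def split: prod.splits)
    then show ?thesis
      using gagliardo_indicator[OF H \<open>r < t\<close>] gagliardo_eq_sq_norm[of "indicator {r<..t}" H] that
      by (simp add: k_def)
  qed
  have incr: "sq_norm (lborel \<Otimes>\<^sub>M lborel) (\<lambda>z. slobodeckij_quotient H (indicator {0<..t}) z - slobodeckij_quotient H (indicator {0<..r}) z)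
      = ennreal (k * \<bar>t - r\<bar> powr (2 * H))" if "0 \<le> r" "0 \<le> t" for r t
  proof (cases t r rule: linorder_cases)
    case equal
    then show ?thesis by (simp add: sq_norm_def)
  next
    case less': less
    show ?thesis
      using less[OF that(2) less'] by (subst sq_norm_commute) (simp add: abs_minus_commute)
  qed (use less that in auto)
  have "gagliardo H (step_fun xs) = ennreal (k * fbm_energy H xs)" if xs: "step_list T xs" for T xs
  proof -
    have e: "step_fun xs = step_integral (\<lambda>t. indicator {0<..t}) xs"
      using step_fun_eq_step_integral[OF xs] by blast
    have [measurable]: "step_fun xs \<in> borel_measurable borel"
      unfolding e by (rule borel_measurable_step_integral[OF xs]) auto
    have "gagliardo H (step_fun xs) = sq_norm (lborel \<Otimes>\<^sub>M lborel) (slobodeckij_quotient H (step_fun xs))"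
      by (rule gagliardo_eq_sq_norm) measurable
    also have "slobodeckij_quotient H (step_fun xs) = step_integral (\<lambda>t. slobodeckij_quotient H (indicator {0<..t})) xs"
      unfolding e using slobodeckij_quotient_step[symmetric] by fast
    also have "sq_norm (lborel \<Otimes>\<^sub>M lborel) \<dots> = ennreal (k * fbm_energy H xs)"
      by (rule sq_norm_step_integral[OF _ incr _ xs]) (use k in auto)
    finally show ?thesis .
  qed
  with that k show thesis by blast
qed

definition rl_conv :: "real \<Rightarrow> (real \<Rightarrow> real) \<Rightarrow> real \<Rightarrow> real" where
  "rl_conv a f x = (LINT t|lborel. rl_kernel a (x - t) * f t)"

lemma measurable_rl_conv [measurable]:
  assumes [measurable]: "f \<in> borel_measurable borel"
  shows "rl_conv a f \<in> borel_measurable borel"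
proof -
  have "(\<lambda>x. LINT t|lborel. rl_kernel a (x - t) * f t) \<in> borel_measurable borel" by measurable
  then show ?thesis by (simp add: rl_conv_def[abs_def])
qed

lemma rl_kernel_mono:
  assumes "1 \<le> a" "x \<le> y" shows "rl_kernel a x \<le> rl_kernel a y"
  using assms Gamma_real_pos[of a] by (auto simp: rl_kernel_def intro!: divide_right_mono powr_mono2 divide_nonneg_pos)

text \<open>
  Young's inequality. On a bounded interval the kernel is integrable, so one applies
  Cauchy--Schwarz with the kernel as weight and integrates in the other order.
\<close>

lemma nn_integral_rl_conv_sq_le:
  assumes a: "0 < a" and [measurable]: "f \<in> borel_measurable borel" and supp: "\<And>x. x \<notin> {0..T} \<Longrightarrow> f x = 0"
  shows "(\<integral>\<^sup>+x. (\<integral>\<^sup>+t. ennreal (rl_kernel a (x - t) * \<bar>f t\<bar>) \<partial>lborel)\<^sup>2 * indicator {0..T} x \<partial>lborel)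
    \<le> ennreal ((rl_kernel (a + 1) T)\<^sup>2) * sq_norm lborel f"
proof -
  define K where "K = rl_kernel (a + 1) T"
  have K: "0 \<le> K" using a by (simp add: K_def rl_kernel_nonneg)
  have nn: "0 \<le> rl_kernel a x" for x using a by (rule rl_kernel_nonneg)
  have A: "(\<integral>\<^sup>+t. ennreal (rl_kernel a (x - t)) * indicator {0..} t \<partial>lborel) \<le> ennreal K" if "x \<le> T" for x
  proof -
    have "(\<integral>\<^sup>+t. ennreal (rl_kernel a (x - t)) * indicator {0..} t \<partial>lborel) = (\<integral>\<^sup>+t. ennreal (rl_kernel a t) * indicator {..x} t \<partial>lborel)"
      by (subst nn_integral_real_affine[where c = "-1" and t = x]) (auto simp: indicator_def intro!: nn_integral_cong)
    also have "\<dots> \<le> ennreal K"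
      unfolding nn_integral_rl_kernel[OF a] K_def using a that by (intro ennreal_leI rl_kernel_mono) auto
    finally show ?thesis .
  qed
  have B: "(\<integral>\<^sup>+x. ennreal (rl_kernel a (x - t)) * indicator {0..T} x \<partial>lborel) \<le> ennreal K" if "0 \<le> t" for t
  proof -
    have "(\<integral>\<^sup>+x. ennreal (rl_kernel a (x - t)) * indicator {0..T} x \<partial>lborel)
        \<le> (\<integral>\<^sup>+x. ennreal (rl_kernel a (x - t)) * indicator {..T} x \<partial>lborel)"
      by (intro nn_integral_mono mult_left_mono) (auto simp: indicator_def)
    also have "\<dots> = (\<integral>\<^sup>+x. ennreal (rl_kernel a x) * indicator {..T - t} x \<partial>lborel)"
      by (subst nn_integral_real_affine[where c = 1 and t = t]) (auto simp: indicator_def intro!: nn_integral_cong)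
    also have "\<dots> \<le> ennreal K"
      unfolding nn_integral_rl_kernel[OF a] K_def using a that by (intro ennreal_leI rl_kernel_mono) auto
    finally show ?thesis .
  qed
  have CS: "(\<integral>\<^sup>+t. ennreal (rl_kernel a (x - t) * \<bar>f t\<bar>) \<partial>lborel)\<^sup>2
      \<le> ennreal K * (\<integral>\<^sup>+t. ennreal (rl_kernel a (x - t)) * ennreal ((f t)\<^sup>2) \<partial>lborel)" if "x \<le> T" for x
  proof -
    let ?p = "\<lambda>t. rl_kernel a (x - t) * indicator {0..} t"
    have "(\<integral>\<^sup>+t. ennreal (rl_kernel a (x - t) * \<bar>f t\<bar>) \<partial>lborel) = (\<integral>\<^sup>+t. ennreal (?p t * \<bar>f t\<bar>) \<partial>lborel)"
      using supp by (intro nn_integral_cong) (auto simp: indicator_def)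
    moreover have "\<dots>\<^sup>2 \<le> (\<integral>\<^sup>+t. ennreal (?p t) \<partial>lborel) * (\<integral>\<^sup>+t. ennreal (?p t * (f t)\<^sup>2) \<partial>lborel)"
      by (rule nn_integral_weighted_sq_le) (use nn in auto)
    moreover have "(\<integral>\<^sup>+t. ennreal (?p t) \<partial>lborel) = (\<integral>\<^sup>+t. ennreal (rl_kernel a (x - t)) * indicator {0..} t \<partial>lborel)"
      by (intro nn_integral_cong) (simp add: indicator_def)
    moreover have "(\<integral>\<^sup>+t. ennreal (?p t * (f t)\<^sup>2) \<partial>lborel) = (\<integral>\<^sup>+t. ennreal (rl_kernel a (x - t)) * ennreal ((f t)\<^sup>2) \<partial>lborel)"
      using supp nn by (intro nn_integral_cong) (auto simp: indicator_def ennreal_mult)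
    ultimately have "(\<integral>\<^sup>+t. ennreal (rl_kernel a (x - t) * \<bar>f t\<bar>) \<partial>lborel)\<^sup>2
        \<le> (\<integral>\<^sup>+t. ennreal (rl_kernel a (x - t)) * indicator {0..} t \<partial>lborel) * (\<integral>\<^sup>+t. ennreal (rl_kernel a (x - t)) * ennreal ((f t)\<^sup>2) \<partial>lborel)"
      by simp
    then show ?thesis using A[OF that] by (meson mult_right_mono order_trans zero_le)
  qed
  have "(\<integral>\<^sup>+x. (\<integral>\<^sup>+t. ennreal (rl_kernel a (x - t) * \<bar>f t\<bar>) \<partial>lborel)\<^sup>2 * indicator {0..T} x \<partial>lborel)
     \<le> (\<integral>\<^sup>+x. ennreal K * (\<integral>\<^sup>+t. ennreal ((f t)\<^sup>2) * (ennreal (rl_kernel a (x - t)) * indicator {0..T} x) \<partial>lborel) \<partial>lborel)"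
    using CS by (intro nn_integral_mono) (auto simp: indicator_def mult.commute)
  also have "\<dots> = ennreal K * (\<integral>\<^sup>+x. (\<integral>\<^sup>+t. ennreal ((f t)\<^sup>2) * (ennreal (rl_kernel a (x - t)) * indicator {0..T} x) \<partial>lborel) \<partial>lborel)"
    by (rule nn_integral_cmult) measurable
  also have "(\<integral>\<^sup>+x. (\<integral>\<^sup>+t. ennreal ((f t)\<^sup>2) * (ennreal (rl_kernel a (x - t)) * indicator {0..T} x) \<partial>lborel) \<partial>lborel)
     = (\<integral>\<^sup>+t. (\<integral>\<^sup>+x. ennreal ((f t)\<^sup>2) * (ennreal (rl_kernel a (x - t)) * indicator {0..T} x) \<partial>lborel) \<partial>lborel)"
    by (rule lborel_pair.Fubini') measurable
  also have "\<dots> = (\<integral>\<^sup>+t. ennreal ((f t)\<^sup>2) * (\<integral>\<^sup>+x. ennreal (rl_kernel a (x - t)) * indicator {0..T} x \<partial>lborel) \<partial>lborel)"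
    by (intro nn_integral_cong nn_integral_cmult) measurable
  also have "\<dots> \<le> (\<integral>\<^sup>+t. ennreal K * ennreal ((f t)\<^sup>2) \<partial>lborel)"
  proof (intro nn_integral_mono)
    fix t show "ennreal ((f t)\<^sup>2) * (\<integral>\<^sup>+x. ennreal (rl_kernel a (x - t)) * indicator {0..T} x \<partial>lborel) \<le> ennreal K * ennreal ((f t)\<^sup>2)"
      using mult_left_mono[OF B[of t], of "ennreal ((f t)\<^sup>2)"] supp[of t]
      by (cases "0 \<le> t") (auto simp: mult.commute)
  qed
  also have "\<dots> = ennreal K * sq_norm lborel f"
    unfolding sq_norm_def by (rule nn_integral_cmult) measurable
  also have "ennreal K * (ennreal K * sq_norm lborel f) = ennreal (K\<^sup>2) * sq_norm lborel f"
    using K by (simp add: power2_eq_square ennreal_mult mult.assoc)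
  finally show ?thesis by (simp add: K_def mult_left_mono)
qed

lemma sq_norm_rl_conv_le:
  assumes a: "0 < a" and [measurable]: "f \<in> borel_measurable borel" and supp: "\<And>x. x \<notin> {0..T} \<Longrightarrow> f x = 0"
  shows "sq_norm lborel (zero_ext T (rl_conv a f)) \<le> ennreal ((rl_kernel (a + 1) T)\<^sup>2) * sq_norm lborel f"
proof -
  have "sq_norm lborel (zero_ext T (rl_conv a f))
      \<le> (\<integral>\<^sup>+x. (\<integral>\<^sup>+t. ennreal (rl_kernel a (x - t) * \<bar>f t\<bar>) \<partial>lborel)\<^sup>2 * indicator {0..T} x \<partial>lborel)"
    unfolding sq_norm_def
  proof (intro nn_integral_mono)
    fix x
    have "ennreal \<bar>rl_conv a f x\<bar> \<le> (\<integral>\<^sup>+t. ennreal (rl_kernel a (x - t) * \<bar>f t\<bar>) \<partial>lborel)"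
      using integral_norm_bound_ennreal[of lborel "\<lambda>t. rl_kernel a (x - t) * f t"] rl_kernel_nonneg[OF a]
      by (cases "integrable lborel (\<lambda>t. rl_kernel a (x - t) * f t)")
         (auto simp: rl_conv_def abs_mult not_integrable_integral_eq)
    then have "(ennreal \<bar>rl_conv a f x\<bar>)\<^sup>2 \<le> (\<integral>\<^sup>+t. ennreal (rl_kernel a (x - t) * \<bar>f t\<bar>) \<partial>lborel)\<^sup>2"
      by (rule power_mono) simp
    then show "ennreal ((zero_ext T (rl_conv a f) x)\<^sup>2)
      \<le> (\<integral>\<^sup>+t. ennreal (rl_kernel a (x - t) * \<bar>f t\<bar>) \<partial>lborel)\<^sup>2 * indicator {0..T} x"
      by (simp add: zero_ext_def ennreal_power indicator_def)
  qed
  also have "\<dots> \<le> ennreal ((rl_kernel (a + 1) T)\<^sup>2) * sq_norm lborel f"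
    by (rule nn_integral_rl_conv_sq_le[OF assms])
  finally show ?thesis .
qed

lemma AE_integrable_rl_conv:
  assumes a: "0 < a" and [measurable]: "f \<in> borel_measurable borel" and supp: "\<And>x. x \<notin> {0..T} \<Longrightarrow> f x = 0"
    and fin: "sq_norm lborel f < \<infinity>"
  shows "AE x in lborel. x \<in> {0..T} \<longrightarrow> integrable lborel (\<lambda>t. rl_kernel a (x - t) * f t)"
proof -
  have "(\<integral>\<^sup>+x. (\<integral>\<^sup>+t. ennreal (rl_kernel a (x - t) * \<bar>f t\<bar>) \<partial>lborel)\<^sup>2 * indicator {0..T} x \<partial>lborel) \<noteq> \<infinity>"
  proof -
    have "ennreal ((rl_kernel (a + 1) T)\<^sup>2) * sq_norm lborel f < \<infinity>"
      using fin by (simp add: ennreal_mult_less_top)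
    from order.strict_trans1[OF nn_integral_rl_conv_sq_le[OF assms(1-3)] this] show ?thesis by simp
  qed
  then have "AE x in lborel. (\<integral>\<^sup>+t. ennreal (rl_kernel a (x - t) * \<bar>f t\<bar>) \<partial>lborel)\<^sup>2 * indicator {0..T} x \<noteq> \<infinity>"
    by (intro nn_integral_PInf_AE) measurable
  then show ?thesis
  proof eventually_elim
    case (elim x)
    show ?case
    proof
      assume "x \<in> {0..T}"
      with elim have "(\<integral>\<^sup>+t. ennreal (rl_kernel a (x - t) * \<bar>f t\<bar>) \<partial>lborel) < \<infinity>"
        by (auto simp: power2_eq_square ennreal_mult_eq_top_iff less_top)
      then show "integrable lborel (\<lambda>t. rl_kernel a (x - t) * f t)"
        using rl_kernel_nonneg[OF a] by (subst integrable_iff_bounded) (auto simp: abs_mult)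
    qed
  qed
qed

lemma step_fun_eq_kernel:
  assumes "step_list T xs"
  shows "step_fun xs x = step_integral (\<lambda>t x. - rl_kernel 1 (x - t)) xs x"
  using assms
proof (induction xs)
  case (Cons p xs)
  obtain c a b where p: "p = (c, a, b)" by (cases p)
  have "indicator {a<..b} x = (rl_kernel 1 (x - a) - rl_kernel 1 (x - b) :: real)"
    using Cons.prems p by (auto simp: indicator_def rl_kernel_1)
  with Cons p show ?case by (simp add: step_fun_def)
qed (simp add: step_fun_def)

lemma has_bochner_integral_rl_kernel_step:
  assumes "0 < a" "0 < b"
  shows "has_bochner_integral lborel (\<lambda>t. rl_kernel a (x - t) * step_integral (\<lambda>u t. - rl_kernel b (t - u)) xs t)
     (step_integral (\<lambda>u x. - rl_kernel (a + b) (x - u)) xs x)"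
proof (induction xs)
  case Nil
  then show ?case by (simp add: has_bochner_integral_zero)
next
  case (Cons p xs)
  obtain c u v where p: "p = (c, u, v)" by (cases p)
  have "has_bochner_integral lborel (\<lambda>t. c * (rl_kernel a (x - t) * rl_kernel b (t - u) - rl_kernel a (x - t) * rl_kernel b (t - v))
      + rl_kernel a (x - t) * step_integral (\<lambda>u t. - rl_kernel b (t - u)) xs t)
     (c * (rl_kernel (a + b) (x - u) - rl_kernel (a + b) (x - v)) + step_integral (\<lambda>u x. - rl_kernel (a + b) (x - u)) xs x)"
    by (intro has_bochner_integral_add has_bochner_integral_mult_right has_bochner_integral_diff
        has_bochner_integral_rl_kernel_conv assms Cons.IH)
  then show ?case by (simp add: p algebra_simps)
qed

text \<open>
  The semigroup law on kernels: it recovers a step function from its fractional derivative,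
  and computes its fractional integral.
\<close>

lemma rl_conv_step:
  assumes "0 < a" "0 < b"
  shows "rl_conv a (step_integral (\<lambda>u t. - rl_kernel b (t - u)) xs) = step_integral (\<lambda>u x. - rl_kernel (a + b) (x - u)) xs"
  using has_bochner_integral_rl_kernel_step[OF assms] by (auto simp: rl_conv_def has_bochner_integral_iff)

text \<open>
  A fractional integral looks only at the past.
\<close>

lemma rl_conv_zero_ext:
  assumes "x \<le> T" "\<And>t. t < 0 \<Longrightarrow> f t = 0"
  shows "rl_conv a (zero_ext T f) x = rl_conv a f x"
  unfolding rl_conv_def using assms
  by (intro Bochner_Integration.integral_cong refl) (auto simp: zero_ext_def)

section \<open>Density of step functions and of their fractional derivatives\<close>

lemma ennreal_quarter:
  assumes "a < ennreal (e / 4)" "b < ennreal (e / 4)" "c \<le> 2 * a + 2 * b"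
  shows "c < ennreal e"
proof -
  obtain a' b' where ab: "a = ennreal a'" "0 \<le> a'" "b = ennreal b'" "0 \<le> b'"
    using assms(1,2) by (metis ennreal_cases not_less_iff_gr_or_eq order.strict_trans top.not_eq_extremum)
  have "a' < e / 4" "b' < e / 4" using assms(1,2) ab by (auto simp: ennreal_less_iff)
  moreover have "2 * a + 2 * b = ennreal (2 * a' + 2 * b')"
    using ab by (simp add: ennreal_mult ennreal_plus)
  ultimately have "2 * a + 2 * b < ennreal e" using ab by (simp add: ennreal_less_iff del: ennreal_plus)
  with assms(3) show ?thesis by simp
qed

text \<open>
  A linear map from step functions to functions. The two instances are the step functions
  themselves and their fractional derivatives.
\<close>

locale step_system =
  fixes T :: real and V :: "(real \<times> real \<times> real) list \<Rightarrow> real \<Rightarrow> real"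
  assumes measurable_V [measurable]: "\<And>xs. V xs \<in> borel_measurable borel"
    and V_append: "\<And>xs ys x. V (xs @ ys) x = V xs x + V ys x"
    and V_scale: "\<And>c xs x. V (step_scale c xs) x = c * V xs x"
begin

definition approximable :: "(real \<Rightarrow> real) \<Rightarrow> bool" where
  "approximable f \<longleftrightarrow> f \<in> borel_measurable borel \<and>
     (\<forall>e>0. \<exists>xs. step_list T xs \<and> sq_norm lborel (\<lambda>x. V xs x - f x) < ennreal e)"

lemma approximableD [measurable_dest]: "approximable f \<Longrightarrow> f \<in> borel_measurable borel"
  by (simp add: approximable_def)

lemma approximable_cmult:
  assumes f: "approximable f"
  shows "approximable (\<lambda>x. c * f x)"
  unfolding approximable_def
proof (intro conjI allI impI)
  have [measurable]: "f \<in> borel_measurable borel" using f by (rule approximableD)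
  then show "(\<lambda>x. c * f x) \<in> borel_measurable borel" by measurable
  fix e :: real assume "0 < e"
  then have "0 < e / (c\<^sup>2 + 1)" by (simp add: add_nonneg_pos)
  then obtain xs where xs: "step_list T xs" "sq_norm lborel (\<lambda>x. V xs x - f x) < ennreal (e / (c\<^sup>2 + 1))"
    using f unfolding approximable_def by blast
  have "sq_norm lborel (\<lambda>x. V (step_scale c xs) x - c * f x) = sq_norm lborel (\<lambda>x. c * (V xs x - f x))"
    by (simp add: V_scale right_diff_distrib)
  also have "\<dots> = ennreal (c\<^sup>2) * sq_norm lborel (\<lambda>x. V xs x - f x)"
    by (rule sq_norm_cmult) measurable
  also have "\<dots> \<le> ennreal (c\<^sup>2) * ennreal (e / (c\<^sup>2 + 1))"
    using xs(2) by (intro mult_left_mono) auto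
  also have "\<dots> = ennreal (c\<^sup>2 * (e / (c\<^sup>2 + 1)))"
    by (simp only: ennreal_mult' zero_le_power2)
  also have "\<dots> < ennreal e"
  proof -
    have "0 < c\<^sup>2 + 1" by (simp add: add_nonneg_pos)
    then have "c\<^sup>2 * (e / (c\<^sup>2 + 1)) < e" using \<open>0 < e\<close> by (simp add: field_simps)
    then show ?thesis using \<open>0 < e\<close> by (simp add: ennreal_lessI)
  qed
  finally show "\<exists>xs. step_list T xs \<and> sq_norm lborel (\<lambda>x. V xs x - c * f x) < ennreal e"
    using xs(1) by (intro exI[of _ "step_scale c xs"]) simp
qed

lemma approximable_add:
  assumes f: "approximable f" and g: "approximable g"
  shows "approximable (\<lambda>x. f x + g x)"
  unfolding approximable_def
proof (intro conjI allI impI)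
  have [measurable]: "f \<in> borel_measurable borel" "g \<in> borel_measurable borel"
    using f g by (auto dest: approximableD)
  then show "(\<lambda>x. f x + g x) \<in> borel_measurable borel" by measurable
  fix e :: real assume "0 < e"
  then have "0 < e / 4" by simp
  obtain xs where xs: "step_list T xs" "sq_norm lborel (\<lambda>x. V xs x - f x) < ennreal (e / 4)"
    using f \<open>0 < e / 4\<close> unfolding approximable_def by blast
  obtain ys where ys: "step_list T ys" "sq_norm lborel (\<lambda>x. V ys x - g x) < ennreal (e / 4)"
    using g \<open>0 < e / 4\<close> unfolding approximable_def by blast
  have "sq_norm lborel (\<lambda>x. V (xs @ ys) x - (f x + g x)) = sq_norm lborel (\<lambda>x. (V xs x - f x) + (V ys x - g x))"
    by (simp add: V_append algebra_simps)
  also have "\<dots> \<le> 2 * sq_norm lborel (\<lambda>x. V xs x - f x) + 2 * sq_norm lborel (\<lambda>x. V ys x - g x)"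
    by (rule sq_norm_add) measurable
  finally have "sq_norm lborel (\<lambda>x. V (xs @ ys) x - (f x + g x)) < ennreal e"
    by (rule ennreal_quarter[OF xs(2) ys(2)])
  then show "\<exists>xs. step_list T xs \<and> sq_norm lborel (\<lambda>x. V xs x - (f x + g x)) < ennreal e"
    using xs(1) ys(1) by (intro exI[of _ "xs @ ys"]) simp
qed

lemma approximable_zero: "approximable (\<lambda>x. 0)"
proof -
  have "V [] x = 0" for x using V_append[of "[]" "[]" x] by simp
  then show ?thesis
    unfolding approximable_def by (auto intro!: exI[of _ "[]"] simp: sq_norm_def)
qed

lemma approximable_diff: "approximable f \<Longrightarrow> approximable g \<Longrightarrow> approximable (\<lambda>x. f x - g x)"
  using approximable_add[of f "\<lambda>x. - 1 * g x"] approximable_cmult[of g "- 1"] by simp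

lemma approximable_sum:
  "finite I \<Longrightarrow> (\<And>i. i \<in> I \<Longrightarrow> approximable (f i)) \<Longrightarrow> approximable (\<lambda>x. \<Sum>i\<in>I. f i x)"
  by (induction I rule: finite_induct) (auto intro: approximable_zero approximable_add)

lemma approximable_closed:
  assumes [measurable]: "f \<in> borel_measurable borel"
    and "\<And>e. 0 < e \<Longrightarrow> \<exists>g. approximable g \<and> sq_norm lborel (\<lambda>x. g x - f x) < ennreal e"
  shows "approximable f"
  unfolding approximable_def
proof (intro conjI allI impI)
  fix e :: real assume "0 < e"
  then have "0 < e / 4" by simp
  then obtain g where g: "approximable g" "sq_norm lborel (\<lambda>x. g x - f x) < ennreal (e / 4)"
    using assms(2) by blast
  have [measurable]: "g \<in> borel_measurable borel" using g(1) by (rule approximableD)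
  obtain xs where xs: "step_list T xs" "sq_norm lborel (\<lambda>x. V xs x - g x) < ennreal (e / 4)"
    using g(1) \<open>0 < e / 4\<close> unfolding approximable_def by blast
  have "sq_norm lborel (\<lambda>x. V xs x - f x) \<le> 2 * sq_norm lborel (\<lambda>x. V xs x - g x) + 2 * sq_norm lborel (\<lambda>x. g x - f x)"
    by (rule sq_norm_triangle) measurable
  then have "sq_norm lborel (\<lambda>x. V xs x - f x) < ennreal e"
    by (rule ennreal_quarter[OF xs(2) g(2)])
  with xs(1) show "\<exists>xs. step_list T xs \<and> sq_norm lborel (\<lambda>x. V xs x - f x) < ennreal e" by blast
qed measurable

lemma approximable_cong_AE:
  assumes "approximable f" "g \<in> borel_measurable borel" "AE x in lborel. f x = g x"
  shows "approximable g"
proof (rule approximable_closed)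
  fix e :: real assume "0 < e"
  have "sq_norm lborel (\<lambda>x. f x - g x) = sq_norm lborel (\<lambda>x::real. 0)"
    by (rule sq_norm_cong_AE) (use assms(3) in auto)
  also have "\<dots> = 0" by (simp add: sq_norm_def)
  finally show "\<exists>h. approximable h \<and> sq_norm lborel (\<lambda>x. h x - g x) < ennreal e"
    using assms(1) \<open>0 < e\<close> by (intro exI[of _ f]) simp
qed (rule assms(2))

lemma approximable_dominated_limit:
  assumes s: "\<And>n. approximable (s n)" and [measurable]: "f \<in> borel_measurable borel"
    and lim: "\<And>x. (\<lambda>n. s n x) \<longlonglongrightarrow> f x" and dom: "\<And>n x. \<bar>s n x\<bar> \<le> 2 * \<bar>f x\<bar>"
    and fin: "sq_norm lborel f < \<infinity>"
  shows "approximable f"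
proof (rule approximable_closed)
  have [measurable]: "s n \<in> borel_measurable borel" for n using s by (rule approximableD)
  have "(\<lambda>n. \<integral>\<^sup>+x. ennreal ((s n x - f x)\<^sup>2) \<partial>lborel) \<longlonglongrightarrow> (\<integral>\<^sup>+x. ennreal 0 \<partial>(lborel :: real measure))"
  proof (rule nn_integral_dominated_convergence[where w = "\<lambda>x. ennreal 9 * ennreal ((f x)\<^sup>2)"])
    show "AE x in lborel. ennreal ((s n x - f x)\<^sup>2) \<le> ennreal 9 * ennreal ((f x)\<^sup>2)" for n
    proof (rule AE_I2)
      fix x
      have "\<bar>s n x - f x\<bar> \<le> 3 * \<bar>f x\<bar>" using dom[of n x] by linarith
      then have "(s n x - f x)\<^sup>2 \<le> (3 * \<bar>f x\<bar>)\<^sup>2"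
        by (metis abs_ge_zero power2_abs power_mono)
      then have "ennreal ((s n x - f x)\<^sup>2) \<le> ennreal (9 * (f x)\<^sup>2)" by (intro ennreal_leI) (simp add: power_mult_distrib)
      then show "ennreal ((s n x - f x)\<^sup>2) \<le> ennreal 9 * ennreal ((f x)\<^sup>2)" by (simp add: ennreal_mult)
    qed
    have "(\<integral>\<^sup>+x. ennreal 9 * ennreal ((f x)\<^sup>2) \<partial>lborel) = ennreal 9 * sq_norm lborel f"
      unfolding sq_norm_def by (rule nn_integral_cmult) measurable
    with fin show "(\<integral>\<^sup>+x. ennreal 9 * ennreal ((f x)\<^sup>2) \<partial>lborel) < \<infinity>" by (simp add: ennreal_mult_less_top)
    show "AE x in lborel. (\<lambda>n. ennreal ((s n x - f x)\<^sup>2)) \<longlonglongrightarrow> ennreal 0"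
    proof (rule AE_I2, rule tendsto_ennrealI)
      fix x
      have "(\<lambda>n. (s n x - f x)\<^sup>2) \<longlonglongrightarrow> (f x - f x)\<^sup>2" by (intro tendsto_intros lim)
      then show "(\<lambda>n. (s n x - f x)\<^sup>2) \<longlonglongrightarrow> 0" by simp
    qed
  qed measurable
  then have "(\<lambda>n. sq_norm lborel (\<lambda>x. s n x - f x)) \<longlonglongrightarrow> 0" by (simp add: sq_norm_def)
  note to_0 = this
  fix e :: real assume "0 < e"
  then have "\<forall>\<^sub>F n in sequentially. sq_norm lborel (\<lambda>x. s n x - f x) < ennreal e"
    by (intro order_tendstoD(2)[OF to_0]) simp
  then obtain n where "sq_norm lborel (\<lambda>x. s n x - f x) < ennreal e"
    by (auto simp: eventually_sequentially)
  with s show "\<exists>g. approximable g \<and> sq_norm lborel (\<lambda>x. g x - f x) < ennreal e" by blast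
qed measurable

text \<open>
  Intervals generate the Borel sets, and the approximable functions form a closed linear
  space. A Dynkin argument thus yields indicator functions of Borel sets; simple functions
  and dominated convergence do the rest. The half-open interval \<open>{0<..T}\<close> matches the shape
  of the generators.
\<close>

lemma approximable_L2:
  assumes T: "0 \<le> T" and base: "\<And>a. 0 \<le> a \<Longrightarrow> a \<le> T \<Longrightarrow> approximable (indicator {a<..T})"
    and f [measurable]: "f \<in> borel_measurable borel" and supp: "\<And>x. x \<notin> {0..T} \<Longrightarrow> f x = 0"
    and fin: "sq_norm lborel f < \<infinity>"
  shows "approximable f"
proof -
  have fin_ind: "sq_norm lborel (indicator (B \<inter> {0<..T})) < \<infinity>" if "B \<in> sets borel" for B
  proof -
    have "sq_norm lborel (indicator (B \<inter> {0<..T})) \<le> (\<integral>\<^sup>+x. indicator {0..T} x \<partial>lborel)"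
      unfolding sq_norm_def by (intro nn_integral_mono) (auto simp: indicator_def)
    also have "\<dots> < \<infinity>" using T by simp
    finally show ?thesis .
  qed
  have ind: "approximable (indicator (B \<inter> {0<..T}))" if "B \<in> sets borel" for B
  proof -
    have "Int_stable (range (\<lambda>(a, b). {a <.. b::real}))"
      by (auto simp: Int_stable_def)
    moreover have "range (\<lambda>(a, b). {a <.. b::real}) \<subseteq> Pow UNIV" by simp
    moreover have "B \<in> sigma_sets UNIV (range (\<lambda>(a, b). {a <.. b::real}))"
      using that by (simp add: borel_sigma_sets_Ioc)
    ultimately show ?thesis
    proof (induction rule: sigma_sets_induct_disjoint)
      case (basic A)
      then obtain a b where A: "A = {a<..b}" by auto
      define a' where "a' = max 0 (min a T)"
      define b' where "b' = max a' (min b T)"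
      have ab: "0 \<le> a'" "a' \<le> T" "0 \<le> b'" "b' \<le> T" using T by (auto simp: a'_def b'_def)
      have "indicator (A \<inter> {0<..T}) = (\<lambda>x. indicator {a'<..T} x - indicator {b'<..T} x :: real)"
        using T unfolding A a'_def b'_def by (auto simp: fun_eq_iff indicator_def)
      then show ?case using approximable_diff[OF base[OF ab(1,2)] base[OF ab(3,4)]] by simp
    next
      case empty
      have "indicator ({} \<inter> {0<..T}) = (\<lambda>x. 0 :: real)" by (simp add: fun_eq_iff)
      then show ?case using approximable_zero by simp
    next
      case (compl A)
      have "indicator ((UNIV - A) \<inter> {0<..T}) = (\<lambda>x. indicator {0<..T} x - indicator (A \<inter> {0<..T}) x :: real)"
        by (auto simp: fun_eq_iff indicator_def)
      then show ?case using approximable_diff[OF base[of 0] compl.IH] T by simp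
    next
      case (union A)
      have A [measurable]: "A i \<in> sets borel" for i
        using union(2) by (auto simp: borel_sigma_sets_Ioc)
      show ?case
      proof (rule approximable_dominated_limit)
        fix n
        have "indicator ((\<Union>i<n. A i) \<inter> {0<..T}) = (\<lambda>x. \<Sum>i<n. indicator (A i \<inter> {0<..T}) x :: real)"
        proof
          fix x
          have "indicator (\<Union>i<n. A i \<inter> {0<..T}) x = (\<Sum>i<n. indicator (A i \<inter> {0<..T}) x :: real)"
            by (rule indicator_UN_disjoint) (use union(1) in \<open>auto simp: disjoint_family_on_def\<close>)
          moreover have "(\<Union>i<n. A i \<inter> {0<..T}) = (\<Union>i<n. A i) \<inter> {0<..T}" by blast
          ultimately show "indicator ((\<Union>i<n. A i) \<inter> {0<..T}) x = (\<Sum>i<n. indicator (A i \<inter> {0<..T}) x :: real)" by simp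
        qed
        then show "approximable (indicator ((\<Union>i<n. A i) \<inter> {0<..T}))"
          using union(3) by (simp add: approximable_sum)
      next
        fix x
        have "(\<lambda>n. indicator (\<Union>i<n. A i) x :: real) \<longlonglongrightarrow> indicator (\<Union>i. A i) x"
          by (rule LIMSEQ_indicator_UN)
        then have "(\<lambda>n. indicator (\<Union>i<n. A i) x * indicator {0<..T} x :: real) \<longlonglongrightarrow> indicator (\<Union>i. A i) x * indicator {0<..T} x"
          by (intro tendsto_intros)
        then show "(\<lambda>n. indicator ((\<Union>i<n. A i) \<inter> {0<..T}) x :: real) \<longlonglongrightarrow> indicator ((\<Union>i. A i) \<inter> {0<..T}) x"
          by (simp add: indicator_inter_arith)
      next
        fix n x
        show "\<bar>indicator ((\<Union>i<n. A i) \<inter> {0<..T}) x\<bar> \<le> 2 * \<bar>indicator ((\<Union>i. A i) \<inter> {0<..T}) x :: real\<bar>"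
          by (auto simp: indicator_def)
      next
        show "sq_norm lborel (indicator ((\<Union>i. A i) \<inter> {0<..T})) < \<infinity>" by (rule fin_ind) measurable
      qed measurable
    qed
  qed
  obtain F where F: "\<And>i. simple_function borel (F i)" "\<And>x. (\<lambda>i. F i x) \<longlonglongrightarrow> f x" "\<And>i x. \<bar>F i x\<bar> \<le> 2 * \<bar>f x\<bar>"
    using borel_measurable_implies_sequence_metric[OF f, of 0] by (auto simp: dist_real_def)
  have "approximable (\<lambda>x. indicator {0<..T} x * f x)"
  proof (rule approximable_dominated_limit)
    fix n
    have sf: "finite (range (F n))" "\<And>y. y \<in> range (F n) \<Longrightarrow> F n -` {y} \<in> sets borel"
      using F(1)[of n] by (auto simp: simple_function_def)
    have "(\<lambda>x. indicator {0<..T} x * F n x) = (\<lambda>x. \<Sum>y\<in>range (F n). y * indicator (F n -` {y} \<inter> {0<..T}) x)"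
    proof
      fix x
      have "F n x = (\<Sum>y\<in>range (F n). indicator (F n -` {y}) x *\<^sub>R y)"
        using simple_function_indicator_representation_banach[OF F(1)[of n], of x]
        by (simp only: space_borel Int_UNIV_right UNIV_I)
      then have "indicator {0<..T} x * F n x = indicator {0<..T} x * (\<Sum>y\<in>range (F n). indicator (F n -` {y}) x *\<^sub>R y)"
        by (rule arg_cong)
      also have "\<dots> = (\<Sum>y\<in>range (F n). y * indicator (F n -` {y} \<inter> {0<..T}) x)"
        unfolding sum_distrib_left indicator_inter_arith real_scaleR_def
        by (rule sum.cong[OF refl]) (simp only: mult.commute mult.left_commute)
      finally show "indicator {0<..T} x * F n x = (\<Sum>y\<in>range (F n). y * indicator (F n -` {y} \<inter> {0<..T}) x)" .
    qed
    moreover have "approximable (\<lambda>x. \<Sum>y\<in>range (F n). y * indicator (F n -` {y} \<inter> {0<..T}) x)"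
      by (intro approximable_sum approximable_cmult ind sf)
    ultimately show "approximable (\<lambda>x. indicator {0<..T} x * F n x)" by simp
  next
    fix x show "(\<lambda>n. indicator {0<..T} x * F n x) \<longlonglongrightarrow> indicator {0<..T} x * f x"
      by (intro tendsto_intros F)
  next
    fix n x show "\<bar>indicator {0<..T} x * F n x\<bar> \<le> 2 * \<bar>indicator {0<..T} x * f x\<bar>"
      using F(3)[of n x] by (auto simp: indicator_def)
  next
    have "sq_norm lborel (\<lambda>x. indicator {0<..T} x * f x) \<le> sq_norm lborel f"
      unfolding sq_norm_def by (intro nn_integral_mono) (auto simp: indicator_def)
    then show "sq_norm lborel (\<lambda>x. indicator {0<..T} x * f x) < \<infinity>" using fin by (rule order.strict_trans1)
  qed measurable
  moreover have "AE x in lborel. indicator {0<..T} x * f x = f x"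
  proof -
    have *: "indicator {0<..T} x * f x = f x" if "x \<noteq> 0" for x
      using supp[of x] that by (cases "x \<in> {0..T}") (auto simp: indicator_def)
    from AE_lborel_singleton[of 0] show ?thesis by eventually_elim (rule *)
  qed
  ultimately show ?thesis by (rule approximable_cong_AE[OF _ f])
qed

end

lemma measurable_step_fun [measurable]: "step_fun xs \<in> borel_measurable borel"
proof (induction xs)
  case Nil
  have "step_fun [] = (\<lambda>x. 0)" by (simp add: step_fun_def fun_eq_iff)
  then show ?case by simp
next
  case (Cons p xs)
  obtain c a b where p: "p = (c, a, b)" by (cases p)
  have "step_fun (p # xs) = (\<lambda>x. c * indicator {a<..b} x + step_fun xs x)"
    by (simp add: step_fun_def p fun_eq_iff)
  with Cons show ?case by simp
qed

lemma step_fun_append [simp]: "step_fun (xs @ ys) x = step_fun xs x + step_fun ys x"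
  by (simp add: step_fun_def)

lemma step_fun_scale [simp]: "step_fun (step_scale c xs) x = c * step_fun xs x"
  by (induction xs) (auto simp: step_scale_def step_fun_def algebra_simps)

lemma step_fun_diff [simp]: "step_fun (step_diff xs ys) x = step_fun xs x - step_fun ys x"
  by (simp add: step_diff_def)

lemma step_RL_append [simp]: "step_RL H (xs @ ys) x = step_RL H xs x + step_RL H ys x"
  by (simp add: step_RL_def)

lemma step_RL_scale [simp]: "step_RL H (step_scale c xs) x = c * step_RL H xs x"
  by (simp add: step_RL_def)

lemma step_RL_diff [simp]: "step_RL H (step_diff xs ys) x = step_RL H xs x - step_RL H ys x"
  by (simp add: step_RL_def)

lemma step_fun_dense:
  assumes T: "0 \<le> T" and f: "f \<in> borel_measurable borel" and supp: "\<And>x. x \<notin> {0..T} \<Longrightarrow> f x = 0"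
    and fin: "sq_norm lborel f < \<infinity>" and e: "0 < e"
  obtains xs where "step_list T xs" "sq_norm lborel (\<lambda>x. step_fun xs x - f x) < ennreal e"
proof -
  interpret step_system T step_fun by standard auto
  have "approximable (indicator {a<..T})" if "0 \<le> a" "a \<le> T" for a
    unfolding approximable_def using that
    by (auto intro!: exI[of _ "[(1, a, T)]"] simp: step_fun_def sq_norm_def)
  from approximable_L2[OF T this f supp fin] e that show thesis
    unfolding approximable_def by blast
qed

text \<open>
  With \<open>s = 1 / 2 - H\<close>, the indicator function of \<open>{a<..}\<close> is the superposition of the
  kernels \<open>rl_kernel (1 - s) (x - v)\<close> with weight \<open>rl_kernel s (v - a)\<close>. Rounding \<open>v\<close> down
  to a grid of mesh \<open>h\<close> turns the superposition into the fractional derivative of a step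
  function. By Cauchy--Schwarz the squared error is at most the square of the total weight
  times the squared modulus of continuity of the kernel under translations in \<open>L\<^sup>2\<close>, which
  is of order \<open>h\<close> to the power \<open>2 * H\<close>.
\<close>

lemma step_RL_approximates_indicator:
  assumes H: "0 < H" "H < 1 / 2" and a: "0 \<le> a" "a < T" and e: "0 < e"
  obtains xs where "step_list T xs" "sq_norm lborel (\<lambda>x. zero_ext T (step_RL H xs) x - indicator {a<..T} x) < ennreal e"
proof -
  define s where "s = 1 / 2 - H"
  have s: "0 < s" using H by (simp add: s_def)
  define k where "k = rl_kernel (H + 1 / 2)"
  define m where "m = rl_kernel (1 + s) (T - a)"
  have m: "0 \<le> m" using s by (simp add: m_def rl_kernel_nonneg)
  have nn: "0 \<le> rl_kernel s x" "0 \<le> rl_kernel 1 x" for x using s by (auto intro: rl_kernel_nonneg)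
  have [measurable]: "k \<in> borel_measurable borel" by (simp add: k_def)
  obtain c where c: "0 \<le> c" "\<And>t r. sq_norm lborel (\<lambda>x. k (x - t) - k (x - r)) = ennreal (c * \<bar>t - r\<bar> powr (2 * H))"
    using sq_norm_rl_kernel_diff[of H] H unfolding k_def by auto
  have bound: "\<exists>xs. step_list T xs \<and> sq_norm lborel (\<lambda>x. zero_ext T (step_RL H xs) x - indicator {a<..T} x)
      \<le> ennreal (m\<^sup>2 * (c * ((T - a) / Suc n) powr (2 * H)))" for n
  proof -
    define N where "N = Suc n"
    define h where "h = (T - a) / N"
    have h: "0 < h" using a by (simp add: h_def N_def)
    have hN: "a + h * N = T" by (simp add: h_def N_def)
    define u where "u i = a + h * real i" for i :: nat
    define \<phi> where "\<phi> v = a + h * \<lfloor>(v - a) / h\<rfloor>" for v :: real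
    have [measurable]: "\<phi> \<in> borel_measurable borel" unfolding \<phi>_def by measurable
    have \<phi>: "\<bar>\<phi> v - v\<bar> \<le> h" for v
    proof -
      have "\<phi> v - v = h * (\<lfloor>(v - a) / h\<rfloor> - (v - a) / h)" using h by (simp add: \<phi>_def field_simps)
      moreover have "\<bar>\<lfloor>(v - a) / h\<rfloor> - (v - a) / h\<bar> \<le> 1" by linarith
      ultimately show ?thesis using h by (simp add: abs_mult)
    qed
    define w where "w i = rl_kernel (1 + s) (u (Suc i) - a) - rl_kernel (1 + s) (u i - a)" for i
    define xs where "xs = map (\<lambda>i. (w i, u i, T)) [0..<N]"
    have uT: "u i \<le> T" if "i < N" for i
      using that h hN by (simp add: u_def) (smt (verit) less_imp_le mult_left_mono of_nat_less_iff)
    have u0: "0 \<le> u i" for i using h a by (simp add: u_def)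
    have steps: "step_list T xs"
      using uT u0 by (auto simp: step_list_def xs_def)
    have V: "step_RL H xs x = (\<Sum>i<N. w i * k (x - u i))" if "x \<le> T" for x
    proof -
      have "step_RL H xs x = (\<Sum>i\<leftarrow>[0..<N]. w i * (k (x - u i) - k (x - T)))"
        by (simp add: step_RL_def step_integral_def xs_def k_def comp_def)
      also have "k (x - T) = 0" using that by (simp add: k_def)
      finally show ?thesis by (simp add: interv_sum_list_conv_sum_set_nat atLeast0LessThan)
    qed
    define I where "I i v = rl_kernel 1 (u (Suc i) - v) - rl_kernel 1 (u i - v)" for i v
    have I_\<phi>: "I i v * k (x - u i) = I i v * k (x - \<phi> v)" for i v x
    proof (cases "u i \<le> v \<and> v < u (Suc i)")
      case True
      then have "real i \<le> (v - a) / h" "(v - a) / h < real i + 1"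
        using h by (auto simp: u_def field_simps)
      then have "\<lfloor>(v - a) / h\<rfloor> = int i" by linarith
      then show ?thesis by (simp add: \<phi>_def u_def)
    next
      case False
      moreover have "u i \<le> u (Suc i)" using h by (simp add: u_def)
      ultimately have "I i v = 0" by (auto simp: I_def rl_kernel_1 indicator_def)
      then show ?thesis by simp
    qed
    \<comment> \<open>The second term of the telescoped sum lives on \<open>v < a\<close>, where the weight vanishes.\<close>
    have sum_I: "(\<Sum>i<N. I i v) * rl_kernel s (v - a) = rl_kernel 1 (T - v) * rl_kernel s (v - a)" for v
    proof -
      have "(\<Sum>i<N. I i v) = rl_kernel 1 (T - v) - rl_kernel 1 (a - v)"
        unfolding I_def by (subst sum_lessThan_telescope) (simp add: u_def hN)
      then show ?thesis by (cases "a < v") auto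
    qed
    have int_V: "has_bochner_integral lborel (\<lambda>v. rl_kernel 1 (T - v) * rl_kernel s (v - a) * k (x - \<phi> v)) (\<Sum>i<N. w i * k (x - u i))" for x
    proof -
      have "has_bochner_integral lborel (\<lambda>v. \<Sum>i<N. (rl_kernel 1 (u (Suc i) - v) * rl_kernel s (v - a) - rl_kernel 1 (u i - v) * rl_kernel s (v - a)) * k (x - u i))
          (\<Sum>i<N. w i * k (x - u i))"
        unfolding w_def
        by (intro has_bochner_integral_sum has_bochner_integral_mult_left has_bochner_integral_diff
            has_bochner_integral_rl_kernel_conv s) auto
      also have "(\<lambda>v. \<Sum>i<N. (rl_kernel 1 (u (Suc i) - v) * rl_kernel s (v - a) - rl_kernel 1 (u i - v) * rl_kernel s (v - a)) * k (x - u i))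
         = (\<lambda>v. rl_kernel 1 (T - v) * rl_kernel s (v - a) * k (x - \<phi> v))"
      proof
        fix v
        have "(\<Sum>i<N. (rl_kernel 1 (u (Suc i) - v) * rl_kernel s (v - a) - rl_kernel 1 (u i - v) * rl_kernel s (v - a)) * k (x - u i))
            = (\<Sum>i<N. rl_kernel s (v - a) * (I i v * k (x - u i)))"
          by (simp add: I_def algebra_simps)
        also have "\<dots> = ((\<Sum>i<N. I i v) * rl_kernel s (v - a)) * k (x - \<phi> v)"
          unfolding I_\<phi> by (simp add: sum_distrib_right sum_distrib_left mult_ac)
        finally show "(\<Sum>i<N. (rl_kernel 1 (u (Suc i) - v) * rl_kernel s (v - a) - rl_kernel 1 (u i - v) * rl_kernel s (v - a)) * k (x - u i))
          = rl_kernel 1 (T - v) * rl_kernel s (v - a) * k (x - \<phi> v)" unfolding sum_I .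
      qed
      finally show ?thesis .
    qed
    have int_ind: "has_bochner_integral lborel (\<lambda>v. rl_kernel 1 (T - v) * rl_kernel s (v - a) * k (x - v)) (rl_kernel 1 (x - a))" if "x \<le> T" for x
    proof -
      have "has_bochner_integral lborel (\<lambda>v. k (x - v) * rl_kernel s (v - a)) (rl_kernel 1 (x - a))"
        using has_bochner_integral_rl_kernel_conv[of "H + 1 / 2" s x a] H s by (simp add: k_def s_def)
      moreover have "k (x - v) * rl_kernel s (v - a) = rl_kernel 1 (T - v) * rl_kernel s (v - a) * k (x - v)" for v
        using that by (cases "v < x") (auto simp: k_def rl_kernel_1)
      ultimately show ?thesis by simp
    qed
    let ?D = "\<lambda>x. zero_ext T (step_RL H xs) x - indicator {a<..T} x"
    let ?p = "\<lambda>v. rl_kernel 1 (T - v) * rl_kernel s (v - a)"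
    have p_nn: "0 \<le> ?p v" for v using nn by simp
    have p_int: "(\<integral>\<^sup>+v. ennreal (?p v) \<partial>lborel) = ennreal m"
      unfolding m_def by (rule nn_integral_rl_kernel_conv) (use s in auto)
    have D: "ennreal ((?D x)\<^sup>2) \<le> ennreal m * (\<integral>\<^sup>+v. ennreal (?p v) * ennreal ((k (x - \<phi> v) - k (x - v))\<^sup>2) \<partial>lborel)" for x
    proof (cases "x \<in> {0..T}")
      case False
      then have "?D x = 0" using a by (auto simp: zero_ext_def indicator_def)
      then show ?thesis by simp
    next
      case True
      have eq: "?D x = (LINT v|lborel. ?p v * k (x - \<phi> v) - ?p v * k (x - v))"
        using int_V[of x] int_ind[of x] True V[of x]
        by (simp add: has_bochner_integral_iff zero_ext_def rl_kernel_1 indicator_def)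
      have "ennreal \<bar>?D x\<bar> \<le> (\<integral>\<^sup>+v. ennreal (norm (?p v * k (x - \<phi> v) - ?p v * k (x - v))) \<partial>lborel)"
        unfolding eq real_norm_def[symmetric] using int_V[of x] int_ind[of x] True
        by (intro integral_norm_bound_ennreal) (auto simp: has_bochner_integral_iff)
      also have "\<dots> = (\<integral>\<^sup>+v. ennreal (?p v * \<bar>k (x - \<phi> v) - k (x - v)\<bar>) \<partial>lborel)"
        unfolding right_diff_distrib[symmetric] real_norm_def abs_mult[of "?p _"] by (simp only: abs_of_nonneg p_nn)
      finally have "(ennreal \<bar>?D x\<bar>)\<^sup>2 \<le> (\<integral>\<^sup>+v. ennreal (?p v * \<bar>k (x - \<phi> v) - k (x - v)\<bar>) \<partial>lborel)\<^sup>2"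
        by (rule power_mono) simp
      also have "\<dots> \<le> (\<integral>\<^sup>+v. ennreal (?p v) \<partial>lborel) * (\<integral>\<^sup>+v. ennreal (?p v * (k (x - \<phi> v) - k (x - v))\<^sup>2) \<partial>lborel)"
        by (rule nn_integral_weighted_sq_le) (measurable, rule p_nn)
      finally show ?thesis by (simp only: p_int ennreal_power abs_ge_zero power2_abs ennreal_mult' p_nn)
    qed
    have "sq_norm lborel ?D \<le> (\<integral>\<^sup>+x. ennreal m * (\<integral>\<^sup>+v. ennreal (?p v) * ennreal ((k (x - \<phi> v) - k (x - v))\<^sup>2) \<partial>lborel) \<partial>lborel)"
      unfolding sq_norm_def by (intro nn_integral_mono D)
    also have "\<dots> = ennreal m * (\<integral>\<^sup>+x. (\<integral>\<^sup>+v. ennreal (?p v) * ennreal ((k (x - \<phi> v) - k (x - v))\<^sup>2) \<partial>lborel) \<partial>lborel)"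
      by (rule nn_integral_cmult) measurable
    also have "(\<integral>\<^sup>+x. (\<integral>\<^sup>+v. ennreal (?p v) * ennreal ((k (x - \<phi> v) - k (x - v))\<^sup>2) \<partial>lborel) \<partial>lborel)
       = (\<integral>\<^sup>+v. (\<integral>\<^sup>+x. ennreal (?p v) * ennreal ((k (x - \<phi> v) - k (x - v))\<^sup>2) \<partial>lborel) \<partial>lborel)"
      by (rule lborel_pair.Fubini') measurable
    also have "\<dots> = (\<integral>\<^sup>+v. ennreal (?p v) * sq_norm lborel (\<lambda>x. k (x - \<phi> v) - k (x - v)) \<partial>lborel)"
      unfolding sq_norm_def by (intro nn_integral_cong nn_integral_cmult) measurable
    also have "\<dots> \<le> (\<integral>\<^sup>+v. ennreal (?p v) * ennreal (c * h powr (2 * H)) \<partial>lborel)"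
    proof (intro nn_integral_mono mult_left_mono)
      fix v
      show "sq_norm lborel (\<lambda>x. k (x - \<phi> v) - k (x - v)) \<le> ennreal (c * h powr (2 * H))"
        unfolding c(2) using \<phi>[of v] c(1) H by (intro ennreal_leI mult_left_mono powr_mono2) auto
    qed simp
    also have "\<dots> = ennreal m * ennreal (c * h powr (2 * H))"
      by (subst nn_integral_multc) (measurable, simp only: p_int)
    also have "ennreal m * (ennreal m * ennreal (c * h powr (2 * H))) = ennreal (m\<^sup>2 * (c * h powr (2 * H)))"
      using m c(1) by (simp add: ennreal_mult power2_eq_square mult.assoc)
    finally have "sq_norm lborel ?D \<le> ennreal (m\<^sup>2 * (c * h powr (2 * H)))"
      by (simp add: mult_left_mono)
    with steps show ?thesis unfolding h_def N_def by blast
  qed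
  have "(\<lambda>n. m\<^sup>2 * (c * ((T - a) / real (Suc n)) powr (2 * H))) \<longlonglongrightarrow> m\<^sup>2 * (c * 0)"
  proof (intro tendsto_intros tendsto_zero_powrI)
    show "(\<lambda>n. (T - a) / real (Suc n)) \<longlonglongrightarrow> 0"
      using tendsto_mult[OF tendsto_const LIMSEQ_inverse_real_of_nat, of "T - a"] by (simp add: divide_inverse)
    show "(\<lambda>n. 2 * H) \<longlonglongrightarrow> 2 * H" by simp
  qed (use a H in \<open>auto intro!: always_eventually\<close>)
  then have "\<forall>\<^sub>F n in sequentially. m\<^sup>2 * (c * ((T - a) / real (Suc n)) powr (2 * H)) < e"
    using e by (intro order_tendstoD(2)) auto
  then obtain n where "m\<^sup>2 * (c * ((T - a) / real (Suc n)) powr (2 * H)) < e"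
    by (auto simp: eventually_sequentially)
  then have "ennreal (m\<^sup>2 * (c * ((T - a) / real (Suc n)) powr (2 * H))) < ennreal e"
    using e by (simp add: ennreal_lessI)
  with bound[of n] that show thesis by (meson order.strict_trans1)
qed

text \<open>
  The closed span of the fractional derivatives contains the indicator functions, hence
  everything.
\<close>

lemma step_RL_dense:
  assumes H: "0 < H" "H < 1 / 2" and T: "0 \<le> T" and f: "f \<in> borel_measurable borel"
    and supp: "\<And>x. x \<notin> {0..T} \<Longrightarrow> f x = 0" and fin: "sq_norm lborel f < \<infinity>" and e: "0 < e"
  obtains xs where "step_list T xs" "sq_norm lborel (\<lambda>x. zero_ext T (step_RL H xs) x - f x) < ennreal e"
proof -
  interpret step_system T "\<lambda>xs. zero_ext T (step_RL H xs)"
    by standard (auto simp: zero_ext_def)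
  have "approximable (indicator {a<..T})" if "0 \<le> a" "a \<le> T" for a
  proof (cases "a = T")
    case True
    have "indicator {T<..T} = (\<lambda>x. 0 :: real)" by (simp add: fun_eq_iff)
    with True show ?thesis using approximable_zero by simp
  next
    case False
    show ?thesis
      unfolding approximable_def
    proof (intro conjI allI impI)
      fix e :: real assume "0 < e"
      with False that obtain xs where "step_list T xs"
        "sq_norm lborel (\<lambda>x. zero_ext T (step_RL H xs) x - indicator {a<..T} x) < ennreal e"
        using step_RL_approximates_indicator[OF H, of a T e] by auto
      then show "\<exists>xs. step_list T xs \<and> sq_norm lborel (\<lambda>x. zero_ext T (step_RL H xs) x - indicator {a<..T} x) < ennreal e"
        by blast
    qed measurable
  qed
  from approximable_L2[OF T this f supp fin] e that show thesis
    unfolding approximable_def by blast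
qed

section \<open>Passage to Borel representatives; composition of fractional integrals\<close>

text \<open>
  Completeness of Lebesgue measure.
\<close>

lemma lebesgue_measurable_cong_AE:
  fixes f F :: "real \<Rightarrow> real"
  assumes F: "F \<in> borel_measurable borel" and eq: "AE x in lborel. f x = F x"
  shows "f \<in> borel_measurable lebesgue"
proof (rule measurableI)
  fix A :: "real set" assume A: "A \<in> sets borel"
  have "AE x in lebesgue. x \<in> F -` A \<longleftrightarrow> x \<in> f -` A"
    using AE_completion[OF eq] by eventually_elim simp
  moreover have "F -` A \<in> sets lebesgue"
    using measurable_sets_borel[OF F A] by simp
  ultimately have "f -` A \<in> sets lebesgue"
    using completion.in_sets_AE[of "F -` A" "f -` A" lborel] by simp
  then show "f -` A \<inter> space lebesgue \<in> sets lebesgue" by simp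
qed simp

lemma integral_lebesgue_on_eq:
  fixes f F :: "real \<Rightarrow> real"
  assumes F [measurable]: "F \<in> borel_measurable borel" and eq: "AE x in lborel. x \<in> {a..b} \<longrightarrow> f x = F x"
  shows "(LINT x|lebesgue_on {a..b}. f x) = (LINT x|lborel. indicator {a..b} x * F x)"
proof -
  have eq': "AE x in lborel. indicator {a..b} x * f x = indicator {a..b} x * F x"
    using eq by eventually_elim (auto simp: indicator_def)
  have [measurable]: "(\<lambda>x. indicator {a..b} x * F x) \<in> borel_measurable borel" by measurable
  have "(LINT x|lebesgue_on {a..b}. f x) = (LINT x|lebesgue. indicator {a..b} x * f x)"
    by (subst integral_restrict_space) auto
  also have "\<dots> = (LINT x|lebesgue. indicator {a..b} x * F x)"
    by (intro integral_cong_AE lebesgue_measurable_cong_AE[OF _ eq'] AE_completion[OF eq'] measurable_completion) measurable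
  also have "\<dots> = (LINT x|lborel. indicator {a..b} x * F x)"
    by (rule integral_completion) measurable
  finally show ?thesis .
qed

text \<open>
  Product measures need Borel functions, so all computations are carried out with a Borel
  version that vanishes outside \<open>{0..T}\<close>.
\<close>

lemma sq_integrable_borel_rep:
  assumes q: "sq_integrable T q"
  obtains q' where "q' \<in> borel_measurable borel" "\<And>x. x \<notin> {0..T} \<Longrightarrow> q' x = 0"
    "AE x in lborel. zero_ext T q x = q' x" "sq_norm lborel q' = ennreal ((L2_norm T q)\<^sup>2)"
proof -
  have zero_ext_if: "zero_ext T q = (\<lambda>x. if x \<in> {0..T} then q x else 0)" by (simp add: zero_ext_def fun_eq_iff)
  have "q \<in> borel_measurable (lebesgue_on {0..T})" and int: "integrable (lebesgue_on {0..T}) (\<lambda>r. (q r)\<^sup>2)"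
    using q by (auto simp: sq_integrable_def)
  then have "zero_ext T q \<in> borel_measurable lebesgue"
    unfolding zero_ext_if by (subst borel_measurable_if) auto
  then obtain r where r: "r \<in> borel_measurable lborel" "AE x in lborel. zero_ext T q x = r x"
    using completion_ex_borel_measurable_real by blast
  define q' where "q' = zero_ext T r"
  have [measurable]: "q' \<in> borel_measurable borel" using r(1) by (auto simp: q'_def)
  have eq: "AE x in lborel. zero_ext T q x = q' x"
    using r(2) by eventually_elim (auto simp: q'_def zero_ext_def split: if_splits)
  have "integrable lebesgue (\<lambda>x. indicator {0..T} x *\<^sub>R (q x)\<^sup>2)"
    using int by (subst (asm) integrable_restrict_space) auto
  then have "integrable lebesgue (\<lambda>x. (zero_ext T q x)\<^sup>2)"
    by (rule Bochner_Integration.integrable_cong[OF refl, THEN iffD1, rotated]) (simp add: zero_ext_def)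
  moreover have "(\<lambda>x. (q' x)\<^sup>2) \<in> borel_measurable lebesgue" by (rule measurable_completion) measurable
  moreover have "AE x in lebesgue. (zero_ext T q x)\<^sup>2 = (q' x)\<^sup>2"
    using AE_completion[OF eq] by eventually_elim simp
  ultimately have "integrable lebesgue (\<lambda>x. (q' x)\<^sup>2)"
    by (rule integrable_cong_AE_imp)
  then have int': "integrable lborel (\<lambda>x. (q' x)\<^sup>2)"
    by (subst (asm) integrable_completion) auto
  have "(L2_norm T q)\<^sup>2 = (LINT x|lebesgue_on {0..T}. (q x)\<^sup>2)"
    unfolding L2_norm_def by (rule real_sqrt_pow2) simp
  also have "\<dots> = (LINT x|lborel. indicator {0..T} x * (q' x)\<^sup>2)"
    by (rule integral_lebesgue_on_eq, measurable) (use eq in eventually_elim, auto simp: zero_ext_def split: if_splits)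
  also have "\<dots> = (LINT x|lborel. (q' x)\<^sup>2)"
    by (intro Bochner_Integration.integral_cong refl) (simp add: q'_def zero_ext_def indicator_def)
  finally have "sq_norm lborel q' = ennreal ((L2_norm T q)\<^sup>2)"
    using sq_norm_eq_integral[OF int'] by simp
  moreover have "q' x = 0" if "x \<notin> {0..T}" for x
    using that by (auto simp: q'_def zero_ext_def)
  ultimately show thesis using eq by (intro that[of q']) auto
qed

lemma RL_integral_eq_rl_conv:
  assumes a: "0 < a" and [measurable]: "q' \<in> borel_measurable borel" and supp: "\<And>x. x \<notin> {0..T} \<Longrightarrow> q' x = 0"
    and eq: "AE x in lborel. zero_ext T q x = q' x" and t: "t \<le> T"
  shows "RL_integral a q t = rl_conv a q' t"
proof -
  have "(LINT r|lebesgue_on {0..t}. (t - r) powr (a - 1) * q r)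
      = (LINT r|lborel. indicator {0..t} r * ((t - r) powr (a - 1) * q' r))"
  proof (rule integral_lebesgue_on_eq)
    show "AE r in lborel. r \<in> {0..t} \<longrightarrow> (t - r) powr (a - 1) * q r = (t - r) powr (a - 1) * q' r"
      using eq by eventually_elim (use t in \<open>auto simp: zero_ext_def\<close>)
  qed measurable
  then have "RL_integral a q t = (LINT r|lborel. 1 / Gamma a * (indicator {0..t} r * ((t - r) powr (a - 1) * q' r)))"
    by (simp add: RL_integral_def)
  also have "\<dots> = rl_conv a q' t"
    unfolding rl_conv_def
  proof (intro Bochner_Integration.integral_cong refl)
    fix r show "1 / Gamma a * (indicator {0..t} r * ((t - r) powr (a - 1) * q' r)) = rl_kernel a (t - r) * q' r"
      using supp[of r] by (cases "0 \<le> r") (auto simp: rl_kernel_def indicator_def)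
  qed
  finally show ?thesis .
qed

lemma integrable_indicator_Icc: "integrable lborel (indicator {a..b} :: real \<Rightarrow> real)"
  by (intro integrable_real_indicator) (auto simp: emeasure_bounded_finite[OF bounded_closed_interval, unfolded infinity_ennreal_def])

lemma integrable_of_sq_norm:
  assumes [measurable]: "f \<in> borel_measurable borel" and supp: "\<And>x. x \<notin> {0..T} \<Longrightarrow> f x = 0"
    and fin: "sq_norm lborel f < \<infinity>"
  shows "integrable lborel (f :: real \<Rightarrow> real)"
proof (rule Bochner_Integration.integrable_bound)
  show "integrable lborel (\<lambda>x. indicator {0..T} x + (f x)\<^sup>2)"
    using fin by (intro Bochner_Integration.integrable_add integrable_indicator_Icc) (simp add: integrable_sq_iff)
  show "AE x in lborel. norm (f x) \<le> norm (indicator {0..T} x + (f x)\<^sup>2)"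
  proof (rule AE_I2)
    fix x
    have "\<bar>f x\<bar> \<le> 1 + (f x)\<^sup>2"
      using zero_le_power2[of "\<bar>f x\<bar> - 1"] zero_le_power2[of "f x"] by (simp add: power2_diff)
    then show "norm (f x) \<le> norm (indicator {0..T} x + (f x)\<^sup>2)"
      using supp[of x] by (cases "x \<in> {0..T}") auto
  qed
qed measurable

text \<open>
  Fubini's theorem and the semigroup law of the kernels. For \<open>a + b \<ge> 1\<close> the composed kernel
  is bounded on bounded sets, so that the identity holds at every point and not just almost
  everywhere.
\<close>

lemma rl_conv_rl_conv:
  assumes a: "0 < a" and b: "0 < b" and ab: "1 \<le> a + b"
    and [measurable]: "f \<in> borel_measurable borel" and supp: "\<And>x. x < 0 \<Longrightarrow> f x = 0" and int: "integrable lborel f"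
  shows "rl_conv a (rl_conv b f) x = rl_conv (a + b) f x"
proof -
  define F where "F t u = rl_kernel a (x - t) * (rl_kernel b (t - u) * f u)" for t u
  have [measurable]: "case_prod F \<in> borel_measurable (lborel \<Otimes>\<^sub>M lborel)"
    unfolding F_def by measurable
  have nn: "0 \<le> rl_kernel a y" "0 \<le> rl_kernel b y" "0 \<le> rl_kernel (a + b) y" for y
    using a b by (auto intro: rl_kernel_nonneg)
  have F: "integrable (lborel \<Otimes>\<^sub>M lborel) (case_prod F)"
  proof (rule integrableI_bounded)
    have "(\<integral>\<^sup>+z. ennreal (norm (case_prod F z)) \<partial>(lborel \<Otimes>\<^sub>M lborel)) = (\<integral>\<^sup>+u. (\<integral>\<^sup>+t. ennreal (norm (F t u)) \<partial>lborel) \<partial>lborel)"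
      by (subst lborel_pair.nn_integral_snd[symmetric]) auto
    also have "\<dots> = (\<integral>\<^sup>+u. ennreal (rl_kernel (a + b) (x - u)) * ennreal \<bar>f u\<bar> \<partial>lborel)"
    proof (rule nn_integral_cong)
      fix u
      have "(\<integral>\<^sup>+t. ennreal (norm (F t u)) \<partial>lborel) = (\<integral>\<^sup>+t. ennreal (rl_kernel a (x - t) * rl_kernel b (t - u)) * ennreal \<bar>f u\<bar> \<partial>lborel)"
        using nn by (intro nn_integral_cong) (simp add: F_def abs_mult ennreal_mult' mult.assoc)
      also have "\<dots> = ennreal (rl_kernel (a + b) (x - u)) * ennreal \<bar>f u\<bar>"
        by (subst nn_integral_multc) (use a b in \<open>simp_all add: nn_integral_rl_kernel_conv\<close>)
      finally show "(\<integral>\<^sup>+t. ennreal (norm (F t u)) \<partial>lborel) = ennreal (rl_kernel (a + b) (x - u)) * ennreal \<bar>f u\<bar>" .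
    qed
    also have "\<dots> \<le> (\<integral>\<^sup>+u. ennreal (rl_kernel (a + b) x) * ennreal \<bar>f u\<bar> \<partial>lborel)"
    proof (rule nn_integral_mono)
      fix u show "ennreal (rl_kernel (a + b) (x - u)) * ennreal \<bar>f u\<bar> \<le> ennreal (rl_kernel (a + b) x) * ennreal \<bar>f u\<bar>"
        using supp[of u] ab by (cases "u < 0") (auto intro!: mult_right_mono ennreal_leI rl_kernel_mono)
    qed
    also have "\<dots> = ennreal (rl_kernel (a + b) x) * (\<integral>\<^sup>+u. ennreal \<bar>f u\<bar> \<partial>lborel)"
      by (rule nn_integral_cmult) measurable
    also have "\<dots> < \<infinity>"
      using int by (auto simp: ennreal_mult_less_top integrable_iff_bounded)
    finally show "(\<integral>\<^sup>+z. ennreal (norm (case_prod F z)) \<partial>(lborel \<Otimes>\<^sub>M lborel)) < \<infinity>" .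
  qed measurable
  have inner: "(LINT u|lborel. F t u) = rl_kernel a (x - t) * rl_conv b f t" for t
    by (simp add: F_def rl_conv_def)
  have "rl_conv a (rl_conv b f) x = (LINT t|lborel. LINT u|lborel. F t u)"
    by (simp only: inner) (simp add: rl_conv_def)
  also have "\<dots> = (LINT u|lborel. LINT t|lborel. F t u)"
    by (rule lborel_pair.Fubini_integral[OF F, symmetric])
  also have "\<dots> = (LINT u|lborel. rl_kernel (a + b) (x - u) * f u)"
  proof (intro Bochner_Integration.integral_cong refl)
    fix u
    have "(LINT t|lborel. F t u) = (LINT t|lborel. rl_kernel a (x - t) * rl_kernel b (t - u) * f u)"
      by (simp add: F_def mult.assoc)
    then show "(LINT t|lborel. F t u) = rl_kernel (a + b) (x - u) * f u"
      using has_bochner_integral_rl_kernel_conv[OF a b, of x u] by (simp add: has_bochner_integral_iff)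
  qed
  finally show "rl_conv a (rl_conv b f) x = rl_conv (a + b) f x" by (simp add: rl_conv_def)
qed

lemma rl_conv_neg:
  assumes "\<And>x. x < 0 \<Longrightarrow> f x = 0" "t \<le> 0"
  shows "rl_conv a f t = 0"
proof -
  have "(\<lambda>u. rl_kernel a (t - u) * f u) = (\<lambda>u. 0)"
  proof
    fix u show "rl_kernel a (t - u) * f u = 0"
      using assms by (cases "u < 0") auto
  qed
  then show ?thesis by (simp add: rl_conv_def)
qed

text \<open>
  Cauchy--Schwarz: for \<open>a > 1 / 2\<close> the kernel is locally square integrable, so that
  fractional integrals of square integrable functions tend to 0 at the origin.
\<close>

lemma rl_conv_sq_le:
  assumes a: "1 / 2 < a" and [measurable]: "f \<in> borel_measurable borel" and supp: "\<And>x. x < 0 \<Longrightarrow> f x = 0"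
    and fin: "sq_norm lborel f < \<infinity>"
  obtains C where "0 \<le> C" "\<And>t. (rl_conv a f t)\<^sup>2 \<le> C * rl_kernel (2 * a) t"
proof -
  define p where "p = enn2real (sq_norm lborel f)"
  have p: "sq_norm lborel f = ennreal p" "0 \<le> p" using fin by (auto simp: p_def)
  define G where "G = Gamma (2 * a - 1) / (Gamma a)\<^sup>2"
  have G: "0 \<le> G" using a by (simp add: G_def Gamma_real_pos less_imp_le)
  have nn: "0 \<le> rl_kernel a x" "0 \<le> rl_kernel (2 * a) x" "0 \<le> rl_kernel (2 * a - 1) x" for x using a by (auto intro: rl_kernel_nonneg)
  have "(rl_conv a f t)\<^sup>2 \<le> (G * p) * rl_kernel (2 * a) t" for t
  proof -
    let ?k = "\<lambda>u. rl_kernel a (t - u) * indicator {0..} u"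
    have "rl_conv a f t = (LINT u|lborel. ?k u * f u)"
      unfolding rl_conv_def using supp by (intro Bochner_Integration.integral_cong refl) (auto simp: indicator_def)
    then have "(ennreal \<bar>rl_conv a f t\<bar>)\<^sup>2 \<le> sq_norm lborel ?k * ennreal p"
      using integral_mult_sq_le[of ?k lborel f] by (simp add: p(1))
    also have "sq_norm lborel ?k
       = (\<integral>\<^sup>+u. ennreal G * (ennreal (rl_kernel (2 * a - 1) (t - u)) * indicator {0..} u) \<partial>lborel)"
      unfolding sq_norm_def
    proof (rule nn_integral_cong)
      fix u
      have "(rl_kernel a (t - u))\<^sup>2 = G * rl_kernel (2 * a - 1) (t - u)"
        unfolding G_def by (rule rl_kernel_sq[OF a])
      then show "ennreal ((?k u)\<^sup>2) = ennreal G * (ennreal (rl_kernel (2 * a - 1) (t - u)) * indicator {0..} u)"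
        using nn G by (simp add: indicator_def ennreal_mult)
    qed
    also have "\<dots> = ennreal G * (\<integral>\<^sup>+u. ennreal (rl_kernel (2 * a - 1) (t - u)) * indicator {0..} u \<partial>lborel)"
      by (rule nn_integral_cmult) measurable
    also have "(\<integral>\<^sup>+u. ennreal (rl_kernel (2 * a - 1) (t - u)) * indicator {0..} u \<partial>lborel)
       = (\<integral>\<^sup>+u. ennreal (rl_kernel (2 * a - 1) u) * indicator {..t} u \<partial>lborel)"
      by (subst nn_integral_real_affine[where c = "-1" and t = t]) (auto simp: indicator_def intro!: nn_integral_cong)
    also have "\<dots> = ennreal (rl_kernel (2 * a) t)"
      using nn_integral_rl_kernel[of "2 * a - 1" t] a by simp
    also have "ennreal G * ennreal (rl_kernel (2 * a) t) * ennreal p = ennreal (G * p * rl_kernel (2 * a) t)"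
      using G p(2) nn by (simp add: ennreal_mult mult_ac)
    finally show ?thesis using G p(2) nn by (simp add: ennreal_power)
  qed
  moreover have "0 \<le> G * p" using G p(2) by simp
  ultimately show thesis using that by blast
qed

text \<open>
  Such a function is orthogonal to all step functions, hence, by their density, to itself.
\<close>

lemma AE_zero_of_interval_integrals:
  fixes f :: "real \<Rightarrow> real"
  assumes T: "0 \<le> T" and [measurable]: "f \<in> borel_measurable borel" and supp: "\<And>x. x \<notin> {0..T} \<Longrightarrow> f x = 0"
    and fin: "sq_norm lborel f < \<infinity>"
    and zero: "\<And>a b. 0 \<le> a \<Longrightarrow> a \<le> b \<Longrightarrow> b \<le> T \<Longrightarrow> (LINT x|lborel. indicator {a<..b} x * f x) = 0"
  shows "AE x in lborel. f x = 0"
proof -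
  have int: "integrable lborel f" by (rule integrable_of_sq_norm[OF _ supp fin]) measurable
  have step: "integrable lborel (\<lambda>x. step_fun xs x * f x) \<and> (LINT x|lborel. step_fun xs x * f x) = 0" if "step_list T xs" for xs
    using that
  proof (induction xs)
    case Nil
    then show ?case by (simp add: step_fun_def)
  next
    case (Cons p xs)
    obtain c a b where p: "p = (c, a, b)" by (cases p)
    have 1: "integrable lborel (\<lambda>x. indicator {a<..b} x * f x)"
      using integrable_mult_indicator[OF _ int, of "{a<..b}"] by simp
    have "(\<lambda>x. step_fun (p # xs) x * f x) = (\<lambda>x. c * (indicator {a<..b} x * f x) + step_fun xs x * f x)"
      by (simp add: p step_fun_def fun_eq_iff algebra_simps)
    then show ?case using Cons 1 zero[of a b] by (simp add: p)
  qed
  define p where "p = enn2real (sq_norm lborel f)"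
  have p: "sq_norm lborel f = ennreal p" "0 \<le> p" using fin by (auto simp: p_def)
  have int2: "integrable lborel (\<lambda>x. (f x)\<^sup>2)" using fin by (simp add: integrable_sq_iff)
  have "p\<^sup>2 \<le> p * e" if "0 < e" for e
  proof -
    obtain xs where xs: "step_list T xs" "sq_norm lborel (\<lambda>x. step_fun xs x - f x) < ennreal e"
      using step_fun_dense[OF T _ supp fin \<open>0 < e\<close>] by auto
    let ?r = "\<lambda>x. step_fun xs x - f x"
    have "- p = - (LINT x|lborel. (f x)\<^sup>2)" using sq_norm_eq_integral[OF int2] p by simp
    also have "\<dots> = (LINT x|lborel. step_fun xs x * f x - (f x)\<^sup>2)" using step[OF xs(1)] int2 by simp
    also have "\<dots> = (LINT x|lborel. f x * ?r x)" by (simp add: algebra_simps power2_eq_square)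
    finally have "(ennreal \<bar>- p\<bar>)\<^sup>2 \<le> sq_norm lborel f * sq_norm lborel ?r"
      using integral_mult_sq_le[of f lborel ?r] by simp
    also have "\<dots> \<le> ennreal p * ennreal e"
      unfolding p(1) using xs(2) by (intro mult_left_mono) auto
    finally show ?thesis using p(2) \<open>0 < e\<close> by (simp add: ennreal_power ennreal_mult[symmetric])
  qed
  then have "p \<le> e" if "0 < e" for e
    using that p(2) by (cases "p = 0") (auto simp: power2_eq_square)
  then have "p \<le> 0" by (rule dense_ge)
  then have "sq_norm lborel f = 0" using p by simp
  then have "AE x in lborel. ennreal ((f x)\<^sup>2) = 0"
    unfolding sq_norm_def by (subst (asm) nn_integral_0_iff_AE) auto
  then show ?thesis by eventually_elim (simp add: ennreal_eq_0_iff)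
qed

section \<open>Inversion of the weak fractional derivative\<close>

text \<open>
  A continuous approximation from below of the indicator function of the open interval, with
  compact support inside that interval.
\<close>

definition trapezoid :: "real \<Rightarrow> real \<Rightarrow> nat \<Rightarrow> real \<Rightarrow> real" where
  "trapezoid a b n x = max 0 (min 1 (real (Suc n) * min (x - a) (b - x) - 1))"

lemma trapezoid_bounds: "0 \<le> trapezoid a b n x" "trapezoid a b n x \<le> 1"
  by (auto simp: trapezoid_def)

lemma continuous_trapezoid: "continuous_on S (trapezoid a b n)"
  unfolding trapezoid_def by (intro continuous_intros)

lemma measurable_trapezoid [measurable]: "trapezoid a b n \<in> borel_measurable borel"
  by (rule borel_measurable_continuous_onI[OF continuous_trapezoid])

lemma trapezoid_support:
  assumes "trapezoid a b n x \<noteq> 0"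
  shows "a + 1 / real (Suc n) \<le> x" "x \<le> b - 1 / real (Suc n)"
proof -
  have "1 < real (Suc n) * min (x - a) (b - x)"
    using assms by (auto simp: trapezoid_def max_def min_def split: if_splits)
  then have "1 / real (Suc n) < min (x - a) (b - x)"
    by (subst pos_divide_less_eq) (simp_all only: mult.commute of_nat_0_less_iff zero_less_Suc)
  then show "a + 1 / real (Suc n) \<le> x" "x \<le> b - 1 / real (Suc n)" by auto
qed

lemma trapezoid_le_indicator: "norm (trapezoid a b n x) \<le> indicator {a..b} x"
proof (cases "trapezoid a b n x = 0")
  case False
  have "0 < 1 / real (Suc n)" by simp
  then have "a \<le> x" "x \<le> b" using trapezoid_support[OF False] by linarith+
  then show ?thesis using trapezoid_bounds[of a b n x] by simp
qed simp

lemma trapezoid_tendsto: "(\<lambda>n. trapezoid a b n x) \<longlonglongrightarrow> indicator {a<..<b} x"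
proof (cases "x \<in> {a<..<b}")
  case True
  define d where "d = min (x - a) (b - x)"
  have d: "0 < d" using True by (auto simp: d_def)
  obtain N :: nat where N: "2 / d < real N" using reals_Archimedean2 by blast
  have "trapezoid a b n x = 1" if "N \<le> n" for n
  proof -
    have "2 / d < real (Suc n)" using N that by simp
    then have "2 < real (Suc n) * d" using d by (simp add: divide_less_eq)
    then show ?thesis by (simp add: trapezoid_def d_def[symmetric])
  qed
  then have "\<forall>\<^sub>F n in sequentially. trapezoid a b n x = 1" by (auto simp: eventually_sequentially)
  with True show ?thesis by (simp add: tendsto_eventually)
next
  case False
  have "trapezoid a b n x = 0" for n
  proof (rule ccontr)
    assume "trapezoid a b n x \<noteq> 0"
    from trapezoid_support[OF this] have "a + 1 / real (Suc n) \<le> x" "x \<le> b - 1 / real (Suc n)" .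
    moreover have "0 < 1 / real (Suc n)" by simp
    ultimately have "a < x" "x < b" by linarith+
    with False show False by simp
  qed
  with False show ?thesis by simp
qed

text \<open>
  The antiderivative that vanishes to the left of the support vanishes to the right as well,
  because the total integral is 0.
\<close>

lemma antiderivative_of_mean_zero:
  assumes cont: "continuous_on UNIV \<psi>" and c: "0 < c" and supp: "\<And>x. x \<notin> {c..d} \<Longrightarrow> \<psi> x = (0::real)"
    and mean: "(LINT x|lborel. \<psi> x) = 0"
  obtains \<phi> where "\<And>t. (\<phi> has_real_derivative \<psi> t) (at t)" "\<And>t. t \<notin> {c..d} \<Longrightarrow> \<phi> t = 0"
proof -
  define \<phi> where "\<phi> t = integral {0..t} \<psi>" for t
  have below: "\<phi> t = 0" if "t < c" for t
  proof -
    have "integral {0..t} \<psi> = integral {0..t} (\<lambda>_. 0)"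
      by (rule Henstock_Kurzweil_Integration.integral_cong) (use that supp in auto)
    then show ?thesis by (simp add: \<phi>_def)
  qed
  have above: "\<phi> t = 0" if "d < t" "c \<le> t" for t
  proof -
    have "set_integrable lborel {0..t} \<psi>"
      by (rule borel_integrable_atLeastAtMost') (use cont continuous_on_subset in blast)
    then have "\<phi> t = (LINT x:{0..t}|lborel. \<psi> x)"
      unfolding \<phi>_def by (rule set_borel_integral_eq_integral(2)[symmetric])
    also have "\<dots> = (LINT x|lborel. \<psi> x)"
      unfolding set_lebesgue_integral_def
    proof (intro Bochner_Integration.integral_cong refl)
      fix x show "indicator {0..t} x *\<^sub>R \<psi> x = \<psi> x"
        using supp[of x] that c by (cases "x \<in> {c..d}") (auto simp: indicator_def)
    qed
    finally show ?thesis by (simp add: mean)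
  qed
  have deriv: "(\<phi> has_real_derivative \<psi> t) (at t)" for t
  proof (cases "t < c")
    case True
    have "((\<lambda>_. 0) has_real_derivative 0) (at t)" by simp
    then have "(\<phi> has_real_derivative 0) (at t)"
      by (rule has_field_derivative_transform_within_open[where S = "{..<c}"]) (use True below in auto)
    with True supp[of t] show ?thesis by simp
  next
    case False
    have "(\<phi> has_real_derivative \<psi> t) (at t within {0..t + 1})"
      unfolding \<phi>_def
      by (rule integral_has_real_derivative) (use cont continuous_on_subset False c in auto)
    then show ?thesis using False c by (simp add: at_within_Icc_at)
  qed
  from deriv show thesis
  proof (rule that)
    fix t assume "t \<notin> {c..d}"
    then show "\<phi> t = 0" using below[of t] above[of t] by (cases "t < c") auto
  qed
qed

text \<open>
  Derivatives of test functions are the continuous functions with compact support and mean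
  0. Combining the trapezoids of a subinterval and of the whole interval to have mean 0, and
  letting them tend to indicator functions, shows that all subintervals have the same
  average of \<open>h\<close>.
\<close>

lemma du_Bois_Reymond:
  fixes h :: "real \<Rightarrow> real"
  assumes T: "0 < T" and [measurable]: "h \<in> borel_measurable borel" and supp: "\<And>x. x \<notin> {0..T} \<Longrightarrow> h x = 0"
    and fin: "sq_norm lborel h < \<infinity>"
    and test: "\<And>\<phi> \<phi>'. (\<And>t. (\<phi> has_real_derivative \<phi>' t) (at t)) \<Longrightarrow> continuous_on UNIV \<phi>' \<Longrightarrow>
        (\<exists>c d. 0 < c \<and> d < T \<and> (\<forall>t. t \<notin> {c..d} \<longrightarrow> \<phi> t = 0)) \<Longrightarrow> (LINT t|lborel. h t * \<phi>' t) = 0"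
  obtains c where "AE x in lborel. x \<in> {0..T} \<longrightarrow> h x = c"
proof -
  have int_h: "integrable lborel h" by (rule integrable_of_sq_norm[OF _ supp fin]) measurable
  define P where "P a b n = (LINT x|lborel. h x * trapezoid a b n x)" for a b n
  define J where "J a b n = (LINT x|lborel. trapezoid a b n x)" for a b n
  have int_P: "integrable lborel (\<lambda>x. h x * trapezoid a b n x)" for a b n
    by (rule Bochner_Integration.integrable_bound[OF int_h])
       (auto simp: abs_mult mult_left_le trapezoid_bounds)
  have int_J: "integrable lborel (trapezoid a b n)" for a b n
  proof (rule Bochner_Integration.integrable_bound)
    show "integrable lborel (indicator {a..b} :: real \<Rightarrow> real)"
      by (rule integrable_indicator_Icc)
    show "AE x in lborel. norm (trapezoid a b n x) \<le> norm (indicator {a..b} x :: real)"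
      using trapezoid_le_indicator[of a b n] by (intro AE_I2) (simp add: order_trans[OF _ abs_ge_self])
  qed measurable
  have ratio: "J 0 T n * P a b n = J a b n * P 0 T n" if "0 \<le> a" "b \<le> T" for a b n
  proof -
    \<comment> \<open>This combination has mean 0 and is thus the derivative of a test function.\<close>
    define \<psi> where "\<psi> x = J 0 T n * trapezoid a b n x - J a b n * trapezoid 0 T n x" for x
    have cont: "continuous_on UNIV \<psi>" unfolding \<psi>_def by (intro continuous_intros continuous_trapezoid)
    have "\<psi> x = 0" if "x \<notin> {1 / real (Suc n)..T - 1 / real (Suc n)}" for x
    proof -
      have "trapezoid a b n x = 0" "trapezoid 0 T n x = 0"
        using that \<open>0 \<le> a\<close> \<open>b \<le> T\<close> trapezoid_support[of a b n x] trapezoid_support[of 0 T n x] by fastforce+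
      then show ?thesis by (simp add: \<psi>_def)
    qed
    moreover have "(LINT x|lborel. \<psi> x) = 0"
      unfolding \<psi>_def using int_J by (simp add: J_def)
    ultimately obtain \<phi> where \<phi>: "\<And>t. (\<phi> has_real_derivative \<psi> t) (at t)"
      "\<And>t. t \<notin> {1 / real (Suc n)..T - 1 / real (Suc n)} \<Longrightarrow> \<phi> t = 0"
      using antiderivative_of_mean_zero[OF cont, of "1 / real (Suc n)" "T - 1 / real (Suc n)"] by auto
    have "\<exists>c d. 0 < c \<and> d < T \<and> (\<forall>t. t \<notin> {c..d} \<longrightarrow> \<phi> t = 0)"
      using \<phi>(2) by (intro exI[of _ "1 / real (Suc n)"] exI[of _ "T - 1 / real (Suc n)"]) simp
    from test[OF \<phi>(1) cont this] have "(LINT x|lborel. J 0 T n * (h x * trapezoid a b n x) - J a b n * (h x * trapezoid 0 T n x)) = 0"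
      by (simp add: \<psi>_def algebra_simps)
    then show ?thesis using int_P by (simp add: P_def)
  qed
  have lim_P: "(\<lambda>n. P a b n) \<longlonglongrightarrow> (LINT x|lborel. h x * indicator {a<..<b} x)" for a b
    unfolding P_def
  proof (rule integral_dominated_convergence[where w = "\<lambda>x. \<bar>h x\<bar>"])
    show "AE x in lborel. (\<lambda>n. h x * trapezoid a b n x) \<longlonglongrightarrow> h x * indicator {a<..<b} x"
      by (intro AE_I2 tendsto_intros trapezoid_tendsto)
    show "AE x in lborel. norm (h x * trapezoid a b n x) \<le> \<bar>h x\<bar>" for n
      by (intro AE_I2) (simp add: abs_mult mult_left_le trapezoid_bounds)
  qed (use int_h in auto)
  have lim_J: "(\<lambda>n. J a b n) \<longlonglongrightarrow> b - a" if "a \<le> b" for a b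
  proof -
    have "(\<lambda>n. J a b n) \<longlonglongrightarrow> (LINT x|lborel. indicator {a<..<b} x)"
      unfolding J_def
    proof (rule integral_dominated_convergence[where w = "indicator {a..b}"])
      show "AE x in lborel. (\<lambda>n. trapezoid a b n x) \<longlonglongrightarrow> indicator {a<..<b} x"
        by (intro AE_I2 trapezoid_tendsto)
      show "integrable lborel (indicator {a..b} :: real \<Rightarrow> real)"
      by (rule integrable_indicator_Icc)
      show "AE x in lborel. norm (trapezoid a b n x) \<le> indicator {a..b} x" for n
        by (intro AE_I2 trapezoid_le_indicator)
    qed measurable
    then show ?thesis using that by simp
  qed
  define c where "c = (LINT x|lborel. h x * indicator {0<..<T} x) / T"
  define f where "f x = h x - c * indicator {0..T} x" for x
  have mean: "(LINT x|lborel. h x * indicator {a<..<b} x) = c * (b - a)" if "0 \<le> a" "a \<le> b" "b \<le> T" for a b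
  proof -
    have "(\<lambda>n. J 0 T n * P a b n) \<longlonglongrightarrow> (T - 0) * (LINT x|lborel. h x * indicator {a<..<b} x)"
      using T by (intro tendsto_mult lim_J lim_P) simp
    moreover have "(\<lambda>n. J a b n * P 0 T n) \<longlonglongrightarrow> (b - a) * (LINT x|lborel. h x * indicator {0<..<T} x)"
      using that by (intro tendsto_mult lim_J lim_P)
    ultimately have "T * (LINT x|lborel. h x * indicator {a<..<b} x) = (b - a) * (LINT x|lborel. h x * indicator {0<..<T} x)"
      using ratio[of a b] that by (auto intro: LIMSEQ_unique)
    then show ?thesis using T by (simp add: c_def field_simps)
  qed
  have "AE x in lborel. f x = 0"
  proof (rule AE_zero_of_interval_integrals)
    show "f \<in> borel_measurable borel" unfolding f_def by measurable
    show "f x = 0" if "x \<notin> {0..T}" for x using supp[OF that] that by (simp add: f_def)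
    have "sq_norm lborel f \<le> 2 * sq_norm lborel h + 2 * sq_norm lborel (\<lambda>x. c * indicator {0..T} x)"
      unfolding f_def by (rule sq_norm_diff) measurable
    also have "sq_norm lborel (\<lambda>x. c * indicator {0..T} x) = ennreal (c\<^sup>2) * sq_norm lborel (indicator {0..T})"
      by (rule sq_norm_cmult) measurable
    also have "sq_norm lborel (indicator {0..T} :: real \<Rightarrow> real) = (\<integral>\<^sup>+x. indicator {0..T} x \<partial>lborel)"
      unfolding sq_norm_def by (intro nn_integral_cong) (simp add: indicator_def)
    also have "\<dots> = ennreal T" using T by simp
    also have "2 * sq_norm lborel h + 2 * (ennreal (c\<^sup>2) * ennreal T) < \<infinity>"
      using fin by (simp add: ennreal_mult_less_top)
    finally show "sq_norm lborel f < \<infinity>" .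
    fix a b assume ab: "0 \<le> a" "a \<le> b" "b \<le> T"
    have 1: "integrable lborel (\<lambda>x. h x * indicator {a<..<b} x)"
      using integrable_mult_indicator[OF _ int_h, of "{a<..<b}"] by (simp add: mult.commute)
    have 2: "integrable lborel (indicator {a<..<b} :: real \<Rightarrow> real)" using ab(2) by simp
    have "(LINT x|lborel. indicator {a<..b} x * f x) = (LINT x|lborel. h x * indicator {a<..<b} x - c * indicator {a<..<b} x)"
    proof (rule integral_cong_AE)
      show "AE x in lborel. indicator {a<..b} x * f x = h x * indicator {a<..<b} x - c * indicator {a<..<b} x"
        using AE_lborel_singleton[of b]
        by eventually_elim (use ab in \<open>auto simp: f_def indicator_def\<close>)
      show "(\<lambda>x. indicator {a<..b} x * f x) \<in> borel_measurable lborel" unfolding f_def by measurable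
    qed measurable
    also have "\<dots> = 0" using mean[OF ab] ab 1 2 by simp
    finally show "(LINT x|lborel. indicator {a<..b} x * f x) = 0" .
  qed (use T in auto)
  then have "AE x in lborel. x \<in> {0..T} \<longrightarrow> h x = c"
    by eventually_elim (auto simp: f_def)
  with that show thesis .
qed

lemma integral_rl_conv_1_by_parts:
  assumes T: "0 < T" and [measurable]: "g \<in> borel_measurable borel" and supp: "\<And>x. x \<notin> {0..T} \<Longrightarrow> g x = 0"
    and fin: "sq_norm lborel g < \<infinity>"
    and deriv: "\<And>t. (\<phi> has_real_derivative \<phi>' t) (at t)" and cont: "continuous_on UNIV \<phi>'" and end0: "\<phi> T = 0"
  shows "integrable lborel (\<lambda>t. zero_ext T (rl_conv 1 g) t * \<phi>' t)"
    "(LINT t|lborel. zero_ext T (rl_conv 1 g) t * \<phi>' t) = - (LINT t|lborel. g t * \<phi> t)"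
proof -
  have int_g: "integrable lborel g" by (rule integrable_of_sq_norm[OF _ supp fin]) measurable
  have [measurable]: "\<phi>' \<in> borel_measurable borel"
    by (rule borel_measurable_continuous_onI[OF cont])
  define F where "F t u = indicator {0..T} t * \<phi>' t * (rl_kernel 1 (t - u) * g u)" for t u
  have [measurable]: "case_prod F \<in> borel_measurable (lborel \<Otimes>\<^sub>M lborel)"
    unfolding F_def by measurable
  have set_int: "set_integrable lborel {a..b} \<phi>'" for a b
    by (rule borel_integrable_atLeastAtMost') (use cont continuous_on_subset in blast)
  have int_\<phi>': "integrable lborel (\<lambda>t. indicator {0..T} t * \<phi>' t)"
    using set_int[of 0 T] by (simp add: set_integrable_def)
  have F: "integrable (lborel \<Otimes>\<^sub>M lborel) (case_prod F)"
  proof (rule Bochner_Integration.integrable_bound)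
    show "integrable (lborel \<Otimes>\<^sub>M lborel) (\<lambda>(t, u). (indicator {0..T} t * \<phi>' t) * g u)"
      by (rule lborel_pair.integrable_product_swap_iff[THEN iffD1], rule lborel_pair.Fubini_integrable)
         (use int_g int_\<phi>' in \<open>auto simp: abs_mult intro!: integrable_abs\<close>)
    show "AE z in lborel \<Otimes>\<^sub>M lborel. norm (case_prod F z) \<le> norm ((\<lambda>(t, u). (indicator {0..T} t * \<phi>' t) * g u) z)"
      by (rule AE_I2) (auto simp: F_def rl_kernel_1 indicator_def)
  qed measurable
  have inner: "(LINT u|lborel. F t u) = zero_ext T (rl_conv 1 g) t * \<phi>' t" for t
    by (simp add: F_def rl_conv_def zero_ext_def)
  show "integrable lborel (\<lambda>t. zero_ext T (rl_conv 1 g) t * \<phi>' t)"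
    using lborel_pair.integrable_fst'[OF F] by (simp add: inner)
  have "(LINT t|lborel. zero_ext T (rl_conv 1 g) t * \<phi>' t) = (LINT t|lborel. LINT u|lborel. F t u)"
    by (simp only: inner)
  also have "\<dots> = (LINT u|lborel. LINT t|lborel. F t u)"
    by (rule lborel_pair.Fubini_integral[OF F, symmetric])
  also have "\<dots> = (LINT u|lborel. - (g u * \<phi> u))"
  proof (intro Bochner_Integration.integral_cong refl)
    fix u
    show "(LINT t|lborel. F t u) = - (g u * \<phi> u)"
    proof (cases "u \<in> {0..T}")
      case False
      then show ?thesis using supp[of u] by (simp add: F_def)
    next
      case True
      have "(LINT t|lborel. F t u) = (LINT t|lborel. g u * (indicator {u..T} t *\<^sub>R \<phi>' t))"
      proof (rule integral_cong_AE)
        show "AE t in lborel. F t u = g u * (indicator {u..T} t *\<^sub>R \<phi>' t)"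
          using AE_lborel_singleton[of u]
          by eventually_elim (use True in \<open>auto simp: F_def rl_kernel_1 indicator_def\<close>)
      qed measurable
      also have "\<dots> = g u * integral {u..T} \<phi>'"
        using set_borel_integral_eq_integral(2)[OF set_int[of u T]] by (simp add: set_lebesgue_integral_def)
      also have "integral {u..T} \<phi>' = \<phi> T - \<phi> u"
      proof (rule integral_unique, rule fundamental_theorem_of_calculus)
        show "(\<phi> has_vector_derivative \<phi>' x) (at x within {u..T})" for x
          using deriv[of x] has_field_derivative_at_within has_real_derivative_iff_has_vector_derivative by blast
      qed (use True in auto)
      finally show ?thesis by (simp add: end0)
    qed
  qed
  also have "\<dots> = - (LINT t|lborel. g t * \<phi> t)" by simp
  finally show "(LINT t|lborel. zero_ext T (rl_conv 1 g) t * \<phi>' t) = - (LINT t|lborel. g t * \<phi> t)" .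
qed

text \<open>
  The primitive of \<open>g'\<close> has the same weak derivative, and du Bois-Reymond's lemma applies to
  the difference.
\<close>

lemma has_weak_derivative_antiderivative:
  assumes T: "0 < T" and w: "has_weak_derivative 0 T F g"
    and [measurable]: "f \<in> borel_measurable borel" and F: "\<And>t. t \<in> {0..T} \<Longrightarrow> F t = f t"
    and f_fin: "sq_norm lborel (zero_ext T f) < \<infinity>"
    and [measurable]: "g' \<in> borel_measurable borel" and g_supp: "\<And>x. x \<notin> {0..T} \<Longrightarrow> g' x = 0"
    and g_fin: "sq_norm lborel g' < \<infinity>" and g: "AE x in lborel. zero_ext T g x = g' x"
  obtains c where "AE x in lborel. x \<in> {0..T} \<longrightarrow> f x - rl_conv 1 g' x = c"
proof -
  define h where "h = (\<lambda>x. zero_ext T f x - zero_ext T (rl_conv 1 g') x)"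
  have [measurable]: "h \<in> borel_measurable borel" unfolding h_def by measurable
  have "sq_norm lborel h \<le> 2 * sq_norm lborel (zero_ext T f) + 2 * sq_norm lborel (zero_ext T (rl_conv 1 g'))"
    unfolding h_def by (rule sq_norm_diff) measurable
  also have "\<dots> \<le> 2 * sq_norm lborel (zero_ext T f) + 2 * (ennreal ((rl_kernel (1 + 1) T)\<^sup>2) * sq_norm lborel g')"
    by (intro add_left_mono mult_left_mono sq_norm_rl_conv_le g_supp) auto
  also have "\<dots> < \<infinity>" using f_fin g_fin by (simp add: ennreal_mult_less_top)
  finally have h_fin: "sq_norm lborel h < \<infinity>" .
  obtain c where c: "AE x in lborel. x \<in> {0..T} \<longrightarrow> h x = c"
  proof (rule du_Bois_Reymond[OF T _ _ h_fin])
    show "h x = 0" if "x \<notin> {0..T}" for x using that by (auto simp: h_def zero_ext_def)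
    fix \<phi> \<phi>' :: "real \<Rightarrow> real"
    assume deriv: "\<And>t. (\<phi> has_real_derivative \<phi>' t) (at t)" and cont: "continuous_on UNIV \<phi>'"
      and supp: "\<exists>c d. 0 < c \<and> d < T \<and> (\<forall>t. t \<notin> {c..d} \<longrightarrow> \<phi> t = 0)"
    have [measurable]: "\<phi>' \<in> borel_measurable borel" by (rule borel_measurable_continuous_onI[OF cont])
    have "continuous_on UNIV \<phi>" using deriv by (meson DERIV_continuous continuous_at_imp_continuous_on)
    then have [measurable]: "\<phi> \<in> borel_measurable borel" by (rule borel_measurable_continuous_onI)
    have T0: "\<phi> T = 0" using supp by auto
    have "(LINT t|lebesgue_on {0..T}. F t * \<phi>' t) = - (LINT t|lebesgue_on {0..T}. g t * \<phi> t)"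
      using w deriv cont supp unfolding has_weak_derivative_def by blast
    also have "(LINT t|lebesgue_on {0..T}. F t * \<phi>' t) = (LINT t|lborel. indicator {0..T} t * (f t * \<phi>' t))"
      by (rule integral_lebesgue_on_eq) (use F in auto)
    also have "\<dots> = (LINT t|lborel. zero_ext T f t * \<phi>' t)"
      by (intro Bochner_Integration.integral_cong refl) (simp add: zero_ext_def)
    also have "(LINT t|lebesgue_on {0..T}. g t * \<phi> t) = (LINT t|lborel. indicator {0..T} t * (g' t * \<phi> t))"
      by (rule integral_lebesgue_on_eq, measurable) (use g in eventually_elim, auto simp: zero_ext_def split: if_splits)
    also have "\<dots> = (LINT t|lborel. g' t * \<phi> t)"
      using g_supp by (intro Bochner_Integration.integral_cong refl) (auto simp: indicator_def)
    finally have *: "(LINT t|lborel. zero_ext T f t * \<phi>' t) = - (LINT t|lborel. g' t * \<phi> t)" .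
    have "integrable lborel (\<lambda>t. zero_ext T f t * \<phi>' t)"
    proof -
      have "bounded (\<phi>' ` {0..T})"
        by (rule compact_imp_bounded[OF compact_continuous_image[OF continuous_on_subset[OF cont subset_UNIV]]]) simp
      then obtain B where "\<forall>y\<in>\<phi>' ` {0..T}. norm y \<le> B" by (auto simp: bounded_iff)
      then have B: "\<bar>\<phi>' t\<bar> \<le> B" if "t \<in> {0..T}" for t using that by auto
      have f_int: "integrable lborel (zero_ext T f)"
        by (rule integrable_of_sq_norm[OF _ _ f_fin, of T]) (auto simp: zero_ext_def)
      show ?thesis
      proof (rule Bochner_Integration.integrable_bound)
        show "integrable lborel (\<lambda>t. B * zero_ext T f t)" using f_int by simp
        show "AE t in lborel. norm (zero_ext T f t * \<phi>' t) \<le> norm (B * zero_ext T f t)"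
        proof (rule AE_I2)
          fix t show "norm (zero_ext T f t * \<phi>' t) \<le> norm (B * zero_ext T f t)"
          proof (cases "t \<in> {0..T}")
            case True
            have "\<bar>\<phi>' t\<bar> \<le> \<bar>B\<bar>" using B[OF True] by linarith
            then show ?thesis by (simp add: abs_mult mult.commute mult_right_mono)
          qed (auto simp: zero_ext_def)
        qed
      qed measurable
    qed
    then show "(LINT t|lborel. h t * \<phi>' t) = 0"
      using integral_rl_conv_1_by_parts[OF T _ g_supp g_fin deriv cont T0] *
      by (simp add: h_def left_diff_distrib)
  qed (use that in auto)
  have "AE x in lborel. x \<in> {0..T} \<longrightarrow> f x - rl_conv 1 g' x = c"
    using c by eventually_elim (auto simp: h_def zero_ext_def)
  with that show thesis .
qed

text \<open>
  Put \<open>s = 1 / 2 - H\<close>. The fractional integral of order \<open>1 - s\<close> of \<open>q\<close> equals the primitive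
  of \<open>g\<close> up to a constant. The constant is 0, because both are fractional integrals of order
  above \<open>1 / 2\<close> of square integrable functions and tend to 0 at the origin. Integrating once
  more, with order \<open>s\<close>, shows that \<open>q\<close> and the fractional integral of order \<open>s\<close> of \<open>g\<close> have
  the same primitive.
\<close>

lemma RL_derivative_inverse:
  assumes H: "0 < H" "H < 1 / 2" and T: "0 < T" and w: "has_RL_derivative T (1 / 2 - H) q g"
    and [measurable]: "q' \<in> borel_measurable borel" and q_supp: "\<And>x. x \<notin> {0..T} \<Longrightarrow> q' x = 0"
    and q_fin: "sq_norm lborel q' < \<infinity>" and q: "AE x in lborel. zero_ext T q x = q' x"
    and [measurable]: "g' \<in> borel_measurable borel" and g_supp: "\<And>x. x \<notin> {0..T} \<Longrightarrow> g' x = 0"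
    and g_fin: "sq_norm lborel g' < \<infinity>" and g: "AE x in lborel. zero_ext T g x = g' x"
  shows "AE x in lborel. q' x = zero_ext T (rl_conv (1 / 2 - H) g') x"
proof -
  define s where "s = 1 / 2 - H"
  define a where "a = H + 1 / 2"
  have as: "0 < s" "1 / 2 < a" "0 < a" "s + a = 1" "a + s = 1" using H by (auto simp: s_def a_def)
  have q_neg: "x < 0 \<Longrightarrow> q' x = 0" and g_neg: "x < 0 \<Longrightarrow> g' x = 0" for x
    using q_supp[of x] g_supp[of x] by auto
  have int_q: "integrable lborel q'" by (rule integrable_of_sq_norm[OF _ q_supp q_fin]) measurable
  have int_g: "integrable lborel g'" by (rule integrable_of_sq_norm[OF _ g_supp g_fin]) measurable
  have w': "has_weak_derivative 0 T (RL_integral a q) g"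
    using w by (simp add: has_RL_derivative_def a_def add.commute)
  have RL: "RL_integral a q t = rl_conv a q' t" if "t \<in> {0..T}" for t
    by (rule RL_integral_eq_rl_conv[OF as(3) _ q_supp q]) (use that in auto)
  have conv_fin: "sq_norm lborel (zero_ext T (rl_conv a q')) < \<infinity>"
  proof -
    have "sq_norm lborel (zero_ext T (rl_conv a q')) \<le> ennreal ((rl_kernel (a + 1) T)\<^sup>2) * sq_norm lborel q'"
      by (rule sq_norm_rl_conv_le[OF as(3) _ q_supp]) measurable
    also have "\<dots> < \<infinity>" using q_fin by (simp add: ennreal_mult_less_top)
    finally show ?thesis .
  qed
  obtain c where c: "AE x in lborel. x \<in> {0..T} \<longrightarrow> rl_conv a q' x - rl_conv 1 g' x = c"
    using has_weak_derivative_antiderivative[OF T w' _ RL conv_fin _ g_supp g_fin g] by auto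
  \<comment> \<open>Otherwise \<open>c\<^sup>2\<close> would be at most \<open>b\<close>, which tends to 0 at the origin, on a set of positive measure.\<close>
  have "c = 0"
  proof (rule ccontr)
    assume "c \<noteq> 0"
    obtain C where C: "0 \<le> C" "\<And>t. (rl_conv a q' t)\<^sup>2 \<le> C * rl_kernel (2 * a) t"
      using rl_conv_sq_le[OF as(2) _ q_neg q_fin] by auto
    obtain D where D: "0 \<le> D" "\<And>t. (rl_conv 1 g' t)\<^sup>2 \<le> D * rl_kernel (2 * 1) t"
      using rl_conv_sq_le[of 1, OF _ _ g_neg g_fin] by auto
    define b where "b t = 2 * (C * rl_kernel (2 * a) t) + 2 * (D * rl_kernel (2 * 1) t)" for t
    have Gamma0: "Gamma (2 * a) \<noteq> 0" "Gamma (2 :: real) \<noteq> 0"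
      using as Gamma_real_pos[of "2 * a"] Gamma_real_pos[of 2] by (metis less_irrefl mult_pos_pos zero_less_numeral)+
    have "((\<lambda>t. t powr (2 * a - 1)) \<longlongrightarrow> 0) (at_right (0 :: real))"
      by (rule tendsto_zero_powrI[where b = "2 * a - 1"])
         (use as in \<open>auto intro!: tendsto_ident_at eventually_at_rightI[of 0 1]\<close>)
    then have "((\<lambda>t. 2 * (C * (t powr (2 * a - 1) / Gamma (2 * a))) + 2 * (D * (t / Gamma 2))) \<longlongrightarrow> 2 * (C * (0 / Gamma (2 * a))) + 2 * (D * (0 / Gamma 2))) (at_right (0 :: real))"
      using Gamma0 by (intro tendsto_intros)
    moreover have "\<forall>\<^sub>F t in at_right 0. 2 * (C * (t powr (2 * a - 1) / Gamma (2 * a))) + 2 * (D * (t / Gamma 2)) = b t"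
      by (rule eventually_at_rightI[of 0 1]) (auto simp: b_def rl_kernel_def)
    ultimately have "(b \<longlongrightarrow> 2 * (C * (0 / Gamma (2 * a))) + 2 * (D * (0 / Gamma 2))) (at_right 0)"
      by (rule Lim_transform_eventually)
    then have "(b \<longlongrightarrow> 0) (at_right 0)" by simp
    then have "\<forall>\<^sub>F t in at_right 0. b t < c\<^sup>2"
      using \<open>c \<noteq> 0\<close> by (intro order_tendstoD(2)) auto
    then obtain d where d: "0 < d" "\<And>t. 0 < t \<Longrightarrow> t < d \<Longrightarrow> b t < c\<^sup>2"
      unfolding eventually_at_right_field by auto
    have "AE x in lborel. x \<notin> {0<..<min d T}"
      using c
    proof eventually_elim
      case (elim x)
      show ?case
      proof
        assume x: "x \<in> {0<..<min d T}"
        then have "c = rl_conv a q' x - rl_conv 1 g' x" using elim by auto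
        then have "c\<^sup>2 \<le> 2 * (rl_conv a q' x)\<^sup>2 + 2 * (rl_conv 1 g' x)\<^sup>2"
          using zero_le_power2[of "rl_conv a q' x + rl_conv 1 g' x"] by (simp add: power2_sum power2_diff)
        also have "\<dots> \<le> b x" using C(2)[of x] D(2)[of x] by (simp add: b_def)
        also have "\<dots> < c\<^sup>2" using x by (intro d) auto
        finally show False by simp
      qed
    qed
    from emeasure_eq_0_AE[OF this] have "emeasure lborel {x \<in> space lborel. \<not> x \<notin> {0<..<min d T}} = 0"
      by (simp only: not_not)
    also have "{x \<in> space lborel. \<not> x \<notin> {0<..<min d T}} = {0<..<min d T}" by auto
    finally have "emeasure lborel {0<..<min d T} = 0" .
    then show False using d T by simp
  qed
  \<comment> \<open>The primitive of \<open>f\<close> will vanish, because the two terms have the same primitive by the semigroup law.\<close>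
  define f where "f x = q' x - zero_ext T (rl_conv s g') x" for x
  have [measurable]: "f \<in> borel_measurable borel" unfolding f_def by measurable
  have f_supp: "f x = 0" if "x \<notin> {0..T}" for x using q_supp[OF that] that by (auto simp: f_def zero_ext_def)
  have I_fin: "sq_norm lborel (zero_ext T (rl_conv s g')) < \<infinity>"
  proof -
    have "sq_norm lborel (zero_ext T (rl_conv s g')) \<le> ennreal ((rl_kernel (s + 1) T)\<^sup>2) * sq_norm lborel g'"
      by (rule sq_norm_rl_conv_le[OF as(1) _ g_supp]) measurable
    also have "\<dots> < \<infinity>" using g_fin by (simp add: ennreal_mult_less_top)
    finally show ?thesis .
  qed
  have f_fin: "sq_norm lborel f < \<infinity>"
  proof -
    have "sq_norm lborel f \<le> 2 * sq_norm lborel q' + 2 * sq_norm lborel (zero_ext T (rl_conv s g'))"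
      unfolding f_def by (rule sq_norm_diff) measurable
    also have "\<dots> < \<infinity>" using q_fin I_fin by (simp add: ennreal_mult_less_top)
    finally show ?thesis .
  qed
  have int_f: "integrable lborel f" by (rule integrable_of_sq_norm[OF _ f_supp f_fin]) measurable
  have int_I: "integrable lborel (zero_ext T (rl_conv s g'))"
    by (rule integrable_of_sq_norm[OF _ _ I_fin, of T]) (auto simp: zero_ext_def)
  have prim: "rl_conv 1 f x = 0" if "x \<in> {0..T}" for x
  proof -
    have "rl_conv 1 q' x = rl_conv s (rl_conv a q') x"
      using rl_conv_rl_conv[OF as(1) as(3) _ _ q_neg int_q] as by simp
    also have "\<dots> = rl_conv s (rl_conv 1 g') x"
      unfolding rl_conv_def[of s]
    proof (rule integral_cong_AE)
      show "AE t in lborel. rl_kernel s (x - t) * rl_conv a q' t = rl_kernel s (x - t) * rl_conv 1 g' t"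
        using c
      proof eventually_elim
        case (elim t)
        consider "t < 0" | "x < t" | "t \<in> {0..T}" using \<open>x \<in> {0..T}\<close> by fastforce
        then show ?case
        proof cases
          case 1
          then show ?thesis using rl_conv_neg[where f = q' and t = t and a = a, OF q_neg] rl_conv_neg[where f = g' and t = t and a = 1, OF g_neg] by simp
        qed (use elim \<open>c = 0\<close> in auto)
      qed
    qed measurable
    also have "\<dots> = rl_conv (s + 1) g' x"
      using rl_conv_rl_conv[OF as(1) zero_less_one _ _ g_neg int_g] as by simp
    also have "\<dots> = rl_conv 1 (rl_conv s g') x"
      using rl_conv_rl_conv[OF zero_less_one as(1) _ _ g_neg int_g] as by (simp add: add.commute)
    also have "\<dots> = rl_conv 1 (zero_ext T (rl_conv s g')) x"
      by (rule rl_conv_zero_ext[symmetric]) (use that in \<open>auto intro!: rl_conv_neg g_neg\<close>)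
    finally have "rl_conv 1 q' x = rl_conv 1 (zero_ext T (rl_conv s g')) x" .
    moreover have "rl_conv 1 f x = rl_conv 1 q' x - rl_conv 1 (zero_ext T (rl_conv s g')) x"
    proof -
      have *: "integrable lborel (\<lambda>t. rl_kernel 1 (x - t) * u t)" if "integrable lborel u" for u
        using integrable_mult_indicator[OF _ that, of "{..<x}"]
        by (rule Bochner_Integration.integrable_cong[OF refl, THEN iffD1, rotated]) (auto simp: rl_kernel_1 indicator_def)
      show ?thesis
        unfolding rl_conv_def[of 1] f_def right_diff_distrib
        by (rule Bochner_Integration.integral_diff[OF *[OF int_q] *[OF int_I]])
    qed
    ultimately show ?thesis by simp
  qed
  have "AE x in lborel. f x = 0"
  proof (rule AE_zero_of_interval_integrals[OF _ _ f_supp f_fin])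
    fix u v assume uv: "0 \<le> u" "u \<le> v" "v \<le> T"
    have int_ind: "integrable lborel (\<lambda>x. rl_kernel 1 (y - x) * f x)" for y
      using integrable_mult_indicator[OF _ int_f, of "{..<y}"]
      by (rule Bochner_Integration.integrable_cong[OF refl, THEN iffD1, rotated]) (auto simp: rl_kernel_1 indicator_def)
    have "(LINT x|lborel. indicator {u<..v} x * f x) = (LINT x|lborel. rl_kernel 1 (v - x) * f x - rl_kernel 1 (u - x) * f x)"
    proof (rule integral_cong_AE)
      show "AE x in lborel. indicator {u<..v} x * f x = rl_kernel 1 (v - x) * f x - rl_kernel 1 (u - x) * f x"
        using AE_lborel_singleton[of u] AE_lborel_singleton[of v]
        by eventually_elim (use uv in \<open>auto simp: rl_kernel_1 indicator_def\<close>)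
    qed measurable
    also have "\<dots> = rl_conv 1 f v - rl_conv 1 f u"
      unfolding rl_conv_def by (rule Bochner_Integration.integral_diff[OF int_ind int_ind])
    also have "\<dots> = 0" using prim uv by simp
    finally show "(LINT x|lborel. indicator {u<..v} x * f x) = 0" .
  qed (use T in auto)
  then show ?thesis by eventually_elim (simp add: f_def s_def)
qed

section \<open>Approximation of admissible integrands by step functions\<close>

lemma integrand_norm2_eq:
  assumes [measurable]: "p' \<in> borel_measurable borel" and eq: "AE x in lborel. zero_ext T p x = p' x"
  shows "integrand_norm2 H T p = sq_norm lborel p' + (if H < 1 / 2 then gagliardo H p' else 0)"
proof -
  have "(\<integral>\<^sup>+r. ennreal ((zero_ext T p r)\<^sup>2) \<partial>lborel) = sq_norm lborel p'"
    unfolding sq_norm_def using eq by (intro nn_integral_cong_AE) auto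
  moreover have "(\<integral>\<^sup>+x. (\<integral>\<^sup>+y. ennreal ((zero_ext T p x - zero_ext T p y)\<^sup>2 / \<bar>x - y\<bar> powr (2 - 2 * H)) \<partial>lborel) \<partial>lborel) = gagliardo H p'"
    unfolding gagliardo_def
  proof (rule nn_integral_cong_AE)
    show "AE x in lborel. (\<integral>\<^sup>+y. ennreal ((zero_ext T p x - zero_ext T p y)\<^sup>2 / \<bar>x - y\<bar> powr (2 - 2 * H)) \<partial>lborel)
       = (\<integral>\<^sup>+y. ennreal ((p' x - p' y)\<^sup>2 / \<bar>x - y\<bar> powr (2 - 2 * H)) \<partial>lborel)"
      using eq
    proof eventually_elim
      case (elim x)
      show ?case
      proof (rule nn_integral_cong_AE)
        show "AE y in lborel. ennreal ((zero_ext T p x - zero_ext T p y)\<^sup>2 / \<bar>x - y\<bar> powr (2 - 2 * H))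
           = ennreal ((p' x - p' y)\<^sup>2 / \<bar>x - y\<bar> powr (2 - 2 * H))"
          using eq by eventually_elim (simp add: elim)
      qed
    qed
  qed
  ultimately show ?thesis
    unfolding integrand_norm2_def by (simp add: nn_integral_completion)
qed

lemma step_fun_support: "step_list T xs \<Longrightarrow> x \<notin> {0..T} \<Longrightarrow> step_fun xs x = 0"
  by (induction xs) (auto simp: step_fun_def indicator_def)

lemma zero_ext_step_fun: "step_list T xs \<Longrightarrow> zero_ext T (step_fun xs) = step_fun xs"
  using step_fun_support[of T xs] by (auto simp: zero_ext_def fun_eq_iff)

lemma AE_zero_ext_step_fun_minus:
  assumes xs: "step_list T xs" and supp: "\<And>x. x \<notin> {0..T} \<Longrightarrow> q' x = 0"
    and eq: "AE x in lborel. zero_ext T q x = q' x"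
  shows "AE x in lborel. zero_ext T (\<lambda>r. step_fun xs r - q r) x = step_fun xs x - q' x"
  using eq
proof eventually_elim
  case (elim x)
  then show ?case using step_fun_support[OF xs, of x] supp[of x] by (auto simp: zero_ext_def)
qed

lemma sq_norm_step_fun_finite: "sq_norm lborel (step_fun xs) < \<infinity>"
proof (induction xs)
  case Nil
  then show ?case by (simp add: step_fun_def sq_norm_def)
next
  case (Cons p xs)
  obtain c a b where p: "p = (c, a, b)" by (cases p)
  have "step_fun (p # xs) = (\<lambda>x. c * indicator {a<..b} x + step_fun xs x)"
    by (simp add: step_fun_def p fun_eq_iff)
  then have "sq_norm lborel (step_fun (p # xs)) \<le> 2 * sq_norm lborel (\<lambda>x. c * indicator {a<..b} x) + 2 * sq_norm lborel (step_fun xs)"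
    using sq_norm_add[of "\<lambda>x. c * indicator {a<..b} x" lborel "step_fun xs"] by simp
  also have "sq_norm lborel (\<lambda>x. c * indicator {a<..b} x) = ennreal (c\<^sup>2) * sq_norm lborel (indicator {a<..b})"
    by (rule sq_norm_cmult) measurable
  also have "sq_norm lborel (indicator {a<..b} :: real \<Rightarrow> real) = (\<integral>\<^sup>+x. indicator {a<..b} x \<partial>lborel)"
    unfolding sq_norm_def by (intro nn_integral_cong) (simp add: indicator_def)
  also have "\<dots> = emeasure lborel {a<..b}" by simp
  also have "2 * (ennreal (c\<^sup>2) * emeasure lborel {a<..b}) + 2 * sq_norm lborel (step_fun xs) < \<infinity>"
    using Cons emeasure_bounded_finite[of "{a<..b}"] by (simp add: ennreal_mult_less_top)
  finally show ?case .
qed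

lemma step_RL_eq_rl_conv:
  assumes "1 / 2 < H" "step_list T xs"
  shows "step_RL H xs = rl_conv (H - 1 / 2) (step_fun xs)"
proof -
  have "step_fun xs = step_integral (\<lambda>t x. - rl_kernel 1 (x - t)) xs"
    using step_fun_eq_kernel[OF assms(2)] by blast
  moreover have "H - 1 / 2 + 1 = H + 1 / 2" by simp
  ultimately show ?thesis
    unfolding step_RL_def using rl_conv_step[of "H - 1 / 2" 1 xs] assms(1) by (simp add: add.commute)
qed

lemma step_RL_half:
  assumes "step_list T xs"
  shows "step_RL (1 / 2) xs = step_fun xs"
  using step_fun_eq_kernel[OF assms] by (simp add: step_RL_def fun_eq_iff)

lemma rl_conv_step_RL:
  assumes H: "0 < H" "H < 1 / 2" and xs: "step_list T xs" and x: "x \<le> T"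
  shows "rl_conv (1 / 2 - H) (zero_ext T (step_RL H xs)) x = step_fun xs x"
proof -
  have "rl_conv (1 / 2 - H) (zero_ext T (step_RL H xs)) x = rl_conv (1 / 2 - H) (step_RL H xs) x"
    by (rule rl_conv_zero_ext[OF x]) (use step_RL_neg[OF xs] in auto)
  also have "\<dots> = step_integral (\<lambda>u x. - rl_kernel 1 (x - u)) xs x"
    unfolding step_RL_def using rl_conv_step[of "1 / 2 - H" "H + 1 / 2" xs] H by simp
  also have "\<dots> = step_fun xs x" using step_fun_eq_kernel[OF xs] by simp
  finally show ?thesis .
qed

lemma AE_rl_conv_diff:
  assumes a: "0 < a"
    and [measurable]: "f \<in> borel_measurable borel" and f: "\<And>x. x \<notin> {0..T} \<Longrightarrow> f x = 0" "sq_norm lborel f < \<infinity>"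
    and [measurable]: "g \<in> borel_measurable borel" and g: "\<And>x. x \<notin> {0..T} \<Longrightarrow> g x = 0" "sq_norm lborel g < \<infinity>"
  shows "AE x in lborel. zero_ext T (rl_conv a f) x - zero_ext T (rl_conv a g) x = zero_ext T (rl_conv a (\<lambda>x. f x - g x)) x"
proof -
  have "AE x in lborel. x \<in> {0..T} \<longrightarrow> integrable lborel (\<lambda>t. rl_kernel a (x - t) * f t)"
    by (rule AE_integrable_rl_conv[OF a _ f]) measurable
  moreover have "AE x in lborel. x \<in> {0..T} \<longrightarrow> integrable lborel (\<lambda>t. rl_kernel a (x - t) * g t)"
    by (rule AE_integrable_rl_conv[OF a _ g]) measurable
  ultimately show ?thesis
    by eventually_elim (auto simp: zero_ext_def rl_conv_def right_diff_distrib)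
qed

lemma sq_norm_RL_le_step:
  assumes H: "1 / 2 \<le> H"
  obtains K where "0 \<le> K"
    "\<And>xs. step_list T xs \<Longrightarrow> sq_norm lborel (zero_ext T (step_RL H xs)) \<le> ennreal K * sq_norm lborel (step_fun xs)"
proof (cases "H = 1 / 2")
  case True
  show thesis
  proof (rule that[of 1])
    fix xs assume "step_list T xs"
    then show "sq_norm lborel (zero_ext T (step_RL H xs)) \<le> ennreal 1 * sq_norm lborel (step_fun xs)"
      unfolding True by (simp add: step_RL_half zero_ext_step_fun)
  qed simp
next
  case False
  then have H': "1 / 2 < H" using H by simp
  show thesis
  proof (rule that)
    fix xs assume xs: "step_list T xs"
    show "sq_norm lborel (zero_ext T (step_RL H xs)) \<le> ennreal ((rl_kernel (H - 1 / 2 + 1) T)\<^sup>2) * sq_norm lborel (step_fun xs)"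
      unfolding step_RL_eq_rl_conv[OF H' xs]
      by (rule sq_norm_rl_conv_le) (use H' xs in \<open>auto intro: step_fun_support\<close>)
  qed simp
qed

text \<open>
  This makes the elementary integral continuous on the space of integrands. For \<open>H < 1 / 2\<close>
  the energy is a multiple of the seminorm; for \<open>H \<ge> 1 / 2\<close> the energy estimate applies, and
  the operator is bounded on \<open>L\<^sup>2\<close>.
\<close>

lemma energy_le_integrand_norm2:
  assumes H: "0 < H" "H < 1"
  obtains C where "0 < C"
    "\<And>xs. step_list T xs \<Longrightarrow> ennreal (fbm_energy H xs) \<le> ennreal C * integrand_norm2 H T (step_fun xs)"
proof -
  have N: "integrand_norm2 H T (step_fun xs) = sq_norm lborel (step_fun xs) + (if H < 1 / 2 then gagliardo H (step_fun xs) else 0)"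
    if "step_list T xs" for xs
    by (rule integrand_norm2_eq) (use zero_ext_step_fun[OF that] in auto)
  show thesis
  proof (cases "H < 1 / 2")
    case True
    obtain k where k: "0 < k" "\<And>T xs. step_list T xs \<Longrightarrow> gagliardo H (step_fun xs) = ennreal (k * fbm_energy H xs)"
      using gagliardo_step_fun[OF H(1) True] by blast
    show thesis
    proof (rule that)
      show "0 < 1 / k" using k(1) by simp
      fix xs assume xs: "step_list T xs"
      have "ennreal (fbm_energy H xs) = ennreal (1 / k) * ennreal (k * fbm_energy H xs)"
        using k(1) by (subst ennreal_mult'[symmetric]) auto
      also have "\<dots> = ennreal (1 / k) * gagliardo H (step_fun xs)"
        using k(2)[OF xs] by simp
      also have "\<dots> \<le> ennreal (1 / k) * integrand_norm2 H T (step_fun xs)"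
        unfolding N[OF xs] using True by (intro mult_left_mono) (auto simp: add_increasing)
      finally show "ennreal (fbm_energy H xs) \<le> ennreal (1 / k) * integrand_norm2 H T (step_fun xs)" .
    qed
  next
    case False
    obtain C where C: "0 < C" "\<And>T xs. step_list T xs \<Longrightarrow> ennreal (fbm_energy H xs) \<le> ennreal C * sq_norm lborel (zero_ext T (step_RL H xs))"
      using energy_le_sq_norm_RL[OF H] by blast
    obtain K where K: "0 \<le> K" "\<And>xs. step_list T xs \<Longrightarrow> sq_norm lborel (zero_ext T (step_RL H xs)) \<le> ennreal K * sq_norm lborel (step_fun xs)"
      using sq_norm_RL_le_step[of H T] False by auto
    show thesis
    proof (rule that)
      show "0 < C * (K + 1)" using C(1) K(1) by simp
      fix xs assume xs: "step_list T xs"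
      have "ennreal (fbm_energy H xs) \<le> ennreal C * (ennreal K * sq_norm lborel (step_fun xs))"
        using C(2)[OF xs] K(2)[OF xs] by (meson mult_left_mono order_trans zero_le)
      also have "\<dots> \<le> ennreal C * (ennreal (K + 1) * sq_norm lborel (step_fun xs))"
        by (intro mult_left_mono mult_right_mono ennreal_leI) auto
      also have "\<dots> = ennreal (C * (K + 1)) * integrand_norm2 H T (step_fun xs)"
        unfolding N[OF xs] using False C(1) K(1) by (simp add: ennreal_mult mult.assoc del: ennreal_plus)
      finally show "ennreal (fbm_energy H xs) \<le> ennreal (C * (K + 1)) * integrand_norm2 H T (step_fun xs)" .
    qed
  qed
qed

text \<open>
  Geometric rates of convergence in mean square thus give convergence almost everywhere
  without passing to a subsequence.
\<close>

lemma AE_summable_sq: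
  assumes [measurable]: "\<And>n. f n \<in> borel_measurable N"
    and le: "\<And>n. sq_norm N (f n) \<le> ennreal (c n)" and c: "summable c" "\<And>n. 0 \<le> c n"
  shows "AE x in N. summable (\<lambda>n. (f n x)\<^sup>2)"
proof -
  have "(\<integral>\<^sup>+x. (\<Sum>n. ennreal ((f n x)\<^sup>2)) \<partial>N) = (\<Sum>n. sq_norm N (f n))"
    unfolding sq_norm_def by (rule nn_integral_suminf) measurable
  also have "\<dots> \<le> (\<Sum>n. ennreal (c n))" by (intro suminf_le le) auto
  also have "\<dots> = ennreal (\<Sum>n. c n)" by (rule suminf_ennreal2) (use c in auto)
  finally have "(\<integral>\<^sup>+x. (\<Sum>n. ennreal ((f n x)\<^sup>2)) \<partial>N) \<noteq> \<infinity>"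
    by (auto simp: top_unique)
  then have "AE x in N. (\<Sum>n. ennreal ((f n x)\<^sup>2)) \<noteq> \<infinity>"
    by (intro nn_integral_PInf_AE) measurable
  then show ?thesis
    by eventually_elim (auto intro: summable_suminf_not_top)
qed

lemma tendsto_zero_of_summable_sq:
  fixes f :: "nat \<Rightarrow> real"
  assumes "summable (\<lambda>n. (f n)\<^sup>2)"
  shows "f \<longlonglongrightarrow> 0"
proof -
  have "(\<lambda>n. sqrt ((f n)\<^sup>2)) \<longlonglongrightarrow> sqrt 0"
    by (intro tendsto_real_sqrt summable_LIMSEQ_zero assms)
  then show ?thesis by (simp add: tendsto_rabs_zero_iff)
qed

text \<open>
  Fatou's lemma in each of the two variables.
\<close>

lemma gagliardo_Fatou:
  assumes [measurable]: "\<And>n. f n \<in> borel_measurable borel"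
    and lim: "AE x in lborel. (\<lambda>n. f n x) \<longlonglongrightarrow> g x"
  shows "gagliardo H g \<le> liminf (\<lambda>n. gagliardo H (f n))"
proof -
  let ?G = "\<lambda>u x y. ennreal ((u x - u y)\<^sup>2 / \<bar>x - y\<bar> powr (2 - 2 * H))"
  have "gagliardo H g = (\<integral>\<^sup>+x. (\<integral>\<^sup>+y. liminf (\<lambda>n. ?G (f n) x y) \<partial>lborel) \<partial>lborel)"
    unfolding gagliardo_def
  proof (rule nn_integral_cong_AE)
    show "AE x in lborel. (\<integral>\<^sup>+y. ?G g x y \<partial>lborel) = (\<integral>\<^sup>+y. liminf (\<lambda>n. ?G (f n) x y) \<partial>lborel)"
      using lim
    proof eventually_elim
      case (elim x)
      show ?case
      proof (rule nn_integral_cong_AE)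
        show "AE y in lborel. ?G g x y = liminf (\<lambda>n. ?G (f n) x y)"
          using lim
        proof eventually_elim
          case (elim y)
          have "(\<lambda>n. (f n x - f n y)\<^sup>2 / \<bar>x - y\<bar> powr (2 - 2 * H)) \<longlonglongrightarrow> (g x - g y)\<^sup>2 / \<bar>x - y\<bar> powr (2 - 2 * H)"
            unfolding divide_inverse
            by (intro tendsto_intros elim \<open>(\<lambda>n. f n x) \<longlonglongrightarrow> g x\<close>)
          then have "(\<lambda>n. ?G (f n) x y) \<longlonglongrightarrow> ?G g x y" by (rule tendsto_ennrealI)
          then show ?case by (rule lim_imp_Liminf[OF sequentially_bot, symmetric])
        qed
      qed
    qed
  qed
  also have "\<dots> \<le> (\<integral>\<^sup>+x. liminf (\<lambda>n. \<integral>\<^sup>+y. ?G (f n) x y \<partial>lborel) \<partial>lborel)"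
    by (intro nn_integral_mono nn_integral_liminf) measurable
  also have "\<dots> \<le> liminf (\<lambda>n. \<integral>\<^sup>+x. (\<integral>\<^sup>+y. ?G (f n) x y \<partial>lborel) \<partial>lborel)"
    by (intro nn_integral_liminf) measurable
  finally show ?thesis by (simp add: gagliardo_def)
qed

lemma liminf_le_const:
  fixes X :: "nat \<Rightarrow> ennreal"
  assumes "\<And>m. n \<le> m \<Longrightarrow> X m \<le> B"
  shows "liminf X \<le> B"
proof -
  have "liminf X \<le> liminf (\<lambda>_ :: nat. B)"
    by (rule Liminf_mono) (use assms in \<open>auto simp: eventually_sequentially\<close>)
  then show ?thesis by (simp add: Liminf_const)
qed

text \<open>
  Approximate \<open>g'\<close> by fractional derivatives of step functions. The fractional integral
  brings them back to the step functions and is bounded, which gives \<open>L\<^sup>2\<close> convergence. The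
  seminorm of a difference of two such step functions is a multiple of its energy, which the
  energy estimate bounds by the distance of the fractional derivatives; the limit is taken
  by Fatou's lemma.
\<close>

lemma RL_derivative_step_approximation:
  assumes H: "0 < H" "H < 1 / 2" and T: "0 < T"
    and [measurable]: "q' \<in> borel_measurable borel" and g' [measurable]: "g' \<in> borel_measurable borel"
    and g_supp: "\<And>x. x \<notin> {0..T} \<Longrightarrow> g' x = 0" and g_fin: "sq_norm lborel g' < \<infinity>"
    and q: "AE x in lborel. q' x = zero_ext T (rl_conv (1 / 2 - H) g') x"
  obtains c ys where "0 \<le> c" "\<And>n. step_list T (ys n)"
    "\<And>n. sq_norm lborel (\<lambda>x. step_fun (ys n) x - q' x) \<le> ennreal (c * (1 / 4) ^ n)"
    "\<And>n. gagliardo H (\<lambda>x. step_fun (ys n) x - q' x) \<le> ennreal (c * (1 / 4) ^ n)"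
    "\<And>n. sq_norm lborel (\<lambda>x. zero_ext T (step_RL H (ys n)) x - g' x) \<le> ennreal (c * (1 / 4) ^ n)"
proof -
  define s where "s = 1 / 2 - H"
  have s: "0 < s" using H by (simp add: s_def)
  define K where "K = (rl_kernel (s + 1) T)\<^sup>2"
  have K: "0 \<le> K" by (simp add: K_def)
  have "\<exists>xs. step_list T xs \<and> sq_norm lborel (\<lambda>x. zero_ext T (step_RL H xs) x - g' x) < ennreal ((1 / 4) ^ n)" for n
    using step_RL_dense[OF H less_imp_le[OF T] g' g_supp g_fin, of "(1 / 4) ^ n"] by auto
  then obtain ys where ys: "\<And>n. step_list T (ys n)"
    "\<And>n. sq_norm lborel (\<lambda>x. zero_ext T (step_RL H (ys n)) x - g' x) < ennreal ((1 / 4) ^ n)"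
    by metis
  define A where "A n = zero_ext T (step_RL H (ys n))" for n
  have [measurable]: "A n \<in> borel_measurable borel" for n by (simp add: A_def)
  have A_supp: "A n x = 0" if "x \<notin> {0..T}" for n x using that by (auto simp: A_def zero_ext_def)
  have A_g: "sq_norm lborel (\<lambda>x. A n x - g' x) \<le> ennreal ((1 / 4) ^ n)" for n
    using ys(2)[of n] by (simp add: A_def)
  have A_fin: "sq_norm lborel (A n) < \<infinity>" for n
  proof -
    have "sq_norm lborel (A n) \<le> 2 * sq_norm lborel (\<lambda>x. A n x - g' x) + 2 * sq_norm lborel g'"
      by (rule sq_norm_le) measurable
    also have "\<dots> \<le> 2 * ennreal ((1 / 4) ^ n) + 2 * sq_norm lborel g'"
      by (intro add_right_mono mult_left_mono A_g) auto
    also have "\<dots> < \<infinity>" using g_fin by (simp add: ennreal_mult_less_top)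
    finally show ?thesis .
  qed
  have L2: "sq_norm lborel (\<lambda>x. step_fun (ys n) x - q' x) \<le> ennreal (K * (1 / 4) ^ n)" for n
  proof -
    have "AE x in lborel. zero_ext T (rl_conv s (A n)) x - zero_ext T (rl_conv s g') x = zero_ext T (rl_conv s (\<lambda>x. A n x - g' x)) x"
      by (rule AE_rl_conv_diff[OF s _ A_supp A_fin _ g_supp g_fin]) measurable
    then have "AE x in lborel. step_fun (ys n) x - q' x = zero_ext T (rl_conv s (\<lambda>x. A n x - g' x)) x"
      using q
    proof eventually_elim
      case (elim x)
      have "zero_ext T (rl_conv s (A n)) x = step_fun (ys n) x"
        using rl_conv_step_RL[OF H ys(1)[of n], of x] step_fun_support[OF ys(1)[of n], of x]
        by (cases "x \<in> {0..T}") (auto simp: zero_ext_def[of T "rl_conv s (A n)"] A_def[symmetric] s_def[symmetric])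
      with elim show ?case by (simp add: s_def)
    qed
    then have "sq_norm lborel (\<lambda>x. step_fun (ys n) x - q' x) = sq_norm lborel (zero_ext T (rl_conv s (\<lambda>x. A n x - g' x)))"
      by (rule sq_norm_cong_AE)
    also have "\<dots> \<le> ennreal K * sq_norm lborel (\<lambda>x. A n x - g' x)"
      unfolding K_def by (rule sq_norm_rl_conv_le[OF s]) (use A_supp g_supp in auto)
    also have "\<dots> \<le> ennreal K * ennreal ((1 / 4) ^ n)" by (intro mult_left_mono A_g) simp
    also have "\<dots> = ennreal (K * (1 / 4) ^ n)" using K by (simp add: ennreal_mult)
    finally show ?thesis .
  qed
  have "AE x in lborel. summable (\<lambda>n. (step_fun (ys n) x - q' x)\<^sup>2)"
    by (rule AE_summable_sq[OF _ L2]) (use K in \<open>auto intro!: summable_mult summable_geometric\<close>)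
  then have lim: "AE x in lborel. (\<lambda>n. step_fun (ys n) x) \<longlonglongrightarrow> q' x"
    by eventually_elim (auto dest!: tendsto_zero_of_summable_sq simp: LIM_zero_iff)
  obtain k where k: "0 < k" "\<And>T xs. step_list T xs \<Longrightarrow> gagliardo H (step_fun xs) = ennreal (k * fbm_energy H xs)"
    using gagliardo_step_fun[OF H] by blast
  obtain C where C: "0 < C" "\<And>T xs. step_list T xs \<Longrightarrow> ennreal (fbm_energy H xs) \<le> ennreal C * sq_norm lborel (zero_ext T (step_RL H xs))"
    using energy_le_sq_norm_RL[of H] H by auto
  have Cauchy: "gagliardo H (\<lambda>x. step_fun (ys n) x - step_fun (ys m) x) \<le> ennreal (k * (C * 4) * (1 / 4) ^ n)" if "n \<le> m" for n m
  proof -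
    have steps: "step_list T (step_diff (ys n) (ys m))" using ys(1) by simp
    have "zero_ext T (step_RL H (step_diff (ys n) (ys m))) = (\<lambda>x. A n x - A m x)"
      by (auto simp: A_def zero_ext_def fun_eq_iff)
    then have "sq_norm lborel (zero_ext T (step_RL H (step_diff (ys n) (ys m))))
       \<le> 2 * sq_norm lborel (\<lambda>x. A n x - g' x) + 2 * sq_norm lborel (\<lambda>x. g' x - A m x)"
      using sq_norm_triangle[of "A n" lborel g' "A m"] by simp
    also have "\<dots> \<le> 2 * ennreal ((1 / 4) ^ n) + 2 * ennreal ((1 / 4) ^ n)"
    proof (intro add_mono mult_left_mono A_g)
      have "sq_norm lborel (\<lambda>x. g' x - A m x) \<le> ennreal ((1 / 4) ^ m)"
        using A_g[of m] by (simp add: sq_norm_commute)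
      also have "\<dots> \<le> ennreal ((1 / 4) ^ n)" using that by (intro ennreal_leI power_decreasing) auto
      finally show "sq_norm lborel (\<lambda>x. g' x - A m x) \<le> ennreal ((1 / 4) ^ n)" .
    qed auto
    also have "\<dots> = ennreal (4 * (1 / 4) ^ n)"
    proof -
      have "2 * ennreal ((1 / 4) ^ n) = ennreal (2 * (1 / 4) ^ n)" by (simp add: ennreal_mult)
      then show ?thesis by (simp add: ennreal_plus[symmetric] del: ennreal_plus)
    qed
    finally have A_nm: "sq_norm lborel (zero_ext T (step_RL H (step_diff (ys n) (ys m)))) \<le> ennreal (4 * (1 / 4) ^ n)" .
    have "gagliardo H (\<lambda>x. step_fun (ys n) x - step_fun (ys m) x) = gagliardo H (step_fun (step_diff (ys n) (ys m)))"
      by (simp add: gagliardo_def)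
    also have "\<dots> = ennreal k * ennreal (fbm_energy H (step_diff (ys n) (ys m)))"
      unfolding k(2)[OF steps] using k(1) by (simp add: ennreal_mult')
    also have "\<dots> \<le> ennreal k * (ennreal C * ennreal (4 * (1 / 4) ^ n))"
      using order_trans[OF C(2)[OF steps] mult_left_mono[OF A_nm, of "ennreal C"]] by (intro mult_left_mono) auto
    also have "\<dots> = ennreal (k * (C * 4) * (1 / 4) ^ n)"
      using k(1) C(1) by (simp add: ennreal_mult' mult.assoc)
    finally show ?thesis .
  qed
  have Gag: "gagliardo H (\<lambda>x. step_fun (ys n) x - q' x) \<le> ennreal (k * (C * 4) * (1 / 4) ^ n)" for n
  proof -
    have "gagliardo H (\<lambda>x. step_fun (ys n) x - q' x) \<le> liminf (\<lambda>m. gagliardo H (\<lambda>x. step_fun (ys n) x - step_fun (ys m) x))"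
      by (rule gagliardo_Fatou, measurable) (use lim in eventually_elim, auto intro!: tendsto_intros)
    also have "\<dots> \<le> ennreal (k * (C * 4) * (1 / 4) ^ n)"
      by (rule liminf_le_const[OF Cauchy])
    finally show ?thesis .
  qed
  define c where "c = K + k * (C * 4) + 1"
  have c: "0 \<le> c" "K \<le> c" "k * (C * 4) \<le> c" "1 \<le> c" using K k(1) C(1) by (auto simp: c_def)
  show thesis
  proof (rule that[OF c(1) ys(1)])
    fix n
    show "sq_norm lborel (\<lambda>x. step_fun (ys n) x - q' x) \<le> ennreal (c * (1 / 4) ^ n)"
      by (rule order_trans[OF L2]) (intro ennreal_leI mult_right_mono c, simp)
    show "gagliardo H (\<lambda>x. step_fun (ys n) x - q' x) \<le> ennreal (c * (1 / 4) ^ n)"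
      by (rule order_trans[OF Gag]) (intro ennreal_leI mult_right_mono c, simp)
    have "sq_norm lborel (\<lambda>x. zero_ext T (step_RL H (ys n)) x - g' x) \<le> ennreal (1 * (1 / 4) ^ n)"
      using A_g[of n] by (simp add: A_def)
    also have "\<dots> \<le> ennreal (c * (1 / 4) ^ n)" by (intro ennreal_leI mult_right_mono c) simp
    finally show "sq_norm lborel (\<lambda>x. zero_ext T (step_RL H (ys n)) x - g' x) \<le> ennreal (c * (1 / 4) ^ n)" .
  qed
qed

text \<open>
  For \<open>H \<ge> 1 / 2\<close> the operator is bounded, so that every approximation of \<open>q\<close> by step
  functions serves; below \<open>1 / 2\<close> the preceding lemma applies. The geometric rate prepares
  the almost sure construction of the Wiener integral.
\<close>

lemma RL_step_approximation:
  assumes T: "0 < T" and H: "0 < H" "H < 1" and q: "sq_integrable T q" and g: "sq_integrable T g"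
    and RL: "has_RL T ((1 - 2 * H) / 2) q g"
  obtains c ys where "0 \<le> c" "\<And>n. step_list T (ys n)"
    "\<And>n. integrand_norm2 H T (\<lambda>r. step_fun (ys n) r - q r) \<le> ennreal (c * (1 / 4) ^ n)"
    "\<And>n. sq_norm lborel (zero_ext T (step_RL H (ys n))) \<le> ennreal (c * (1 / 4) ^ n + 2 * (L2_norm T g)\<^sup>2)"
proof -
  obtain q' where q'[measurable]: "q' \<in> borel_measurable borel" and q_supp: "\<And>x. x \<notin> {0..T} \<Longrightarrow> q' x = 0"
    and q_eq: "AE x in lborel. zero_ext T q x = q' x" and q_norm: "sq_norm lborel q' = ennreal ((L2_norm T q)\<^sup>2)"
    using sq_integrable_borel_rep[OF q] by blast
  obtain g' where g'[measurable]: "g' \<in> borel_measurable borel" and g_supp: "\<And>x. x \<notin> {0..T} \<Longrightarrow> g' x = 0"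
    and g_eq: "AE x in lborel. zero_ext T g x = g' x" and g_norm: "sq_norm lborel g' = ennreal ((L2_norm T g)\<^sup>2)"
    using sq_integrable_borel_rep[OF g] by blast
  have q_fin: "sq_norm lborel q' < \<infinity>" and g_fin: "sq_norm lborel g' < \<infinity>" by (simp_all add: q_norm g_norm)
  have N: "integrand_norm2 H T (\<lambda>r. step_fun xs r - q r) = sq_norm lborel (\<lambda>x. step_fun xs x - q' x)
      + (if H < 1 / 2 then gagliardo H (\<lambda>x. step_fun xs x - q' x) else 0)" if "step_list T xs" for xs
    by (rule integrand_norm2_eq[OF _ AE_zero_ext_step_fun_minus[OF that q_supp q_eq]]) measurable
  obtain c ys where c: "0 \<le> c" and ys: "\<And>n. step_list T (ys n)"
    and 1: "\<And>n. integrand_norm2 H T (\<lambda>r. step_fun (ys n) r - q r) \<le> ennreal (c * (1 / 4) ^ n)"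
    and 2: "\<And>n. sq_norm lborel (\<lambda>x. zero_ext T (step_RL H (ys n)) x - g' x) \<le> ennreal (c * (1 / 4) ^ n)"
  proof (cases "H < 1 / 2")
    case True
    then have "has_RL_derivative T (1 / 2 - H) q g"
      using RL by (simp add: has_RL_def diff_divide_distrib)
    then have inv: "AE x in lborel. q' x = zero_ext T (rl_conv (1 / 2 - H) g') x"
      by (rule RL_derivative_inverse[OF H(1) True T _ q' q_supp q_fin q_eq g' g_supp g_fin g_eq])
    obtain c ys where c: "0 \<le> c" and ys: "\<And>n. step_list T (ys n)"
      and 1: "\<And>n. sq_norm lborel (\<lambda>x. step_fun (ys n) x - q' x) \<le> ennreal (c * (1 / 4) ^ n)"
      and 2: "\<And>n. gagliardo H (\<lambda>x. step_fun (ys n) x - q' x) \<le> ennreal (c * (1 / 4) ^ n)"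
      and 3: "\<And>n. sq_norm lborel (\<lambda>x. zero_ext T (step_RL H (ys n)) x - g' x) \<le> ennreal (c * (1 / 4) ^ n)"
      using RL_derivative_step_approximation[OF H(1) True T q' g' g_supp g_fin inv] by blast
    show thesis
    proof (rule that[of "2 * c" ys])
      fix n
      have "integrand_norm2 H T (\<lambda>r. step_fun (ys n) r - q r) \<le> ennreal (c * (1 / 4) ^ n) + ennreal (c * (1 / 4) ^ n)"
        unfolding N[OF ys] using True 1 2 by (simp add: add_mono)
      also have "\<dots> = ennreal (2 * c * (1 / 4) ^ n)"
        using c by (simp add: ennreal_plus[symmetric] del: ennreal_plus)
      finally show "integrand_norm2 H T (\<lambda>r. step_fun (ys n) r - q r) \<le> ennreal (2 * c * (1 / 4) ^ n)" .
      show "sq_norm lborel (\<lambda>x. zero_ext T (step_RL H (ys n)) x - g' x) \<le> ennreal (2 * c * (1 / 4) ^ n)"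
        by (rule order_trans[OF 3]) (use c in \<open>auto intro!: ennreal_leI mult_right_mono\<close>)
    qed (use c ys in auto)
  next
    case False
    have "\<exists>xs. step_list T xs \<and> sq_norm lborel (\<lambda>x. step_fun xs x - q' x) < ennreal ((1 / 4) ^ n)" for n
      using step_fun_dense[OF less_imp_le[OF T] q' q_supp q_fin, of "(1 / 4) ^ n"] by auto
    then obtain ys where ys: "\<And>n. step_list T (ys n)"
      "\<And>n. sq_norm lborel (\<lambda>x. step_fun (ys n) x - q' x) < ennreal ((1 / 4) ^ n)"
      by metis
    obtain K where K: "0 \<le> K" "\<And>n. sq_norm lborel (\<lambda>x. zero_ext T (step_RL H (ys n)) x - g' x) \<le> ennreal K * sq_norm lborel (\<lambda>x. step_fun (ys n) x - q' x)"
    proof (cases "H = 1 / 2")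
      case True
      then have "AE t in lebesgue_on {0..T}. g t = q t" using RL by (simp add: has_RL_def)
      then have "AE t in lborel. t \<in> {0..T} \<longrightarrow> g t = q t"
        by (simp add: AE_restrict_space_iff AE_completion_iff)
      then have "AE t in lborel. q' t = g' t"
        using q_eq g_eq
      proof eventually_elim
        case (elim t)
        then show ?case using q_supp[of t] g_supp[of t] by (auto simp: zero_ext_def split: if_splits)
      qed
      then have "sq_norm lborel (\<lambda>x. zero_ext T (step_RL H (ys n)) x - g' x) = sq_norm lborel (\<lambda>x. step_fun (ys n) x - q' x)" for n
        unfolding True step_RL_half[OF ys(1)] zero_ext_step_fun[OF ys(1)] by (intro sq_norm_cong_AE) auto
      then show thesis by (intro that[of 1]) auto
    next
      case False
      then have H': "1 / 2 < H" using \<open>\<not> H < 1 / 2\<close> by simp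
      define s where "s = H - 1 / 2"
      have s: "0 < s" using H' by (simp add: s_def)
      have "AE t in lebesgue_on {0..T}. g t = RL_integral s q t"
        using RL H' by (simp add: has_RL_def s_def diff_divide_distrib)
      then have "AE t in lborel. t \<in> {0..T} \<longrightarrow> g t = RL_integral s q t"
        by (simp add: AE_restrict_space_iff AE_completion_iff)
      then have g_conv: "AE t in lborel. g' t = zero_ext T (rl_conv s q') t"
        using g_eq
      proof eventually_elim
        case (elim t)
        then show ?case
          using g_supp[of t] RL_integral_eq_rl_conv[OF s q' q_supp q_eq, of t]
          by (auto simp: zero_ext_def split: if_splits)
      qed
      show thesis
      proof (rule that)
        fix n
        have "AE x in lborel. zero_ext T (rl_conv s (step_fun (ys n))) x - zero_ext T (rl_conv s q') x
            = zero_ext T (rl_conv s (\<lambda>x. step_fun (ys n) x - q' x)) x"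
          by (rule AE_rl_conv_diff[OF s _ step_fun_support[OF ys(1)] sq_norm_step_fun_finite _ q_supp q_fin]) measurable
        then have "AE x in lborel. zero_ext T (step_RL H (ys n)) x - g' x = zero_ext T (rl_conv s (\<lambda>x. step_fun (ys n) x - q' x)) x"
          using g_conv unfolding step_RL_eq_rl_conv[OF H' ys(1)] s_def[symmetric] by eventually_elim simp
        then have "sq_norm lborel (\<lambda>x. zero_ext T (step_RL H (ys n)) x - g' x) = sq_norm lborel (zero_ext T (rl_conv s (\<lambda>x. step_fun (ys n) x - q' x)))"
          by (rule sq_norm_cong_AE)
        also have "\<dots> \<le> ennreal ((rl_kernel (s + 1) T)\<^sup>2) * sq_norm lborel (\<lambda>x. step_fun (ys n) x - q' x)"
          by (rule sq_norm_rl_conv_le[OF s]) (use step_fun_support[OF ys(1)] q_supp in auto)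
        finally show "sq_norm lborel (\<lambda>x. zero_ext T (step_RL H (ys n)) x - g' x) \<le> ennreal ((rl_kernel (s + 1) T)\<^sup>2) * sq_norm lborel (\<lambda>x. step_fun (ys n) x - q' x)" .
      qed simp
    qed
    show thesis
    proof (rule that[of "K + 1" ys])
      fix n
      have "integrand_norm2 H T (\<lambda>r. step_fun (ys n) r - q r) \<le> ennreal (1 * (1 / 4) ^ n)"
        unfolding N[OF ys(1)] using ys(2)[of n] False by simp
      also have "\<dots> \<le> ennreal ((K + 1) * (1 / 4) ^ n)" using K(1) by (intro ennreal_leI mult_right_mono) auto
      finally show "integrand_norm2 H T (\<lambda>r. step_fun (ys n) r - q r) \<le> ennreal ((K + 1) * (1 / 4) ^ n)" .
      have "sq_norm lborel (\<lambda>x. zero_ext T (step_RL H (ys n)) x - g' x) \<le> ennreal K * ennreal ((1 / 4) ^ n)"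
        using ys(2)[of n] by (intro order_trans[OF K(2)] mult_left_mono) auto
      also have "\<dots> = ennreal (K * (1 / 4) ^ n)" using K(1) by (simp add: ennreal_mult)
      also have "\<dots> \<le> ennreal ((K + 1) * (1 / 4) ^ n)" by (intro ennreal_leI mult_right_mono) auto
      finally show "sq_norm lborel (\<lambda>x. zero_ext T (step_RL H (ys n)) x - g' x) \<le> ennreal ((K + 1) * (1 / 4) ^ n)" .
    qed (use K ys in auto)
  qed
  show thesis
  proof (rule that[of "2 * c" ys])
    fix n
    show "integrand_norm2 H T (\<lambda>r. step_fun (ys n) r - q r) \<le> ennreal (2 * c * (1 / 4) ^ n)"
      by (rule order_trans[OF 1]) (use c in \<open>auto intro!: ennreal_leI mult_right_mono\<close>)
    have "sq_norm lborel (zero_ext T (step_RL H (ys n))) \<le> 2 * sq_norm lborel (\<lambda>x. zero_ext T (step_RL H (ys n)) x - g' x) + 2 * sq_norm lborel g'"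
      by (rule sq_norm_le) measurable
    also have "\<dots> \<le> 2 * ennreal (c * (1 / 4) ^ n) + 2 * ennreal ((L2_norm T g)\<^sup>2)"
      unfolding g_norm by (intro add_right_mono mult_left_mono 2) simp
    also have "\<dots> = ennreal (2 * (c * (1 / 4) ^ n)) + ennreal (2 * (L2_norm T g)\<^sup>2)"
      using c by (simp add: ennreal_mult)
    also have "\<dots> = ennreal (2 * c * (1 / 4) ^ n + 2 * (L2_norm T g)\<^sup>2)"
      using c by (simp add: ennreal_plus[symmetric] mult.assoc del: ennreal_plus)
    finally show "sq_norm lborel (zero_ext T (step_RL H (ys n))) \<le> ennreal (2 * c * (1 / 4) ^ n + 2 * (L2_norm T g)\<^sup>2)" .
  qed (use c ys in auto)
qed

section \<open>The Wiener integral\<close>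

text \<open>
  An integral of a non-integrable function is 0 by convention, so that the covariance
  formula alone does not give square integrability.
\<close>

lemma (in prob_space) gaussian_rv_square_integrable:
  assumes "gaussian_rv M X"
  shows "integrable M (\<lambda>\<omega>. (X \<omega>)\<^sup>2)"
proof -
  have [measurable]: "X \<in> borel_measurable M" using assms by (simp add: gaussian_rv_def)
  from assms consider \<mu> where "AE \<omega> in M. X \<omega> = \<mu>"
    | \<mu> \<sigma> where "0 < \<sigma>" "distributed M lborel X (normal_density \<mu> \<sigma>)"
    unfolding gaussian_rv_def by blast
  then show ?thesis
  proof cases
    case 1
    then have eq: "AE \<omega> in M. \<mu>\<^sup>2 = (X \<omega>)\<^sup>2" by eventually_elim simp
    have "integrable M (\<lambda>_. \<mu>\<^sup>2)" by simp
    then show ?thesis by (rule integrable_cong_AE_imp[OF _ _ eq]) measurable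
  next
    case 2
    have "integrable lborel (\<lambda>x. normal_density \<mu> \<sigma> x * (x - \<mu>) ^ 2
       + (2 * \<mu>) * (normal_density \<mu> \<sigma> x * (x - \<mu>) ^ 1) + \<mu>\<^sup>2 * (normal_density \<mu> \<sigma> x * (x - \<mu>) ^ 0))"
      by (intro Bochner_Integration.integrable_add integrable_mult_right integrable_normal_moment \<open>0 < \<sigma>\<close>)
    also have "(\<lambda>x. normal_density \<mu> \<sigma> x * (x - \<mu>) ^ 2
       + (2 * \<mu>) * (normal_density \<mu> \<sigma> x * (x - \<mu>) ^ 1) + \<mu>\<^sup>2 * (normal_density \<mu> \<sigma> x * (x - \<mu>) ^ 0))
       = (\<lambda>x. normal_density \<mu> \<sigma> x * x\<^sup>2)"
      by (simp add: fun_eq_iff power2_eq_square algebra_simps)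
    finally show ?thesis
      using distributed_integrable[OF 2(2), of "\<lambda>x. x\<^sup>2"] by simp
  qed
qed

context
  fixes M :: "'a measure" and W :: "real \<Rightarrow> 'a \<Rightarrow> real" and H :: real
  assumes prob: "prob_space M" and H: "0 < H" "H < 1" and fbm: "fractional_brownian_motion M H W"
begin

interpretation prob_space M by (rule prob)

lemma fbm_gaussian:
  assumes "0 \<le> t"
  shows "gaussian_rv M (W t)"
proof -
  have "\<forall>S c. finite S \<and> S \<subseteq> {0..} \<longrightarrow> gaussian_rv M (\<lambda>\<omega>. \<Sum>t\<in>S. c t * W t \<omega>)"
    using fbm by (simp add: fractional_brownian_motion_def gaussian_process_def)
  from this[rule_format, of "{t}" "\<lambda>_. 1"] assms show ?thesis by simp
qed

lemma fbm_measurable: "0 \<le> t \<Longrightarrow> W t \<in> borel_measurable M"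
  using fbm_gaussian[of t] by (simp add: gaussian_rv_def)

lemma fbm_increment_sq_norm:
  assumes t: "0 \<le> t" and r: "0 \<le> r"
  shows "sq_norm M (\<lambda>\<omega>. W t \<omega> - W r \<omega>) = ennreal (1 * \<bar>t - r\<bar> powr (2 * H))"
proof -
  have [measurable]: "W t \<in> borel_measurable M" "W r \<in> borel_measurable M"
    using t r by (auto intro: fbm_measurable)
  have sq: "integrable M (\<lambda>\<omega>. (W t \<omega>)\<^sup>2)" "integrable M (\<lambda>\<omega>. (W r \<omega>)\<^sup>2)"
    using t r by (auto intro!: gaussian_rv_square_integrable fbm_gaussian)
  have prod: "integrable M (\<lambda>\<omega>. W t \<omega> * W r \<omega>)"
  proof (rule Bochner_Integration.integrable_bound)
    show "integrable M (\<lambda>\<omega>. (W t \<omega>)\<^sup>2 + (W r \<omega>)\<^sup>2)" using sq by simp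
    show "AE \<omega> in M. norm (W t \<omega> * W r \<omega>) \<le> norm ((W t \<omega>)\<^sup>2 + (W r \<omega>)\<^sup>2)"
    proof (rule AE_I2)
      fix \<omega>
      have "2 * (\<bar>W t \<omega>\<bar> * \<bar>W r \<omega>\<bar>) \<le> (W t \<omega>)\<^sup>2 + (W r \<omega>)\<^sup>2"
        using zero_le_power2[of "\<bar>W t \<omega>\<bar> - \<bar>W r \<omega>\<bar>"] by (simp add: power2_diff)
      moreover have "0 \<le> \<bar>W t \<omega>\<bar> * \<bar>W r \<omega>\<bar>" by simp
      ultimately have "\<bar>W t \<omega>\<bar> * \<bar>W r \<omega>\<bar> \<le> (W t \<omega>)\<^sup>2 + (W r \<omega>)\<^sup>2" by linarith
      then show "norm (W t \<omega> * W r \<omega>) \<le> norm ((W t \<omega>)\<^sup>2 + (W r \<omega>)\<^sup>2)"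
        by (simp add: abs_mult)
    qed
  qed measurable
  have cov: "(LINT \<omega>|M. W u \<omega> * W v \<omega>) = 1 / 2 * (u powr (2 * H) + v powr (2 * H) - \<bar>u - v\<bar> powr (2 * H))"
    if "0 \<le> u" "0 \<le> v" for u v
    using fbm that by (simp add: fractional_brownian_motion_def)
  have expand: "(\<lambda>\<omega>. (W t \<omega> - W r \<omega>)\<^sup>2) = (\<lambda>\<omega>. (W t \<omega>)\<^sup>2 + (W r \<omega>)\<^sup>2 - 2 * (W t \<omega> * W r \<omega>))"
    by (simp add: power2_diff fun_eq_iff)
  have int: "integrable M (\<lambda>\<omega>. (W t \<omega> - W r \<omega>)\<^sup>2)"
    unfolding expand using sq prod by simp
  have "(LINT \<omega>|M. (W t \<omega> - W r \<omega>)\<^sup>2) = (LINT \<omega>|M. W t \<omega> * W t \<omega>) + (LINT \<omega>|M. W r \<omega> * W r \<omega>) - 2 * (LINT \<omega>|M. W t \<omega> * W r \<omega>)"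
    unfolding expand using sq prod by (simp add: power2_eq_square)
  also have "\<dots> = \<bar>t - r\<bar> powr (2 * H)"
    using cov[OF t r] cov[OF t t] cov[OF r r] by simp
  finally show ?thesis using sq_norm_eq_integral[OF int] by simp
qed

lemma measurable_step_integral_fbm: "step_list T xs \<Longrightarrow> step_integral W xs \<in> borel_measurable M"
  by (rule borel_measurable_step_integral) (auto intro: fbm_measurable)

lemma sq_norm_step_integral_fbm:
  assumes "step_list T xs"
  shows "sq_norm M (step_integral W xs) = ennreal (fbm_energy H xs)"
  using sq_norm_step_integral[where \<Psi> = W and k = 1 and N = M and T = T and H = H, OF _ _ _ assms]
    fbm_increment_sq_norm fbm_measurable by simp

text \<open>
  Completeness of \<open>L\<^sup>2\<close> for sequences of geometric rate. The bound \<open>2 \<bar>d\<bar> \<le> \<lambda> d\<^sup>2 + 1 / \<lambda>\<close>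
  with \<open>\<lambda> = 2\<^sup>n\<close> makes the increments absolutely summable almost surely, and Fatou's lemma
  gives the rate for the limit.
\<close>

lemma square_integrable_limit:
  assumes S: "\<And>n. S n \<in> borel_measurable M"
    and c: "0 \<le> c" and Cauchy: "\<And>n m. n \<le> m \<Longrightarrow> sq_norm M (\<lambda>\<omega>. S n \<omega> - S m \<omega>) \<le> ennreal (c * (1 / 4) ^ n)"
  obtains X where "X \<in> borel_measurable M" "\<And>n. sq_norm M (\<lambda>\<omega>. S n \<omega> - X \<omega>) \<le> ennreal (c * (1 / 4) ^ n)"
proof -
  note [measurable] = S
  define d where "d n \<omega> = S (Suc n) \<omega> - S n \<omega>" for n \<omega>
  have [measurable]: "d n \<in> borel_measurable M" for n unfolding d_def by measurable
  have "AE \<omega> in M. summable (\<lambda>n. (sqrt (2 ^ n) * d n \<omega>)\<^sup>2)"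
  proof (rule AE_summable_sq)
    fix n
    have "sq_norm M (\<lambda>\<omega>. sqrt (2 ^ n) * d n \<omega>) = ennreal ((sqrt (2 ^ n))\<^sup>2) * sq_norm M (d n)"
      by (rule sq_norm_cmult) measurable
    also have "\<dots> \<le> ennreal (2 ^ n) * ennreal (c * (1 / 4) ^ n)"
    proof (intro mult_mono)
      have "sq_norm M (d n) = sq_norm M (\<lambda>\<omega>. S n \<omega> - S (Suc n) \<omega>)"
        unfolding d_def[abs_def] by (rule sq_norm_commute)
      then show "sq_norm M (d n) \<le> ennreal (c * (1 / 4) ^ n)" using Cauchy[of n "Suc n"] by simp
    qed auto
    also have "\<dots> = ennreal (c * (1 / 2) ^ n)"
    proof -
      have "2 ^ n * (c * (1 / 4) ^ n) = c * (1 / 2) ^ n" by (simp add: power_mult_distrib[symmetric] mult.left_commute)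
      then show ?thesis using c by (subst ennreal_mult[symmetric]) auto
    qed
    finally show "sq_norm M (\<lambda>\<omega>. sqrt (2 ^ n) * d n \<omega>) \<le> ennreal (c * (1 / 2) ^ n)" .
  qed (use c in \<open>auto intro!: summable_mult summable_geometric\<close>)
  then have conv: "AE \<omega> in M. (\<lambda>n. S n \<omega>) \<longlonglongrightarrow> lim (\<lambda>n. S n \<omega>)"
  proof eventually_elim
    case (elim \<omega>)
    have "summable (\<lambda>n. (sqrt (2 ^ n) * d n \<omega>)\<^sup>2 + (1 / 2) ^ n)"
      by (intro summable_add elim summable_geometric) simp
    then have "summable (\<lambda>n. d n \<omega>)"
    proof (rule summable_comparison_test'[where N = 0])
      fix n
      have "0 \<le> (sqrt (2 ^ n) * \<bar>d n \<omega>\<bar> - sqrt ((1 / 2) ^ n))\<^sup>2" by simp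
      also have "\<dots> = (sqrt (2 ^ n) * d n \<omega>)\<^sup>2 + (1 / 2) ^ n - 2 * \<bar>d n \<omega>\<bar> * (sqrt (2 ^ n) * sqrt ((1 / 2) ^ n))"
        by (simp add: power2_diff power_mult_distrib)
      also have "sqrt (2 ^ n) * sqrt ((1 / 2) ^ n) = 1"
        by (simp add: real_sqrt_mult[symmetric] power_mult_distrib[symmetric])
      finally show "norm (d n \<omega>) \<le> (sqrt (2 ^ n) * d n \<omega>)\<^sup>2 + (1 / 2) ^ n" by simp
    qed
    then have "convergent (\<lambda>n. \<Sum>i<n. d i \<omega>)" by (simp add: summable_iff_convergent)
    moreover have "(\<Sum>i<n. d i \<omega>) = S n \<omega> - S 0 \<omega>" for n
      unfolding d_def by (rule sum_lessThan_telescope)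
    ultimately have "convergent (\<lambda>n. (S n \<omega> - S 0 \<omega>) + S 0 \<omega>)"
      by (intro convergent_add convergent_const) simp
    then show ?case by (simp add: convergent_LIMSEQ_iff)
  qed
  define X where "X \<omega> = lim (\<lambda>n. S n \<omega>)" for \<omega>
  have [measurable]: "X \<in> borel_measurable M" unfolding X_def by measurable
  show thesis
  proof (rule that[of X])
    fix n
    have "sq_norm M (\<lambda>\<omega>. S n \<omega> - X \<omega>) = (\<integral>\<^sup>+\<omega>. liminf (\<lambda>m. ennreal ((S n \<omega> - S m \<omega>)\<^sup>2)) \<partial>M)"
      unfolding sq_norm_def
    proof (rule nn_integral_cong_AE)
      show "AE \<omega> in M. ennreal ((S n \<omega> - X \<omega>)\<^sup>2) = liminf (\<lambda>m. ennreal ((S n \<omega> - S m \<omega>)\<^sup>2))"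
        using conv
      proof eventually_elim
        case (elim \<omega>)
        have "(\<lambda>m. ennreal ((S n \<omega> - S m \<omega>)\<^sup>2)) \<longlonglongrightarrow> ennreal ((S n \<omega> - X \<omega>)\<^sup>2)"
          unfolding X_def by (intro tendsto_ennrealI tendsto_intros elim)
        then show ?case by (rule lim_imp_Liminf[OF sequentially_bot, symmetric])
      qed
    qed
    also have "\<dots> \<le> liminf (\<lambda>m. sq_norm M (\<lambda>\<omega>. S n \<omega> - S m \<omega>))"
      unfolding sq_norm_def by (rule nn_integral_liminf) measurable
    also have "\<dots> \<le> ennreal (c * (1 / 4) ^ n)"
      by (rule liminf_le_const[OF Cauchy])
    finally show "sq_norm M (\<lambda>\<omega>. S n \<omega> - X \<omega>) \<le> ennreal (c * (1 / 4) ^ n)" .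
  qed measurable
qed

lemma integrand_norm2_step_diff:
  assumes q: "sq_integrable T q" and xs: "step_list T xs" and ys: "step_list T ys"
  shows "integrand_norm2 H T (step_fun (step_diff xs ys))
     \<le> 2 * integrand_norm2 H T (\<lambda>r. step_fun xs r - q r) + 2 * integrand_norm2 H T (\<lambda>r. step_fun ys r - q r)"
proof -
  obtain q' where [measurable]: "q' \<in> borel_measurable borel" and supp: "\<And>x. x \<notin> {0..T} \<Longrightarrow> q' x = 0"
    and eq: "AE x in lborel. zero_ext T q x = q' x"
    using sq_integrable_borel_rep[OF q] by blast
  have N: "integrand_norm2 H T (\<lambda>r. step_fun zs r - q r) = sq_norm lborel (\<lambda>x. step_fun zs x - q' x)
      + (if H < 1 / 2 then gagliardo H (\<lambda>x. step_fun zs x - q' x) else 0)" if "step_list T zs" for zs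
    by (rule integrand_norm2_eq[OF _ AE_zero_ext_step_fun_minus[OF that supp eq]]) measurable
  have D: "integrand_norm2 H T (step_fun (step_diff xs ys)) = sq_norm lborel (step_fun (step_diff xs ys))
      + (if H < 1 / 2 then gagliardo H (step_fun (step_diff xs ys)) else 0)"
  proof (rule integrand_norm2_eq)
    have "step_list T (step_diff xs ys)" using xs ys by simp
    from zero_ext_step_fun[OF this]
    show "AE x in lborel. zero_ext T (step_fun (step_diff xs ys)) x = step_fun (step_diff xs ys) x" by simp
  qed measurable
  let ?f = "\<lambda>x. step_fun xs x - q' x" and ?g = "\<lambda>x. step_fun ys x - q' x"
  have 1: "sq_norm lborel (step_fun (step_diff xs ys)) \<le> 2 * sq_norm lborel ?f + 2 * sq_norm lborel ?g"
  proof -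
    have "step_fun (step_diff xs ys) = (\<lambda>x. ?f x - ?g x)" by (simp add: fun_eq_iff)
    then show ?thesis using sq_norm_diff[of ?f lborel ?g] by simp
  qed
  have 2: "gagliardo H (step_fun (step_diff xs ys)) \<le> 2 * gagliardo H ?f + 2 * gagliardo H ?g"
  proof -
    have "slobodeckij_quotient H (step_fun (step_diff xs ys)) = (\<lambda>z. slobodeckij_quotient H ?f z - slobodeckij_quotient H ?g z)"
      by (auto simp: slobodeckij_quotient_def fun_eq_iff algebra_simps)
    then show ?thesis
      using sq_norm_diff[of "slobodeckij_quotient H ?f" "lborel \<Otimes>\<^sub>M lborel" "slobodeckij_quotient H ?g"]
      by (simp add: gagliardo_eq_sq_norm)
  qed
  show ?thesis
    unfolding D N[OF xs] N[OF ys] using 1 add_mono[OF 1 2] by (simp add: distrib_left add_ac)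
qed

text \<open>
  The given approximation shows that a Wiener integral exists, so that the chosen version
  satisfies the defining property, but with step functions of its own. These are compared
  with the given ones through the continuity of the elementary integral. The factor 4 stems
  from two applications of the crude triangle inequality.
\<close>

lemma wiener_integral_sq_norm_le:
  assumes q: "sq_integrable T q" and c: "0 \<le> c" and ys: "\<And>n. step_list T (ys n)"
    and approx: "\<And>n. integrand_norm2 H T (\<lambda>r. step_fun (ys n) r - q r) \<le> ennreal (c * (1 / 4) ^ n)"
    and energy: "\<And>n. ennreal (fbm_energy H (ys n)) \<le> ennreal (d n)" and d: "d \<longlonglongrightarrow> D"
  shows "wiener_integral M W H T q \<in> borel_measurable M"
    and "sq_norm M (wiener_integral M W H T q) \<le> ennreal (4 * D)"
proof -
  obtain C where C: "0 < C" "\<And>xs. step_list T xs \<Longrightarrow> ennreal (fbm_energy H xs) \<le> ennreal C * integrand_norm2 H T (step_fun xs)"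
    using energy_le_integrand_norm2[OF H, of T] by blast
  have diff: "sq_norm M (\<lambda>\<omega>. step_integral W xs \<omega> - step_integral W zs \<omega>)
      \<le> ennreal C * (2 * integrand_norm2 H T (\<lambda>r. step_fun xs r - q r) + 2 * integrand_norm2 H T (\<lambda>r. step_fun zs r - q r))"
    if "step_list T xs" "step_list T zs" for xs zs
  proof -
    have steps: "step_list T (step_diff xs zs)" using that by simp
    have "sq_norm M (\<lambda>\<omega>. step_integral W xs \<omega> - step_integral W zs \<omega>) = sq_norm M (step_integral W (step_diff xs zs))"
      by (simp add: sq_norm_def)
    also have "\<dots> \<le> ennreal C * integrand_norm2 H T (step_fun (step_diff xs zs))"
      unfolding sq_norm_step_integral_fbm[OF steps] by (rule C(2)[OF steps])
    also have "\<dots> \<le> ennreal C * (2 * integrand_norm2 H T (\<lambda>r. step_fun xs r - q r) + 2 * integrand_norm2 H T (\<lambda>r. step_fun zs r - q r))"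
      by (intro mult_left_mono integrand_norm2_step_diff q that) simp
    finally show ?thesis .
  qed
  define S where "S n = step_integral W (ys n)" for n
  have S [measurable]: "S n \<in> borel_measurable M" for n
    unfolding S_def by (rule measurable_step_integral_fbm[OF ys])
  have lim0: "(\<lambda>n. ennreal (k * (1 / 4) ^ n)) \<longlonglongrightarrow> 0" for k
  proof -
    have "(\<lambda>n. k * (1 / 4) ^ n) \<longlonglongrightarrow> k * 0"
      by (intro tendsto_intros LIMSEQ_power_zero) simp
    then have "(\<lambda>n. ennreal (k * (1 / 4) ^ n)) \<longlonglongrightarrow> ennreal (k * 0)" by (rule tendsto_ennrealI)
    then show ?thesis by simp
  qed
  have approx0: "(\<lambda>n. integrand_norm2 H T (\<lambda>r. step_fun (ys n) r - q r)) \<longlonglongrightarrow> 0"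
    by (rule tendsto_sandwich[OF _ _ tendsto_const lim0[of c]]) (use approx in auto)
  have "\<exists>X. has_wiener_integral M W H T q X"
  proof -
    have Cauchy: "sq_norm M (\<lambda>\<omega>. S n \<omega> - S m \<omega>) \<le> ennreal ((C * (4 * c)) * (1 / 4) ^ n)" if "n \<le> m" for n m
    proof -
      have "sq_norm M (\<lambda>\<omega>. S n \<omega> - S m \<omega>) \<le> ennreal C * (2 * ennreal (c * (1 / 4) ^ n) + 2 * ennreal (c * (1 / 4) ^ n))"
        unfolding S_def
      proof (rule order_trans[OF diff[OF ys ys]], intro mult_left_mono add_mono approx)
        have "c * (1 / 4) ^ m \<le> c * (1 / 4) ^ n" using that c by (intro mult_left_mono power_decreasing) auto
        then show "integrand_norm2 H T (\<lambda>r. step_fun (ys m) r - q r) \<le> ennreal (c * (1 / 4) ^ n)"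
          by (intro order_trans[OF approx] ennreal_leI)
      qed auto
      also have "2 * ennreal (c * (1 / 4) ^ n) = ennreal (2 * (c * (1 / 4) ^ n))"
        using c by (simp add: ennreal_mult)
      also have "ennreal (2 * (c * (1 / 4) ^ n)) + ennreal (2 * (c * (1 / 4) ^ n)) = ennreal (4 * c * (1 / 4) ^ n)"
        using c by (simp add: ennreal_plus[symmetric] del: ennreal_plus)
      also have "ennreal C * ennreal (4 * c * (1 / 4) ^ n) = ennreal ((C * (4 * c)) * (1 / 4) ^ n)"
        using C(1) by (simp add: ennreal_mult'[symmetric] mult.assoc)
      finally show ?thesis .
    qed
    obtain X where [measurable]: "X \<in> borel_measurable M"
      and X: "\<And>n. sq_norm M (\<lambda>\<omega>. S n \<omega> - X \<omega>) \<le> ennreal ((C * (4 * c)) * (1 / 4) ^ n)"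
      using square_integrable_limit[OF S _ Cauchy] C(1) c by auto
    have "sq_norm M X \<le> 2 * sq_norm M (\<lambda>\<omega>. X \<omega> - S 0 \<omega>) + 2 * sq_norm M (S 0)"
      by (rule sq_norm_le) measurable
    also have "\<dots> < \<infinity>"
    proof -
      have "sq_norm M (\<lambda>\<omega>. X \<omega> - S 0 \<omega>) < \<infinity>"
        using X[of 0] by (subst sq_norm_commute) (auto intro: order.strict_trans1)
      then show ?thesis
        using sq_norm_step_integral_fbm[OF ys[of 0]] by (simp add: S_def ennreal_mult_less_top)
    qed
    finally have "integrable M (\<lambda>\<omega>. (X \<omega>)\<^sup>2)" by (simp add: integrable_sq_iff)
    moreover have "(\<lambda>n. sq_norm M (\<lambda>\<omega>. S n \<omega> - X \<omega>)) \<longlonglongrightarrow> 0"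
      by (rule tendsto_sandwich[OF _ _ tendsto_const lim0[of "C * (4 * c)"]]) (use X in auto)
    ultimately have "has_wiener_integral M W H T q X"
      unfolding has_wiener_integral_def sq_norm_def S_def
      using q ys approx0 by (intro conjI exI[of _ ys]) auto
    then show ?thesis by blast
  qed
  then have "has_wiener_integral M W H T q (wiener_integral M W H T q)"
    unfolding wiener_integral_def by (rule someI_ex)
  then obtain xs where X [measurable]: "wiener_integral M W H T q \<in> borel_measurable M"
    and xs: "\<And>n. step_list T (xs n)" "(\<lambda>n. integrand_norm2 H T (\<lambda>r. step_fun (xs n) r - q r)) \<longlonglongrightarrow> 0"
      "(\<lambda>n. sq_norm M (\<lambda>\<omega>. step_integral W (xs n) \<omega> - wiener_integral M W H T q \<omega>)) \<longlonglongrightarrow> 0"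
    unfolding has_wiener_integral_def sq_norm_def by blast
  show "wiener_integral M W H T q \<in> borel_measurable M" by (rule X)
  let ?X = "wiener_integral M W H T q"
  let ?a = "\<lambda>n. sq_norm M (\<lambda>\<omega>. step_integral W (xs n) \<omega> - ?X \<omega>)"
  let ?b = "\<lambda>n. integrand_norm2 H T (\<lambda>r. step_fun (xs n) r - q r)"
  let ?e = "\<lambda>n. integrand_norm2 H T (\<lambda>r. step_fun (ys n) r - q r)"
  have le: "sq_norm M ?X \<le> 2 * ?a n + 2 * (2 * (ennreal C * (2 * ?b n + 2 * ?e n)) + 2 * ennreal (d n))" for n
  proof -
    have [measurable]: "step_integral W (xs n) \<in> borel_measurable M" by (rule measurable_step_integral_fbm[OF xs(1)])
    have "sq_norm M ?X \<le> 2 * sq_norm M (\<lambda>\<omega>. ?X \<omega> - step_integral W (xs n) \<omega>) + 2 * sq_norm M (step_integral W (xs n))"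
      by (rule sq_norm_le) measurable
    also have "sq_norm M (\<lambda>\<omega>. ?X \<omega> - step_integral W (xs n) \<omega>) = ?a n" by (rule sq_norm_commute)
    also have "sq_norm M (step_integral W (xs n)) \<le> 2 * sq_norm M (\<lambda>\<omega>. step_integral W (xs n) \<omega> - S n \<omega>) + 2 * sq_norm M (S n)"
      by (rule sq_norm_le) measurable
    also have "sq_norm M (S n) \<le> ennreal (d n)"
      unfolding S_def sq_norm_step_integral_fbm[OF ys] by (rule energy)
    also have "sq_norm M (\<lambda>\<omega>. step_integral W (xs n) \<omega> - S n \<omega>) \<le> ennreal C * (2 * ?b n + 2 * ?e n)"
      unfolding S_def by (rule diff[OF xs(1) ys])
    finally show ?thesis by (simp add: add_mono mult_left_mono)
  qed
  have "(\<lambda>n. 2 * ?a n + 2 * (2 * (ennreal C * (2 * ?b n + 2 * ?e n)) + 2 * ennreal (d n)))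
      \<longlonglongrightarrow> 2 * 0 + 2 * (2 * (ennreal C * (2 * 0 + 2 * 0)) + 2 * ennreal D)"
    by (intro tendsto_add ennreal_tendsto_cmult tendsto_ennrealI xs approx0 d) auto
  then have "sq_norm M ?X \<le> 2 * 0 + 2 * (2 * (ennreal C * (2 * 0 + 2 * 0)) + 2 * ennreal D)"
    by (rule LIMSEQ_le_const) (use le in blast)
  also have "\<dots> = ennreal (4 * D)"
    by (simp add: ennreal_mult' mult.assoc[symmetric])
  finally show "sq_norm M ?X \<le> ennreal (4 * D)" .
qed

end

text \<open>
  The end points trade places, and the half-open intervals change at finitely many points
  only.
\<close>

definition step_reflect :: "real \<Rightarrow> (real \<times> real \<times> real) list \<Rightarrow> (real \<times> real \<times> real) list" where
  "step_reflect T xs = map (\<lambda>(c, a, b). (c, T - b, T - a)) xs"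

lemma step_list_reflect: "step_list T xs \<Longrightarrow> step_list T (step_reflect T xs)"
  by (auto simp: step_list_def step_reflect_def)

text \<open>
  The covariance of two increments depends only on the distances between the end points.
\<close>

lemma fbm_energy_reflect: "fbm_energy H (step_reflect T xs) = fbm_energy H xs"
proof -
  have "incr_cov H (T - b) (T - a) (T - b') (T - a') = incr_cov H a b a' b'" for a b a' b'
    by (simp add: incr_cov_def abs_minus_commute add.commute)
  then show ?thesis
    by (simp add: fbm_energy_def step_form_def step_reflect_def split_def comp_def)
qed

text \<open>
  The affine change of variables applies to Borel predicates, hence to membership in a null
  set that covers the exceptions.
\<close>

lemma AE_lborel_reflect:
  fixes P :: "real \<Rightarrow> bool"
  assumes "AE x in lborel. P x"
  shows "AE x in lborel. P (T - x)"
proof -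
  obtain N where N: "\<And>x. x \<in> space lborel - N \<Longrightarrow> P x" "N \<in> null_sets lborel"
    using AE_E3[OF assms] by blast
  then have [measurable]: "N \<in> sets borel" by auto
  have "AE x in lborel. T + (- 1) * x \<notin> N"
    by (rule AE_borel_affine) (use AE_not_in[OF N(2)] in auto)
  then show ?thesis by eventually_elim (use N(1) in auto)
qed

lemma step_fun_reflect: "AE x in lborel. step_fun (step_reflect T xs) x = step_fun xs (T - x)"
proof (induction xs)
  case Nil
  then show ?case by (simp add: step_fun_def step_reflect_def)
next
  case (Cons p xs)
  obtain c a b where p: "p = (c, a, b)" by (cases p)
  have "AE x in lborel. x \<noteq> T - a" by (rule AE_lborel_singleton)
  moreover have "AE x in lborel. x \<noteq> T - b" by (rule AE_lborel_singleton)
  ultimately show ?case using Cons.IH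
  proof eventually_elim
    case (elim x)
    have "indicator {T - b<..T - a} x = (indicator {a<..b} (T - x) :: real)"
      using elim by (auto simp: indicator_def)
    with elim show ?case by (simp add: p step_fun_def step_reflect_def)
  qed
qed

lemma sq_norm_reflect:
  fixes f :: "real \<Rightarrow> real"
  assumes [measurable]: "f \<in> borel_measurable borel"
  shows "sq_norm lborel (\<lambda>x. f (T - x)) = sq_norm lborel f"
  unfolding sq_norm_def by (subst (2) nn_integral_real_affine[where c = "- 1" and t = T]) auto

lemma gagliardo_reflect:
  assumes [measurable]: "f \<in> borel_measurable borel"
  shows "gagliardo H (\<lambda>x. f (T - x)) = gagliardo H f"
proof -
  have inner: "(\<integral>\<^sup>+y. ennreal ((f (T - x) - f (T - y))\<^sup>2 / \<bar>x - y\<bar> powr (2 - 2 * H)) \<partial>lborel)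
    = (\<integral>\<^sup>+y. ennreal ((f (T - x) - f y)\<^sup>2 / \<bar>(T - x) - y\<bar> powr (2 - 2 * H)) \<partial>lborel)" for x
    by (subst (2) nn_integral_real_affine[where c = "- 1" and t = T]) (auto simp: abs_minus_commute)
  show ?thesis
    unfolding gagliardo_def inner
    by (subst (2) nn_integral_real_affine[where c = "- 1" and t = T]) auto
qed

lemma zero_ext_reflect: "zero_ext T (\<lambda>r. q (T - r)) x = zero_ext T q (T - x)"
  by (simp add: zero_ext_def)

lemma integrand_norm2_reflect:
  assumes q: "sq_integrable T q" and xs: "step_list T xs"
  shows "integrand_norm2 H T (\<lambda>r. step_fun (step_reflect T xs) r - q (T - r)) = integrand_norm2 H T (\<lambda>r. step_fun xs r - q r)"
proof -
  obtain q' where [measurable]: "q' \<in> borel_measurable borel" and supp: "\<And>x. x \<notin> {0..T} \<Longrightarrow> q' x = 0"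
    and eq: "AE x in lborel. zero_ext T q x = q' x"
    using sq_integrable_borel_rep[OF q] by blast
  define p where "p x = step_fun xs x - q' x" for x
  have [measurable]: "p \<in> borel_measurable borel" unfolding p_def by measurable
  have pt: "AE x in lborel. zero_ext T (\<lambda>r. step_fun xs r - q r) x = p x"
    unfolding p_def by (rule AE_zero_ext_step_fun_minus[OF xs supp eq])
  have "AE x in lborel. zero_ext T (\<lambda>r. step_fun (step_reflect T xs) r - q (T - r)) x = p (T - x)"
    using AE_lborel_reflect[OF pt, of T] step_fun_reflect[of T xs]
    by eventually_elim (auto simp: zero_ext_def)
  then show ?thesis
    using integrand_norm2_eq[OF _ pt, of H] integrand_norm2_eq[of "\<lambda>x. p (T - x)" T _ H]
    by (simp add: sq_norm_reflect gagliardo_reflect)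
qed

lemma sq_integrable_reflect:
  assumes q: "sq_integrable T q"
  shows "sq_integrable T (\<lambda>r. q (T - r))"
proof -
  obtain q' where [measurable]: "q' \<in> borel_measurable borel" and supp: "\<And>x. x \<notin> {0..T} \<Longrightarrow> q' x = 0"
    and eq: "AE x in lborel. zero_ext T q x = q' x" and norm: "sq_norm lborel q' = ennreal ((L2_norm T q)\<^sup>2)"
    using sq_integrable_borel_rep[OF q] by blast
  have eq': "AE x in lborel. zero_ext T (\<lambda>r. q (T - r)) x = q' (T - x)"
    using AE_lborel_reflect[OF eq, of T] by (simp add: zero_ext_reflect)
  have "zero_ext T (\<lambda>r. q (T - r)) \<in> borel_measurable lebesgue"
    by (rule lebesgue_measurable_cong_AE[OF _ eq']) measurable
  then have meas: "(\<lambda>r. q (T - r)) \<in> borel_measurable (lebesgue_on {0..T})"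
    by (subst borel_measurable_if[symmetric]) (auto simp: zero_ext_def[abs_def])
  have "sq_norm lborel (\<lambda>x. q' (T - x)) < \<infinity>" by (simp add: sq_norm_reflect norm)
  then have "integrable lborel (\<lambda>x. (q' (T - x))\<^sup>2)" by (simp add: integrable_sq_iff)
  then have "integrable lebesgue (\<lambda>x. (q' (T - x))\<^sup>2)" by (subst integrable_completion) auto
  moreover have "AE x in lebesgue. (q' (T - x))\<^sup>2 = indicator {0..T} x *\<^sub>R (q (T - x))\<^sup>2"
    using AE_completion[OF eq'] by eventually_elim (auto simp: zero_ext_def indicator_def split: if_splits)
  moreover have "(\<lambda>x. indicator {0..T} x *\<^sub>R (q (T - x))\<^sup>2) \<in> borel_measurable lebesgue"
  proof -
    have "AE x in lborel. indicator {0..T} x *\<^sub>R (q (T - x))\<^sup>2 = (q' (T - x))\<^sup>2"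
      using eq' by eventually_elim (auto simp: zero_ext_def indicator_def split: if_splits)
    then show ?thesis by (rule lebesgue_measurable_cong_AE[rotated]) measurable
  qed
  ultimately have "integrable lebesgue (\<lambda>x. indicator {0..T} x *\<^sub>R (q (T - x))\<^sup>2)"
    using integrable_cong_AE_imp by blast
  then have "integrable (lebesgue_on {0..T}) (\<lambda>x. (q (T - x))\<^sup>2)"
    by (subst integrable_restrict_space) auto
  with meas show ?thesis by (simp add: sq_integrable_def)
qed

lemma integral_mult_le_of_sq_norm_le:
  assumes [measurable]: "X \<in> borel_measurable N" "Y \<in> borel_measurable N"
    and X: "sq_norm N X \<le> ennreal (C * x\<^sup>2)" and Y: "sq_norm N Y \<le> ennreal (C * y\<^sup>2)"
    and "0 \<le> C" "0 \<le> x" "0 \<le> y"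
  shows "(LINT \<omega>|N. X \<omega> * Y \<omega>) \<le> C * x * y"
proof -
  have "(ennreal \<bar>LINT \<omega>|N. X \<omega> * Y \<omega>\<bar>)\<^sup>2 \<le> sq_norm N X * sq_norm N Y"
    by (rule integral_mult_sq_le) measurable
  also have "\<dots> \<le> ennreal (C * x\<^sup>2) * ennreal (C * y\<^sup>2)" by (intro mult_mono X Y) auto
  also have "\<dots> = ennreal ((C * x * y)\<^sup>2)"
    using assms by (subst ennreal_mult[symmetric]) (auto simp: power2_eq_square mult_ac)
  finally have "\<bar>LINT \<omega>|N. X \<omega> * Y \<omega>\<bar>\<^sup>2 \<le> (C * x * y)\<^sup>2"
    by (simp add: ennreal_power)
  then have "\<bar>LINT \<omega>|N. X \<omega> * Y \<omega>\<bar> \<le> C * x * y"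
    by (rule power2_le_imp_le) (use assms in auto)
  then show ?thesis by simp
qed

theorem lemma2p4:
  fixes M :: "'a measure" and W :: "real \<Rightarrow> 'a \<Rightarrow> real" and H T :: real
  assumes "0 < T" and "0 < H" and "H < 1"
    and "prob_space M" and "complete_measure M"
    and "fractional_brownian_motion M H W"
  shows "\<exists>C>0. \<forall>q1 q2 g1 g2.
    sq_integrable T q1 \<and> sq_integrable T q2 \<and>
    has_RL T ((1 - 2 * H) / 2) q1 g1 \<and> has_RL T ((1 - 2 * H) / 2) q2 g2 \<and>
    sq_integrable T g1 \<and> sq_integrable T g2 \<longrightarrow>
    (LINT \<omega>|M. wiener_integral M W H T q1 \<omega> * wiener_integral M W H T q2 \<omega>)
      \<le> C * L2_norm T g1 * L2_norm T g2 \<and>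
    (LINT \<omega>|M. wiener_integral M W H T (\<lambda>r. q1 (T - r)) \<omega>
              * wiener_integral M W H T (\<lambda>r. q2 (T - r)) \<omega>)
      \<le> C * L2_norm T g1 * L2_norm T g2"
proof -
  note H = \<open>0 < H\<close> \<open>H < 1\<close> and fbm = \<open>prob_space M\<close> \<open>0 < H\<close> \<open>H < 1\<close> \<open>fractional_brownian_motion M H W\<close>
  obtain C where C: "0 < C"
    "\<And>T xs. step_list T xs \<Longrightarrow> ennreal (fbm_energy H xs) \<le> ennreal C * sq_norm lborel (zero_ext T (step_RL H xs))"
    using energy_le_sq_norm_RL[OF H] by blast
  have main: "wiener_integral M W H T q \<in> borel_measurable M \<and>
      sq_norm M (wiener_integral M W H T q) \<le> ennreal (8 * C * (L2_norm T g)\<^sup>2) \<and>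
      wiener_integral M W H T (\<lambda>r. q (T - r)) \<in> borel_measurable M \<and>
      sq_norm M (wiener_integral M W H T (\<lambda>r. q (T - r))) \<le> ennreal (8 * C * (L2_norm T g)\<^sup>2)"
    if q: "sq_integrable T q" and RL: "has_RL T ((1 - 2 * H) / 2) q g" and g: "sq_integrable T g" for q g
  proof -
    obtain c ys where c: "0 \<le> c" and ys: "\<And>n. step_list T (ys n)"
      and approx: "\<And>n. integrand_norm2 H T (\<lambda>r. step_fun (ys n) r - q r) \<le> ennreal (c * (1 / 4) ^ n)"
      and RL_bound: "\<And>n. sq_norm lborel (zero_ext T (step_RL H (ys n))) \<le> ennreal (c * (1 / 4) ^ n + 2 * (L2_norm T g)\<^sup>2)"
      using RL_step_approximation[OF \<open>0 < T\<close> H q g RL] by blast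
    define d where "d n = C * (c * (1 / 4) ^ n + 2 * (L2_norm T g)\<^sup>2)" for n
    have energy: "ennreal (fbm_energy H (ys n)) \<le> ennreal (d n)" for n
    proof -
      have "ennreal (fbm_energy H (ys n)) \<le> ennreal C * ennreal (c * (1 / 4) ^ n + 2 * (L2_norm T g)\<^sup>2)"
        by (rule order_trans[OF C(2)[OF ys]]) (intro mult_left_mono RL_bound, simp)
      also have "\<dots> = ennreal (d n)" using C(1) by (simp add: d_def ennreal_mult' del: ennreal_plus)
      finally show ?thesis .
    qed
    have d: "d \<longlonglongrightarrow> C * (c * 0 + 2 * (L2_norm T g)\<^sup>2)"
      unfolding d_def by (intro tendsto_intros LIMSEQ_power_zero) simp
    have const: "4 * (C * (c * 0 + 2 * (L2_norm T g)\<^sup>2)) = 8 * C * (L2_norm T g)\<^sup>2" by simp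
    have approx': "integrand_norm2 H T (\<lambda>r. step_fun (step_reflect T (ys n)) r - q (T - r)) \<le> ennreal (c * (1 / 4) ^ n)" for n
      using approx by (simp add: integrand_norm2_reflect[OF q ys])
    have energy': "ennreal (fbm_energy H (step_reflect T (ys n))) \<le> ennreal (d n)" for n
      using energy by (simp add: fbm_energy_reflect)
    show ?thesis
      using wiener_integral_sq_norm_le[OF fbm q c ys approx energy d]
        wiener_integral_sq_norm_le[OF fbm sq_integrable_reflect[OF q] c step_list_reflect[OF ys] approx' energy' d]
      unfolding const by blast
  qed
  show ?thesis
  proof (intro exI[of _ "8 * C"] conjI allI impI)
    show "0 < 8 * C" using C(1) by simp
    fix q1 q2 g1 g2
    assume a: "sq_integrable T q1 \<and> sq_integrable T q2 \<and>
      has_RL T ((1 - 2 * H) / 2) q1 g1 \<and> has_RL T ((1 - 2 * H) / 2) q2 g2 \<and>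
      sq_integrable T g1 \<and> sq_integrable T g2"
    have nn: "0 \<le> L2_norm T g1" "0 \<le> L2_norm T g2" by (simp_all add: L2_norm_def)
    note 1 = main[of q1 g1] and 2 = main[of q2 g2]
    show "(LINT \<omega>|M. wiener_integral M W H T q1 \<omega> * wiener_integral M W H T q2 \<omega>)
      \<le> 8 * C * L2_norm T g1 * L2_norm T g2"
      by (rule integral_mult_le_of_sq_norm_le) (use a 1 2 nn C(1) in auto)
    show "(LINT \<omega>|M. wiener_integral M W H T (\<lambda>r. q1 (T - r)) \<omega> * wiener_integral M W H T (\<lambda>r. q2 (T - r)) \<omega>)
      \<le> 8 * C * L2_norm T g1 * L2_norm T g2"
      by (rule integral_mult_le_of_sq_norm_le) (use a 1 2 nn C(1) in auto)
  qed
qed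

end
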